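(* On the class of all Banach algebras $R_c\leqslant\operatorname{Rad}^t\leqslant R_f$; that is, for every Banach algebra $A$, $$R_c(A)\subset\operatorname{Rad}^t(A)\subset R_f(A).$$
   Context: All algebras are complex and associative. For a normed algebra $A$, $\mathcal{M}_f(A)$ and $\mathcal{M}_c(A)$ are the classes of all (nonempty) finite and precompact (totally bounded) subsets of $A$, respectively. For bounded $M\subset A$, $\|M\|=\sup_{a\in M}\|a\|$, $M^n=\{a_1\cdots a_n: a_i\in M\}$, and $\rho(M)=\inf_n\|M^n\|^{1/n}=\lim_n\|M^n\|^{1/n}$ (the joint spectral radius). For $\ast\in\{f,c\}$, $$R_\ast(A)=\{a\in A:\ \rho(\{a\}\cup M)=\rho(M)\ \text{ for all } M\in\mathcal{M}_\ast(A)\}.$$ $A\widehat{\otimes}B$ is the projective tensor product of Banach algebras, a Banach algebra with $(a\otimes b)(c\otimes d)=ac\otimes bd$; $\operatorname{Rad}$ is the Jacobson radical of a Banach algebra; and $$\operatorname{Rad}^t(A)=\{a\in A:\ a\otimes b\in\operatorname{Rad}(A\widehat{\otimes}B)\ \text{ for all Banach algebras } B \text{ and all } b\in B\}.$$ *)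

theory Defs
  imports "HOL-Analysis.Analysis" "HOL-Algebra.Module" "HOL-Algebra.Coset"
    "HOL-Algebra.Algebraic_Closure_Type"
begin

section \<open>Complex Banach algebras\<close>

text \<open>
  Algebras are complex and associative but need not have a unit: the field \<open>one\<close>, which the record
  inherits from the library's modules, is never mentioned below.
\<close>

record 'a nalg = "(complex, 'a) module" +
  anorm :: "'a \<Rightarrow> real"

abbreviation complex_field :: "complex ring" where
  "complex_field \<equiv> ring_of_type_algebra"

text \<open>The distance is set to \<open>0\<close> off the carrier because \<^locale>\<open>Metric_space\<close> demands symmetry and
  nonnegativity on the whole type.\<close>

definition ndist :: "'a nalg \<Rightarrow> 'a \<Rightarrow> 'a \<Rightarrow> real" where
  "ndist A x y = (if x \<in> carrier A \<and> y \<in> carrier A then anorm A (x \<ominus>\<^bsub>A\<^esub> y) else 0)"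

locale normed_algebra = module complex_field A for A :: "'a nalg" (structure) +
  assumes mult_closed: "\<lbrakk>x \<in> carrier A; y \<in> carrier A\<rbrakk> \<Longrightarrow> x \<otimes> y \<in> carrier A"
    and mult_assoc:
      "\<lbrakk>x \<in> carrier A; y \<in> carrier A; z \<in> carrier A\<rbrakk> \<Longrightarrow> (x \<otimes> y) \<otimes> z = x \<otimes> (y \<otimes> z)"
    and mult_add_left:
      "\<lbrakk>x \<in> carrier A; y \<in> carrier A; z \<in> carrier A\<rbrakk> \<Longrightarrow> (x \<oplus> y) \<otimes> z = x \<otimes> z \<oplus> y \<otimes> z"
    and mult_add_right:
      "\<lbrakk>x \<in> carrier A; y \<in> carrier A; z \<in> carrier A\<rbrakk> \<Longrightarrow> x \<otimes> (y \<oplus> z) = x \<otimes> y \<oplus> x \<otimes> z"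
    and mult_smult_left:
      "\<lbrakk>x \<in> carrier A; y \<in> carrier A\<rbrakk> \<Longrightarrow> (c \<odot> x) \<otimes> y = c \<odot> (x \<otimes> y)"
    and mult_smult_right:
      "\<lbrakk>x \<in> carrier A; y \<in> carrier A\<rbrakk> \<Longrightarrow> x \<otimes> (c \<odot> y) = c \<odot> (x \<otimes> y)"
    and anorm_nonneg: "x \<in> carrier A \<Longrightarrow> 0 \<le> anorm A x"
    and anorm_eq_zero: "x \<in> carrier A \<Longrightarrow> anorm A x = 0 \<longleftrightarrow> x = \<zero>"
    and anorm_add: "\<lbrakk>x \<in> carrier A; y \<in> carrier A\<rbrakk> \<Longrightarrow> anorm A (x \<oplus> y) \<le> anorm A x + anorm A y"
    and anorm_smult: "x \<in> carrier A \<Longrightarrow> anorm A (c \<odot> x) = cmod c * anorm A x"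
    and anorm_mult: "\<lbrakk>x \<in> carrier A; y \<in> carrier A\<rbrakk> \<Longrightarrow> anorm A (x \<otimes> y) \<le> anorm A x * anorm A y"

locale banach_algebra = normed_algebra +
  assumes complete: "Metric_space.mcomplete (carrier A) (ndist A)"


section \<open>The joint spectral radius and the sets \<open>R\<^sub>f\<close>, \<open>R\<^sub>c\<close>\<close>

definition set_norm :: "'a nalg \<Rightarrow> 'a set \<Rightarrow> real" where
  "set_norm A M = (SUP x\<in>M. anorm A x)"

text \<open>Meaningful for \<open>n \<ge> 1\<close> only, since \<open>A\<close> may have no unit.\<close>

definition set_power :: "'a nalg \<Rightarrow> 'a set \<Rightarrow> nat \<Rightarrow> 'a set" where
  "set_power A M n = ((\<lambda>P. P <#>\<^bsub>A\<^esub> M) ^^ (n - 1)) M"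

definition joint_spectral_radius :: "'a nalg \<Rightarrow> 'a set \<Rightarrow> real" where
  "joint_spectral_radius A M = (INF n\<in>{1..}. root n (set_norm A (set_power A M n)))"

definition finite_sets :: "'a nalg \<Rightarrow> 'a set set" where
  "finite_sets A = {M. M \<noteq> {} \<and> M \<subseteq> carrier A \<and> finite M}"

definition precompact_sets :: "'a nalg \<Rightarrow> 'a set set" where
  "precompact_sets A =
     {M. M \<noteq> {} \<and> M \<subseteq> carrier A \<and> Metric_space.mtotally_bounded (carrier A) (ndist A) M}"

definition R_f :: "'a nalg \<Rightarrow> 'a set" where
  "R_f A = {a \<in> carrier A. \<forall>M\<in>finite_sets A.
              joint_spectral_radius A ({a} \<union> M) = joint_spectral_radius A M}"

definition R_c :: "'a nalg \<Rightarrow> 'a set" where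
  "R_c A = {a \<in> carrier A. \<forall>M\<in>precompact_sets A.
              joint_spectral_radius A ({a} \<union> M) = joint_spectral_radius A M}"


section \<open>The Jacobson radical\<close>

text \<open>The intersection of all maximal modular left ideals (the whole algebra if there are none).\<close>

definition left_ideal :: "'a nalg \<Rightarrow> 'a set \<Rightarrow> bool" where
  "left_ideal A L \<longleftrightarrow>
     submodule L complex_field A \<and> (\<forall>x\<in>carrier A. \<forall>y\<in>L. x \<otimes>\<^bsub>A\<^esub> y \<in> L)"

definition modular_left_ideal :: "'a nalg \<Rightarrow> 'a set \<Rightarrow> bool" where
  "modular_left_ideal A L \<longleftrightarrow>
     left_ideal A L \<and> (\<exists>u\<in>carrier A. \<forall>x\<in>carrier A. x \<ominus>\<^bsub>A\<^esub> x \<otimes>\<^bsub>A\<^esub> u \<in> L)"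

definition maximal_modular_left_ideal :: "'a nalg \<Rightarrow> 'a set \<Rightarrow> bool" where
  "maximal_modular_left_ideal A L \<longleftrightarrow>
     modular_left_ideal A L \<and> L \<noteq> carrier A \<and>
     (\<forall>J. left_ideal A J \<and> L \<subseteq> J \<and> J \<noteq> carrier A \<longrightarrow> J = L)"

definition jacobson_radical :: "'a nalg \<Rightarrow> 'a set" where
  "jacobson_radical A = {x \<in> carrier A. \<forall>L. maximal_modular_left_ideal A L \<longrightarrow> x \<in> L}"


section \<open>The projective tensor product\<close>

subsection \<open>The algebraic tensor product with the projective norm\<close>

definition bilinear_forms :: "'a nalg \<Rightarrow> 'b nalg \<Rightarrow> ('a \<Rightarrow> 'b \<Rightarrow> complex) set" where
  "bilinear_forms A B = {\<phi>.
     (\<forall>x\<in>carrier A. \<forall>x'\<in>carrier A. \<forall>y\<in>carrier B. \<phi> (x \<oplus>\<^bsub>A\<^esub> x') y = \<phi> x y + \<phi> x' y) \<and>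
     (\<forall>x\<in>carrier A. \<forall>y\<in>carrier B. \<forall>y'\<in>carrier B. \<phi> x (y \<oplus>\<^bsub>B\<^esub> y') = \<phi> x y + \<phi> x y') \<and>
     (\<forall>c. \<forall>x\<in>carrier A. \<forall>y\<in>carrier B. \<phi> (c \<odot>\<^bsub>A\<^esub> x) y = c * \<phi> x y) \<and>
     (\<forall>c. \<forall>x\<in>carrier A. \<forall>y\<in>carrier B. \<phi> x (c \<odot>\<^bsub>B\<^esub> y) = c * \<phi> x y)}"

text \<open>
  The algebraic tensor product is realised inside the dual of the space of bilinear forms, with
  \<open>x \<otimes> y\<close> the evaluation \<open>\<phi> \<mapsto> \<phi> x y\<close>; this is the usual tensor product since the bilinear forms on
  \<open>A \<times> B\<close> separate its points. Functionals are \<open>0\<close> outside the bilinear forms, so that equality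
  of functionals is equality of tensors.
\<close>

type_synonym ('a, 'b) tensor = "('a \<Rightarrow> 'b \<Rightarrow> complex) \<Rightarrow> complex"

definition simple_tensor :: "'a nalg \<Rightarrow> 'b nalg \<Rightarrow> 'a \<Rightarrow> 'b \<Rightarrow> ('a, 'b) tensor" where
  "simple_tensor A B x y = (\<lambda>\<phi>. if \<phi> \<in> bilinear_forms A B then \<phi> x y else 0)"

definition tensor_sum :: "'a nalg \<Rightarrow> 'b nalg \<Rightarrow> ('a \<times> 'b) list \<Rightarrow> ('a, 'b) tensor" where
  "tensor_sum A B xys = (\<lambda>\<phi>. \<Sum>(x, y)\<leftarrow>xys. simple_tensor A B x y \<phi>)"

text \<open>
  The multiplication is the bilinear extension of
  \<open>(x \<otimes> y)(x' \<otimes> y') = (x x') \<otimes> (y y')\<close> (see \<open>simple_tensor_mult\<close>), written without choosing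
  representations of the factors. The norm is the projective norm, the infimum of
  \<open>\<Sum>\<^sub>i \<parallel>x\<^sub>i\<parallel> \<parallel>y\<^sub>i\<parallel>\<close> over all representations \<open>u = \<Sum>\<^sub>i x\<^sub>i \<otimes> y\<^sub>i\<close>.
\<close>

definition algebraic_tensor :: "'a nalg \<Rightarrow> 'b nalg \<Rightarrow> ('a, 'b) tensor nalg" where
  "algebraic_tensor A B =
    \<lparr>carrier = {tensor_sum A B xys |xys. set xys \<subseteq> carrier A \<times> carrier B},
     mult = (\<lambda>u v \<phi>. if \<phi> \<in> bilinear_forms A B
               then u (\<lambda>x y. v (\<lambda>x' y'. \<phi> (x \<otimes>\<^bsub>A\<^esub> x') (y \<otimes>\<^bsub>B\<^esub> y'))) else 0),
     one = undefined,
     zero = (\<lambda>\<phi>. 0),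
     add = (\<lambda>u v \<phi>. u \<phi> + v \<phi>),
     smult = (\<lambda>c u \<phi>. c * u \<phi>),
     anorm = (\<lambda>u. Inf {\<Sum>(x, y)\<leftarrow>xys. anorm A x * anorm B y |xys.
                set xys \<subseteq> carrier A \<times> carrier B \<and> tensor_sum A B xys = u})\<rparr>"

lemma simple_tensor_mult:
  fixes A :: "'a nalg" and B :: "'b nalg"
  assumes A: "normed_algebra A" and B: "normed_algebra B"
    and x: "x \<in> carrier A" "x' \<in> carrier A" and y: "y \<in> carrier B" "y' \<in> carrier B"
  shows "simple_tensor A B x y \<otimes>\<^bsub>algebraic_tensor A B\<^esub> simple_tensor A B x' y' =
         simple_tensor A B (x \<otimes>\<^bsub>A\<^esub> x') (y \<otimes>\<^bsub>B\<^esub> y')"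
proof -
  interpret A: normed_algebra A by fact
  interpret B: normed_algebra B by fact
  note simps = A.mult_closed B.mult_closed A.mult_add_left B.mult_add_left
    A.mult_add_right B.mult_add_right A.mult_smult_left B.mult_smult_left
    A.mult_smult_right B.mult_smult_right
  have smult: "c \<odot>\<^bsub>A\<^esub> z \<in> carrier A" if "z \<in> carrier A" for c z
    using A.smult_closed[of c z] that by (simp add: ring_of_type_algebra_def)
  have smult': "c \<odot>\<^bsub>B\<^esub> z \<in> carrier B" if "z \<in> carrier B" for c z
    using B.smult_closed[of c z] that by (simp add: ring_of_type_algebra_def)
  have inner: "(\<lambda>x' y'. \<phi> (z \<otimes>\<^bsub>A\<^esub> x') (w \<otimes>\<^bsub>B\<^esub> y')) \<in> bilinear_forms A B"
    if "\<phi> \<in> bilinear_forms A B" "z \<in> carrier A" "w \<in> carrier B" for \<phi> z w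
    using that by (auto simp: bilinear_forms_def simps)
  have outer: "(\<lambda>x y. simple_tensor A B x' y' (\<lambda>x' y'. \<phi> (x \<otimes>\<^bsub>A\<^esub> x') (y \<otimes>\<^bsub>B\<^esub> y')))
      \<in> bilinear_forms A B" (is "?\<psi> \<in> _") if \<phi>: "\<phi> \<in> bilinear_forms A B" for \<phi>
  proof -
    have eq: "?\<psi> z w = \<phi> (z \<otimes>\<^bsub>A\<^esub> x') (w \<otimes>\<^bsub>B\<^esub> y')" if "z \<in> carrier A" "w \<in> carrier B" for z w
      using inner[OF \<phi> that] by (simp add: simple_tensor_def)
    have cong: "f \<in> bilinear_forms A B"
      if "g \<in> bilinear_forms A B" "\<And>z w. z \<in> carrier A \<Longrightarrow> w \<in> carrier B \<Longrightarrow> f z w = g z w" for f g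
      using that smult smult' by (simp add: bilinear_forms_def)
    have "(\<lambda>z w. \<phi> (z \<otimes>\<^bsub>A\<^esub> x') (w \<otimes>\<^bsub>B\<^esub> y')) \<in> bilinear_forms A B"
      using \<phi> x y by (auto simp: bilinear_forms_def simps)
    then show ?thesis
      by (rule cong) (rule eq)
  qed
  show ?thesis
    using inner outer x y by (auto simp: algebraic_tensor_def simple_tensor_def fun_eq_iff)
qed


subsection \<open>Completion\<close>

text \<open>Cauchy sequences modulo null sequences.\<close>

definition cauchy_seqs :: "'a nalg \<Rightarrow> (nat \<Rightarrow> 'a) set" where
  "cauchy_seqs A = {s. range s \<subseteq> carrier A \<and>
     (\<forall>e>0. \<exists>N. \<forall>m\<ge>N. \<forall>n\<ge>N. anorm A (s m \<ominus>\<^bsub>A\<^esub> s n) < e)}"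

definition cauchy_class :: "'a nalg \<Rightarrow> (nat \<Rightarrow> 'a) \<Rightarrow> (nat \<Rightarrow> 'a) set" where
  "cauchy_class A s = {t \<in> cauchy_seqs A. (\<lambda>n. anorm A (s n \<ominus>\<^bsub>A\<^esub> t n)) \<longlonglongrightarrow> 0}"

definition completion :: "'a nalg \<Rightarrow> (nat \<Rightarrow> 'a) set nalg" where
  "completion A =
    \<lparr>carrier = cauchy_class A ` cauchy_seqs A,
     mult = (\<lambda>S T. \<Union>s\<in>S. \<Union>t\<in>T. cauchy_class A (\<lambda>n. s n \<otimes>\<^bsub>A\<^esub> t n)),
     one = undefined,
     zero = cauchy_class A (\<lambda>n. \<zero>\<^bsub>A\<^esub>),
     add = (\<lambda>S T. \<Union>s\<in>S. \<Union>t\<in>T. cauchy_class A (\<lambda>n. s n \<oplus>\<^bsub>A\<^esub> t n)),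
     smult = (\<lambda>c S. \<Union>s\<in>S. cauchy_class A (\<lambda>n. c \<odot>\<^bsub>A\<^esub> s n)),
     anorm = (\<lambda>S. THE r. \<forall>s\<in>S. (\<lambda>n. anorm A (s n)) \<longlonglongrightarrow> r)\<rparr>"

definition projective_tensor ::
    "'a nalg \<Rightarrow> 'b nalg \<Rightarrow> (nat \<Rightarrow> ('a, 'b) tensor) set nalg" where
  "projective_tensor A B = completion (algebraic_tensor A B)"

definition elementary_tensor ::
    "'a nalg \<Rightarrow> 'b nalg \<Rightarrow> 'a \<Rightarrow> 'b \<Rightarrow> (nat \<Rightarrow> ('a, 'b) tensor) set" where
  "elementary_tensor A B x y = cauchy_class (algebraic_tensor A B) (\<lambda>n. simple_tensor A B x y)"


section \<open>The tensor radical\<close>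

text \<open>
  HOL cannot quantify over all types inside a formula, so \<open>B\<close> ranges over all Banach algebras whose
  carrier is a subset of the type \<open>'u\<close>, which plays the role of a universe. A nonzero complex algebra
  has at least continuum many elements, so a type \<open>'u\<close> into which the reals do not inject
  carries only zero algebras. As soon as they do inject, \<open>'u\<close> carries a copy of every separable
  Banach algebra. Those already determine the radical, because an element of \<open>A \<otimes> B\<close>
  involves only a separable closed subalgebra of \<open>B\<close>.
\<close>

definition tensor_radical :: "'u itself \<Rightarrow> 'a nalg \<Rightarrow> 'a set" where
  "tensor_radical U A = {a \<in> carrier A. \<forall>(B :: 'u nalg) b.
     banach_algebra B \<longrightarrow> b \<in> carrier B \<longrightarrow>
     elementary_tensor A B a b \<in> jacobson_radical (projective_tensor A B)}"

end

theory Submission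
  imports Defs
begin

text \<open>
  \<^bold>\<open>The first inclusion.\<close> Every \<open>T\<close> in the projective tensor product is a sum
  \<open>\<Sum>\<^sub>i x\<^sub>i \<otimes> y\<^sub>i\<close> in which the \<open>x\<^sub>i\<close> tend to \<open>0\<close> and \<open>\<Sum>\<^sub>i \<parallel>y\<^sub>i\<parallel> < \<infinity>\<close>
  (\<open>bounded_representation\<close>), so the \<open>x\<^sub>i\<close> lie in a precompact set \<open>M\<close>. Expanding the power
  yields \<open>\<parallel>(T (a \<otimes> b))\<^sup>n\<parallel> \<le> \<parallel>(M a)\<^sup>n\<parallel> (\<parallel>b\<parallel> \<Sum>\<^sub>i \<parallel>y\<^sub>i\<parallel>)\<^sup>n\<close>. If \<open>a\<close> belongs to \<open>R_c A\<close>, then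
  \<open>M a\<close> has joint spectral radius \<open>0\<close> (\<open>R_c_small_powers\<close>). Hence \<open>T (a \<otimes> b)\<close> is quasinilpotent
  for every \<open>T\<close>, and this puts \<open>a \<otimes> b\<close> into every maximal modular left ideal.

  \<^bold>\<open>The second inclusion.\<close> Let \<open>M = {x\<^sub>1, \<dots>, x\<^sub>k}\<close>, let \<open>x\<^sub>0 = a\<close> belong to the tensor radical, and
  let \<open>s\<close> exceed the joint spectral radius of \<open>M\<close>. Write \<open>x\<^sub>w\<close> for the product of the letters
  \<open>x\<^sub>i\<close> along a word \<open>w\<close>. Take for \<open>B\<close> the \<open>l\<^sup>1\<close> algebra on words with the weight
  \<open>\<omega>(w) = max (\<parallel>x\<^sub>w\<parallel>, s^|w|)^p\<close> and free generators \<open>e\<^sub>i\<close>, and put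
  \<open>T = \<lambda>\<^sup>-\<^sup>1 \<Sum>\<^sub>i x\<^sub>i \<otimes> e\<^sub>i\<close>. The terms with \<open>i \<ge> 1\<close> have spectral radius at most
  \<open>k s^(p+1) / \<lambda>\<close>, and the term with \<open>i = 0\<close> lies in the Jacobson radical. So for
  \<open>\<lambda> > k s^(p+1)\<close> the element \<open>T\<close> is left quasi-regular: \<open>Y = T + Y T\<close> for some \<open>Y\<close>. Comparing
  coefficients shows that the coefficient of \<open>Y\<close> at \<open>w\<close> is \<open>\<lambda>^(-|w|) x\<^sub>w\<close>, and \<open>Y\<close> being an element
  of the tensor product this gives \<open>\<parallel>x\<^sub>w\<parallel>^(p+1) \<le> \<parallel>x\<^sub>w\<parallel> \<omega>(w) \<le> C \<lambda>^|w|\<close>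
  (\<open>tensor_radical_power_bound\<close>). Therefore the joint spectral radius \<open>\<rho>\<close> of \<open>{a} \<union> M\<close> satisfies
  \<open>\<rho>^(p+1) \<le> (k+1) s^(p+1)\<close>, and \<open>p \<rightarrow> \<infinity>\<close> removes the factor \<open>k+1\<close>. The weight is
  what makes this last step possible: summing norms over words costs a factor \<open>k\<close> per letter, and
  the weight raises everything else to the power \<open>p+1\<close>.

  The algebra \<open>B\<close> has the cardinality of the continuum, so an injection of the reals into a type
  is enough to find a copy of \<open>B\<close> on that type.
\<close>

section \<open>Seminormed algebras and their completions\<close>

lemma complex_field_simps [simp]:
  "carrier complex_field = UNIV" "x \<otimes>\<^bsub>complex_field\<^esub> y = x * y" "\<one>\<^bsub>complex_field\<^esub> = 1"
  "\<zero>\<^bsub>complex_field\<^esub> = 0" "x \<oplus>\<^bsub>complex_field\<^esub> y = x + y"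
  by (simp_all add: ring_of_type_algebra_def)

lemma cring_complex_field: "cring complex_field"
  by (rule cring_from_type_algebra)

text \<open>
  The projective norm on the algebraic tensor product enters only through the completion, which
  divides out the null space anyway; it is therefore treated as a seminorm.
\<close>

locale seminormed_algebra = module complex_field A for A :: "'a nalg" (structure) +
  assumes mult_closed [simp]: "\<lbrakk>x \<in> carrier A; y \<in> carrier A\<rbrakk> \<Longrightarrow> x \<otimes> y \<in> carrier A"
    and mult_assoc:
      "\<lbrakk>x \<in> carrier A; y \<in> carrier A; z \<in> carrier A\<rbrakk> \<Longrightarrow> (x \<otimes> y) \<otimes> z = x \<otimes> (y \<otimes> z)"
    and mult_add_left:
      "\<lbrakk>x \<in> carrier A; y \<in> carrier A; z \<in> carrier A\<rbrakk> \<Longrightarrow> (x \<oplus> y) \<otimes> z = x \<otimes> z \<oplus> y \<otimes> z"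
    and mult_add_right:
      "\<lbrakk>x \<in> carrier A; y \<in> carrier A; z \<in> carrier A\<rbrakk> \<Longrightarrow> x \<otimes> (y \<oplus> z) = x \<otimes> y \<oplus> x \<otimes> z"
    and mult_smult_left:
      "\<lbrakk>x \<in> carrier A; y \<in> carrier A\<rbrakk> \<Longrightarrow> (c \<odot> x) \<otimes> y = c \<odot> (x \<otimes> y)"
    and mult_smult_right:
      "\<lbrakk>x \<in> carrier A; y \<in> carrier A\<rbrakk> \<Longrightarrow> x \<otimes> (c \<odot> y) = c \<odot> (x \<otimes> y)"
    and anorm_nonneg [simp]: "x \<in> carrier A \<Longrightarrow> 0 \<le> anorm A x"
    and anorm_add: "\<lbrakk>x \<in> carrier A; y \<in> carrier A\<rbrakk> \<Longrightarrow> anorm A (x \<oplus> y) \<le> anorm A x + anorm A y"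
    and anorm_smult: "x \<in> carrier A \<Longrightarrow> anorm A (c \<odot> x) = cmod c * anorm A x"
    and anorm_mult: "\<lbrakk>x \<in> carrier A; y \<in> carrier A\<rbrakk> \<Longrightarrow> anorm A (x \<otimes> y) \<le> anorm A x * anorm A y"
begin

lemma smult_in [simp]: "x \<in> carrier A \<Longrightarrow> c \<odot> x \<in> carrier A"
  by (rule smult_closed) simp

lemma smult_zero_left [simp]: "x \<in> carrier A \<Longrightarrow> 0 \<odot> x = \<zero>"
  using smult_l_null[of x] by simp

lemma smult_zero_right [simp]: "c \<odot> \<zero> = \<zero>"
  using smult_r_null[of c] by simp

lemma smult_add: "x \<in> carrier A \<Longrightarrow> (c + d) \<odot> x = c \<odot> x \<oplus> d \<odot> x"
  using smult_l_distr[of c d x] by simp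

lemma smult_smult: "x \<in> carrier A \<Longrightarrow> c \<odot> (d \<odot> x) = (c * d) \<odot> x"
  using smult_assoc1[of c d x] by simp

lemma smult_1 [simp]: "x \<in> carrier A \<Longrightarrow> 1 \<odot> x = x"
  using smult_one[of x] by simp

lemma smult_distrib: "x \<in> carrier A \<Longrightarrow> y \<in> carrier A \<Longrightarrow> c \<odot> (x \<oplus> y) = c \<odot> x \<oplus> c \<odot> y"
  using smult_r_distr[of c x y] by simp

lemma smult_minus1: "x \<in> carrier A \<Longrightarrow> (-1) \<odot> x = \<ominus> x"
  using smult_add[of x "-1" 1] minus_equality[of "(-1) \<odot> x" x] by simp

lemma smult_minus: "x \<in> carrier A \<Longrightarrow> c \<odot> (\<ominus> x) = \<ominus> (c \<odot> x)"
  by (simp add: smult_smult flip: smult_minus1)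

lemma mult_minus_left: "x \<in> carrier A \<Longrightarrow> y \<in> carrier A \<Longrightarrow> (\<ominus> x) \<otimes> y = \<ominus> (x \<otimes> y)"
  by (simp add: mult_smult_left flip: smult_minus1)

lemma mult_minus_right: "x \<in> carrier A \<Longrightarrow> y \<in> carrier A \<Longrightarrow> x \<otimes> (\<ominus> y) = \<ominus> (x \<otimes> y)"
  by (simp add: mult_smult_right flip: smult_minus1)

lemma mult_diff_left:
  "\<lbrakk>x \<in> carrier A; y \<in> carrier A; z \<in> carrier A\<rbrakk> \<Longrightarrow> (x \<ominus> y) \<otimes> z = x \<otimes> z \<ominus> y \<otimes> z"
  by (simp add: minus_eq mult_add_left mult_minus_left)

lemma mult_diff_right:
  "\<lbrakk>x \<in> carrier A; y \<in> carrier A; z \<in> carrier A\<rbrakk> \<Longrightarrow> x \<otimes> (y \<ominus> z) = x \<otimes> y \<ominus> x \<otimes> z"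
  by (simp add: minus_eq mult_add_right mult_minus_right)

lemma smult_diff: "x \<in> carrier A \<Longrightarrow> y \<in> carrier A \<Longrightarrow> c \<odot> (x \<ominus> y) = c \<odot> x \<ominus> c \<odot> y"
  by (simp add: minus_eq smult_distrib smult_minus)

lemma mult_zero_left [simp]: "x \<in> carrier A \<Longrightarrow> \<zero> \<otimes> x = \<zero>"
  using mult_smult_left[of \<zero> x 0] by simp

lemma mult_zero_right [simp]: "x \<in> carrier A \<Longrightarrow> x \<otimes> \<zero> = \<zero>"
  using mult_smult_right[of x \<zero> 0] by simp

lemma diff_self [simp]: "x \<in> carrier A \<Longrightarrow> x \<ominus> x = \<zero>"
  by (simp add: minus_eq r_neg)

lemma diff_zero [simp]: "x \<in> carrier A \<Longrightarrow> x \<ominus> \<zero> = x"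
  by (simp add: minus_eq)

lemma minus_diff: "x \<in> carrier A \<Longrightarrow> y \<in> carrier A \<Longrightarrow> \<ominus> (x \<ominus> y) = y \<ominus> x"
  by (simp add: minus_eq minus_add a_comm)

lemma diff_add_diff:
  "\<lbrakk>x \<in> carrier A; y \<in> carrier A; z \<in> carrier A\<rbrakk> \<Longrightarrow> (x \<ominus> y) \<oplus> (y \<ominus> z) = x \<ominus> z"
  by (simp add: minus_eq a_assoc r_neg1 r_neg2)

lemma diff_add [simp]: "x \<in> carrier A \<Longrightarrow> y \<in> carrier A \<Longrightarrow> (x \<ominus> y) \<oplus> y = x"
  by (simp add: minus_eq a_assoc l_neg)

lemma diff_eq_zero: "x \<in> carrier A \<Longrightarrow> y \<in> carrier A \<Longrightarrow> x \<ominus> y = \<zero> \<longleftrightarrow> x = y"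
  by (metis diff_add diff_self l_zero)

lemma add_diff_add:
  "\<lbrakk>x \<in> carrier A; y \<in> carrier A; x' \<in> carrier A; y' \<in> carrier A\<rbrakk>
    \<Longrightarrow> (x \<oplus> y) \<ominus> (x' \<oplus> y') = (x \<ominus> x') \<oplus> (y \<ominus> y')"
  by (simp add: minus_eq minus_add a_ac)

lemma anorm_zero [simp]: "anorm A \<zero> = 0"
  using anorm_smult[of \<zero> 0] by simp

lemma anorm_minus [simp]: "x \<in> carrier A \<Longrightarrow> anorm A (\<ominus> x) = anorm A x"
  by (simp add: anorm_smult flip: smult_minus1)

lemma anorm_diff_commute:
  "x \<in> carrier A \<Longrightarrow> y \<in> carrier A \<Longrightarrow> anorm A (x \<ominus> y) = anorm A (y \<ominus> x)"
  by (metis anorm_minus minus_diff minus_closed)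

lemma anorm_diff_triangle:
  "\<lbrakk>x \<in> carrier A; y \<in> carrier A; z \<in> carrier A\<rbrakk>
    \<Longrightarrow> anorm A (x \<ominus> z) \<le> anorm A (x \<ominus> y) + anorm A (y \<ominus> z)"
  using anorm_add[of "x \<ominus> y" "y \<ominus> z"] by (simp add: diff_add_diff)

lemma anorm_diff_ge:
  "\<lbrakk>x \<in> carrier A; y \<in> carrier A\<rbrakk> \<Longrightarrow> \<bar>anorm A x - anorm A y\<bar> \<le> anorm A (x \<ominus> y)"
  using anorm_add[of "x \<ominus> y" y] anorm_add[of "y \<ominus> x" x] anorm_diff_commute[of x y] by auto

end

lemma normed_imp_seminormed:
  assumes "normed_algebra A" shows "seminormed_algebra A"
proof -
  interpret normed_algebra A by fact
  show ?thesis
    by unfold_locales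
      (simp_all add: mult_closed mult_assoc mult_add_left mult_add_right mult_smult_left
        mult_smult_right anorm_nonneg anorm_add anorm_smult anorm_mult)
qed

lemma (in seminormed_algebra) normed_algebraI:
  assumes "\<And>x. x \<in> carrier A \<Longrightarrow> anorm A x = 0 \<Longrightarrow> x = \<zero>"
  shows "normed_algebra A"
  using assms
  by unfold_locales
    (auto simp: mult_assoc mult_add_left mult_add_right mult_smult_left
      mult_smult_right anorm_add anorm_smult anorm_mult)

subsection \<open>Cauchy classes\<close>

context seminormed_algebra
begin

abbreviation "CS \<equiv> cauchy_seqs A"
abbreviation "cl \<equiv> cauchy_class A"
abbreviation "C \<equiv> completion A"

lemma CS_in: "s \<in> CS \<Longrightarrow> s n \<in> carrier A"
  by (auto simp: cauchy_seqs_def)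

lemma CS_D: "s \<in> CS \<Longrightarrow> e > 0 \<Longrightarrow> \<exists>N. \<forall>m\<ge>N. \<forall>n\<ge>N. anorm A (s m \<ominus> s n) < e"
  by (auto simp: cauchy_seqs_def)

lemma CS_I:
  assumes "\<And>n. s n \<in> carrier A" "\<And>e. e > 0 \<Longrightarrow> \<exists>N. \<forall>m\<ge>N. \<forall>n\<ge>N. anorm A (s m \<ominus> s n) < e"
  shows "s \<in> CS"
  using assms by (auto simp: cauchy_seqs_def)

lemma CS_bounded:
  assumes "s \<in> CS" obtains K where "K > 0" "\<And>n. anorm A (s n) \<le> K"
proof -
  note [simp] = CS_in[OF assms(1)]
  obtain N where N: "\<And>m n. m \<ge> N \<Longrightarrow> n \<ge> N \<Longrightarrow> anorm A (s m \<ominus> s n) < 1"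
    using CS_D[OF assms, of 1] by auto
  let ?K = "1 + (\<Sum>i\<le>N. anorm A (s i))"
  have nn: "0 \<le> anorm A (s i)" for i using assms by simp
  have le: "anorm A (s i) \<le> (\<Sum>i\<le>N. anorm A (s i))" if "i \<le> N" for i
    using that nn by (intro member_le_sum) auto
  have "anorm A (s n) \<le> ?K" for n
  proof (cases "n \<le> N")
    case True then show ?thesis using le[of n] by simp
  next
    case False
    then have "anorm A (s n \<ominus> s N) < 1" by (intro N) auto
    then show ?thesis using anorm_diff_ge[of "s n" "s N"] le[of N] assms by simp
  qed
  moreover have "?K > 0" using nn by (simp add: add_pos_nonneg sum_nonneg)
  ultimately show ?thesis using that by blast
qed

lemma CS_const [simp]: "x \<in> carrier A \<Longrightarrow> (\<lambda>n. x) \<in> CS"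
  by (rule CS_I) auto

lemma CS_add [simp]:
  assumes "s \<in> CS" "t \<in> CS" shows "(\<lambda>n. s n \<oplus> t n) \<in> CS"
proof -
  note [simp] = CS_in[OF assms(1)] CS_in[OF assms(2)]
  show ?thesis
  proof (rule CS_I)
    fix e :: real assume "e > 0"
    then obtain M N where "\<And>m n. m \<ge> M \<Longrightarrow> n \<ge> M \<Longrightarrow> anorm A (s m \<ominus> s n) < e/2"
      and "\<And>m n. m \<ge> N \<Longrightarrow> n \<ge> N \<Longrightarrow> anorm A (t m \<ominus> t n) < e/2"
      using CS_D[OF assms(1), of "e/2"] CS_D[OF assms(2), of "e/2"] by (meson half_gt_zero)
    then have "anorm A ((s m \<oplus> t m) \<ominus> (s n \<oplus> t n)) < e" if "m \<ge> max M N" "n \<ge> max M N" for m n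
      using anorm_add[of "s m \<ominus> s n" "t m \<ominus> t n"] that assms
      by (simp add: add_diff_add) (smt (verit) field_sum_of_halves)
    then show "\<exists>N. \<forall>m\<ge>N. \<forall>n\<ge>N. anorm A ((s m \<oplus> t m) \<ominus> (s n \<oplus> t n)) < e" by blast
  qed (use assms in simp)
qed

lemma mult_diff_mult:
  "\<lbrakk>x \<in> carrier A; y \<in> carrier A; x' \<in> carrier A; y' \<in> carrier A\<rbrakk>
    \<Longrightarrow> x \<otimes> y \<ominus> x' \<otimes> y' = (x \<ominus> x') \<otimes> y \<oplus> x' \<otimes> (y \<ominus> y')"
  by (simp add: mult_diff_left mult_diff_right diff_add_diff)

lemma anorm_mult_diff_le:
  assumes "x \<in> carrier A" "y \<in> carrier A" "x' \<in> carrier A" "y' \<in> carrier A"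
  shows "anorm A (x \<otimes> y \<ominus> x' \<otimes> y') \<le> anorm A (x \<ominus> x') * anorm A y + anorm A x' * anorm A (y \<ominus> y')"
  using anorm_add[of "(x \<ominus> x') \<otimes> y" "x' \<otimes> (y \<ominus> y')"] anorm_mult[of "x \<ominus> x'" y]
    anorm_mult[of x' "y \<ominus> y'"] assms
  by (simp add: mult_diff_mult)

lemma CS_mult [simp]:
  assumes "s \<in> CS" "t \<in> CS" shows "(\<lambda>n. s n \<otimes> t n) \<in> CS"
proof -
  note [simp] = CS_in[OF assms(1)] CS_in[OF assms(2)]
  show ?thesis
  proof (rule CS_I)
    fix e :: real assume e: "e > 0"
    obtain K where K: "K > 0" "\<And>n. anorm A (s n) \<le> K" using CS_bounded[OF assms(1)] by blast
    obtain L where L: "L > 0" "\<And>n. anorm A (t n) \<le> L" using CS_bounded[OF assms(2)] by blast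
    have "e / 2 / L > 0" "e / 2 / K > 0" using e K L by auto
    then obtain M N where M: "\<And>m n. m \<ge> M \<Longrightarrow> n \<ge> M \<Longrightarrow> anorm A (s m \<ominus> s n) < e/2/L"
      and N: "\<And>m n. m \<ge> N \<Longrightarrow> n \<ge> N \<Longrightarrow> anorm A (t m \<ominus> t n) < e/2/K"
      using CS_D[OF assms(1)] CS_D[OF assms(2)] by meson
    have "anorm A (s m \<otimes> t m \<ominus> s n \<otimes> t n) < e" if "m \<ge> max M N" "n \<ge> max M N" for m n
    proof -
      have 1: "anorm A (s m \<ominus> s n) * anorm A (t m) \<le> e/2/L * L"
        using M[of m n] that L assms e by (intro mult_mono) (auto intro: less_imp_le)
      have 2: "anorm A (s n) * anorm A (t m \<ominus> t n) < K * (e/2/K)"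
      proof (rule le_less_trans[OF mult_right_mono])
        show "anorm A (s n) \<le> K" by (rule K)
        show "0 \<le> anorm A (t m \<ominus> t n)" using assms by simp
        show "K * anorm A (t m \<ominus> t n) < K * (e/2/K)"
          using N[of m n] that K by (intro mult_strict_left_mono) auto
      qed
      have "e/2/L * L + K * (e/2/K) = e" using K L by simp
      then show ?thesis
        using anorm_mult_diff_le[of "s m" "t m" "s n" "t n"] 1 2 assms by simp
    qed
    then show "\<exists>N. \<forall>m\<ge>N. \<forall>n\<ge>N. anorm A (s m \<otimes> t m \<ominus> s n \<otimes> t n) < e" by blast
  qed (use assms in simp)
qed

lemma CS_smult [simp]:
  assumes "s \<in> CS" shows "(\<lambda>n. c \<odot> s n) \<in> CS"
proof -
  note [simp] = CS_in[OF assms(1)]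
  show ?thesis
  proof (rule CS_I)
    fix e :: real assume "e > 0"
    then have "e / (cmod c + 1) > 0" by (simp add: add_nonneg_pos)
    then obtain N where N: "\<And>m n. m \<ge> N \<Longrightarrow> n \<ge> N \<Longrightarrow> anorm A (s m \<ominus> s n) < e / (cmod c + 1)"
      using CS_D[OF assms] by meson
    have "anorm A (c \<odot> s m \<ominus> c \<odot> s n) < e" if "m \<ge> N" "n \<ge> N" for m n
    proof -
      have "anorm A (c \<odot> s m \<ominus> c \<odot> s n) = cmod c * anorm A (s m \<ominus> s n)"
        using assms anorm_smult[of "s m \<ominus> s n" c] by (simp add: smult_diff)
      also have "\<dots> \<le> (cmod c + 1) * anorm A (s m \<ominus> s n)"
        using assms by (intro mult_right_mono) auto
      also have "\<dots> < (cmod c + 1) * (e / (cmod c + 1))"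
        using N[OF that] by (intro mult_strict_left_mono) (auto simp: add_nonneg_pos)
      also have "\<dots> = e" by (simp add: add_nonneg_pos add_nonneg_eq_0_iff)
      finally show ?thesis .
    qed
    then show "\<exists>N. \<forall>m\<ge>N. \<forall>n\<ge>N. anorm A (c \<odot> s m \<ominus> c \<odot> s n) < e" by blast
  qed (use assms in simp)
qed

lemma CS_minus [simp]: "s \<in> CS \<Longrightarrow> (\<lambda>n. \<ominus> s n) \<in> CS"
  using CS_smult[of s "-1"] CS_in[of s] by (simp add: smult_minus1)

lemma CS_diff [simp]: "s \<in> CS \<Longrightarrow> t \<in> CS \<Longrightarrow> (\<lambda>n. s n \<ominus> t n) \<in> CS"
  by (simp add: minus_eq)

lemma CS_subseq:
  assumes "s \<in> CS" "strict_mono f" shows "(\<lambda>n. s (f n)) \<in> CS"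
proof -
  note [simp] = CS_in[OF assms(1)]
  show ?thesis
  proof (rule CS_I)
    fix e :: real assume "e > 0"
    then obtain N where N: "\<And>m n. m \<ge> N \<Longrightarrow> n \<ge> N \<Longrightarrow> anorm A (s m \<ominus> s n) < e"
      using CS_D[OF assms(1)] by meson
    have "f m \<ge> N" if "m \<ge> N" for m using that seq_suble[OF assms(2), of m] by simp
    then show "\<exists>N. \<forall>m\<ge>N. \<forall>n\<ge>N. anorm A (s (f m) \<ominus> s (f n)) < e" using N by blast
  qed (use assms in simp)
qed

lemma mem_cl: "t \<in> cl s \<longleftrightarrow> t \<in> CS \<and> (\<lambda>n. anorm A (s n \<ominus> t n)) \<longlonglongrightarrow> 0"
  by (simp add: cauchy_class_def)

lemma null_trans:
  assumes "s \<in> CS" "t \<in> CS" "u \<in> CS"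
    "(\<lambda>n. anorm A (s n \<ominus> t n)) \<longlonglongrightarrow> 0" "(\<lambda>n. anorm A (t n \<ominus> u n)) \<longlonglongrightarrow> 0"
  shows "(\<lambda>n. anorm A (s n \<ominus> u n)) \<longlonglongrightarrow> 0"
proof -
  note [simp] = CS_in[OF assms(1)] CS_in[OF assms(2)] CS_in[OF assms(3)]
  show ?thesis
  proof (rule tendsto_sandwich[OF _ _ tendsto_const])
    show "(\<lambda>n. anorm A (s n \<ominus> t n) + anorm A (t n \<ominus> u n)) \<longlonglongrightarrow> 0"
      using tendsto_add[OF assms(4,5)] by simp
  qed (use assms anorm_diff_triangle in \<open>auto intro!: always_eventually\<close>)
qed

lemma null_sym:
  assumes "s \<in> CS" "t \<in> CS"
  shows "(\<lambda>n. anorm A (s n \<ominus> t n)) \<longlonglongrightarrow> 0 \<longleftrightarrow> (\<lambda>n. anorm A (t n \<ominus> s n)) \<longlonglongrightarrow> 0"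
  using CS_in[OF assms(1)] CS_in[OF assms(2)] by (simp add: anorm_diff_commute)

lemma cl_eq_iff:
  assumes "s \<in> CS" "t \<in> CS"
  shows "cl s = cl t \<longleftrightarrow> (\<lambda>n. anorm A (s n \<ominus> t n)) \<longlonglongrightarrow> 0"
proof
  note [simp] = CS_in[OF assms(1)] CS_in[OF assms(2)]
  assume "cl s = cl t"
  moreover have "t \<in> cl t" using assms(2) by (simp add: mem_cl)
  ultimately have "t \<in> cl s" by simp
  then show "(\<lambda>n. anorm A (s n \<ominus> t n)) \<longlonglongrightarrow> 0" by (simp add: mem_cl)
next
  assume st: "(\<lambda>n. anorm A (s n \<ominus> t n)) \<longlonglongrightarrow> 0"
  then have ts: "(\<lambda>n. anorm A (t n \<ominus> s n)) \<longlonglongrightarrow> 0" using null_sym[OF assms] by blast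
  have "u \<in> cl s \<longleftrightarrow> u \<in> cl t" for u
    using null_trans[OF assms(1,2) _ st, of u] null_trans[OF assms(2,1) _ ts, of u]
    by (auto simp: mem_cl)
  then show "cl s = cl t" by blast
qed

lemma cl_mem_eq: "s \<in> CS \<Longrightarrow> t \<in> cl s \<Longrightarrow> t \<in> CS \<and> cl t = cl s"
  using cl_eq_iff[of s t] by (auto simp: mem_cl)

lemma cl_self: "s \<in> CS \<Longrightarrow> s \<in> cl s"
  using CS_in[of s] by (simp add: mem_cl)

lemma cl_add:
  assumes "s \<in> CS" "t \<in> CS" "s' \<in> CS" "t' \<in> CS" "cl s = cl s'" "cl t = cl t'"
  shows "cl (\<lambda>n. s n \<oplus> t n) = cl (\<lambda>n. s' n \<oplus> t' n)"
proof -
  note [simp] = CS_in[OF assms(1)] CS_in[OF assms(2)] CS_in[OF assms(3)] CS_in[OF assms(4)]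
  have "(\<lambda>n. anorm A ((s n \<oplus> t n) \<ominus> (s' n \<oplus> t' n))) \<longlonglongrightarrow> 0"
  proof (rule tendsto_sandwich[OF _ _ tendsto_const])
    have "(\<lambda>n. anorm A (s n \<ominus> s' n)) \<longlonglongrightarrow> 0" "(\<lambda>n. anorm A (t n \<ominus> t' n)) \<longlonglongrightarrow> 0"
      using assms cl_eq_iff by blast+
    then show "(\<lambda>n. anorm A (s n \<ominus> s' n) + anorm A (t n \<ominus> t' n)) \<longlonglongrightarrow> 0"
      using tendsto_add by fastforce
  qed (use assms anorm_add in \<open>auto intro!: always_eventually simp: add_diff_add\<close>)
  then show ?thesis using assms by (simp add: cl_eq_iff)
qed

lemma cl_mult:
  assumes "s \<in> CS" "t \<in> CS" "s' \<in> CS" "t' \<in> CS" "cl s = cl s'" "cl t = cl t'"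
  shows "cl (\<lambda>n. s n \<otimes> t n) = cl (\<lambda>n. s' n \<otimes> t' n)"
proof -
  note [simp] = CS_in[OF assms(1)] CS_in[OF assms(2)] CS_in[OF assms(3)] CS_in[OF assms(4)]
  obtain K where K: "K > 0" "\<And>n. anorm A (s' n) \<le> K" using CS_bounded[OF assms(3)] by blast
  obtain L where L: "L > 0" "\<And>n. anorm A (t n) \<le> L" using CS_bounded[OF assms(2)] by blast
  have "(\<lambda>n. anorm A (s n \<otimes> t n \<ominus> s' n \<otimes> t' n)) \<longlonglongrightarrow> 0"
  proof (rule tendsto_sandwich[OF _ _ tendsto_const])
    have "(\<lambda>n. anorm A (s n \<ominus> s' n)) \<longlonglongrightarrow> 0" "(\<lambda>n. anorm A (t n \<ominus> t' n)) \<longlonglongrightarrow> 0"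
      using assms cl_eq_iff by blast+
    then have "(\<lambda>n. anorm A (s n \<ominus> s' n) * L + K * anorm A (t n \<ominus> t' n)) \<longlonglongrightarrow> 0 * L + K * 0"
      by (intro tendsto_intros)
    then show "(\<lambda>n. anorm A (s n \<ominus> s' n) * L + K * anorm A (t n \<ominus> t' n)) \<longlonglongrightarrow> 0" by simp
    have "anorm A (s n \<otimes> t n \<ominus> s' n \<otimes> t' n)
      \<le> anorm A (s n \<ominus> s' n) * L + K * anorm A (t n \<ominus> t' n)" for n
      using K L assms
      by (intro order_trans[OF anorm_mult_diff_le] add_mono mult_mono) auto
    then show "\<forall>\<^sub>F n in sequentially. anorm A (s n \<otimes> t n \<ominus> s' n \<otimes> t' n)
      \<le> anorm A (s n \<ominus> s' n) * L + K * anorm A (t n \<ominus> t' n)" by simp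
  qed (use assms in \<open>auto intro!: always_eventually\<close>)
  then show ?thesis using assms by (simp add: cl_eq_iff)
qed

lemma cl_smult:
  assumes "s \<in> CS" "s' \<in> CS" "cl s = cl s'"
  shows "cl (\<lambda>n. c \<odot> s n) = cl (\<lambda>n. c \<odot> s' n)"
proof -
  note [simp] = CS_in[OF assms(1)] CS_in[OF assms(2)]
  have "(\<lambda>n. anorm A (s n \<ominus> s' n)) \<longlonglongrightarrow> 0" using assms cl_eq_iff by blast
  then have "(\<lambda>n. cmod c * anorm A (s n \<ominus> s' n)) \<longlonglongrightarrow> 0"
    using tendsto_mult_right_zero by blast
  moreover have "anorm A (c \<odot> s n \<ominus> c \<odot> s' n) = cmod c * anorm A (s n \<ominus> s' n)" for n
    using assms anorm_smult[of "s n \<ominus> s' n" c] by (simp add: smult_diff)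
  ultimately show ?thesis using assms by (simp add: cl_eq_iff)
qed

lemma carrier_completion: "carrier C = cl ` CS"
  by (simp add: completion_def)

lemma cl_in_carrier [simp]: "s \<in> CS \<Longrightarrow> cl s \<in> carrier C"
  by (simp add: carrier_completion)

lemma completion_zero: "\<zero>\<^bsub>C\<^esub> = cl (\<lambda>n. \<zero>)"
  by (simp add: completion_def)

lemma completion_add [simp]:
  assumes "s \<in> CS" "t \<in> CS" shows "cl s \<oplus>\<^bsub>C\<^esub> cl t = cl (\<lambda>n. s n \<oplus> t n)"
proof -
  have "cl s \<oplus>\<^bsub>C\<^esub> cl t = (\<Union>s'\<in>cl s. \<Union>t'\<in>cl t. cl (\<lambda>n. s' n \<oplus> t' n))"
    by (simp add: completion_def)
  also have "\<dots> = cl (\<lambda>n. s n \<oplus> t n)"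
  proof (rule SUP_eq_const)
    fix s' assume s': "s' \<in> cl s"
    show "(\<Union>t'\<in>cl t. cl (\<lambda>n. s' n \<oplus> t' n)) = cl (\<lambda>n. s n \<oplus> t n)"
    proof (rule SUP_eq_const)
      fix t' assume "t' \<in> cl t"
      then have t': "t' \<in> CS" "cl t' = cl t" using cl_mem_eq[OF assms(2)] by auto
      have s'': "s' \<in> CS" "cl s' = cl s" using cl_mem_eq[OF assms(1) s'] by auto
      show "cl (\<lambda>n. s' n \<oplus> t' n) = cl (\<lambda>n. s n \<oplus> t n)"
        by (rule cl_add[OF s''(1) t'(1) assms s''(2) t'(2)])
    qed (use cl_self[OF assms(2)] in blast)
  qed (use cl_self[OF assms(1)] in blast)
  finally show ?thesis .
qed

lemma completion_mult [simp]:
  assumes "s \<in> CS" "t \<in> CS" shows "cl s \<otimes>\<^bsub>C\<^esub> cl t = cl (\<lambda>n. s n \<otimes> t n)"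
proof -
  have "cl s \<otimes>\<^bsub>C\<^esub> cl t = (\<Union>s'\<in>cl s. \<Union>t'\<in>cl t. cl (\<lambda>n. s' n \<otimes> t' n))"
    by (simp add: completion_def)
  also have "\<dots> = cl (\<lambda>n. s n \<otimes> t n)"
  proof (rule SUP_eq_const)
    fix s' assume s': "s' \<in> cl s"
    show "(\<Union>t'\<in>cl t. cl (\<lambda>n. s' n \<otimes> t' n)) = cl (\<lambda>n. s n \<otimes> t n)"
    proof (rule SUP_eq_const)
      fix t' assume "t' \<in> cl t"
      then have t': "t' \<in> CS" "cl t' = cl t" using cl_mem_eq[OF assms(2)] by auto
      have s'': "s' \<in> CS" "cl s' = cl s" using cl_mem_eq[OF assms(1) s'] by auto
      show "cl (\<lambda>n. s' n \<otimes> t' n) = cl (\<lambda>n. s n \<otimes> t n)"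
        by (rule cl_mult[OF s''(1) t'(1) assms s''(2) t'(2)])
    qed (use cl_self[OF assms(2)] in blast)
  qed (use cl_self[OF assms(1)] in blast)
  finally show ?thesis .
qed

lemma completion_smult [simp]:
  assumes "s \<in> CS" shows "c \<odot>\<^bsub>C\<^esub> cl s = cl (\<lambda>n. c \<odot> s n)"
proof -
  have "c \<odot>\<^bsub>C\<^esub> cl s = (\<Union>s'\<in>cl s. cl (\<lambda>n. c \<odot> s' n))"
    by (simp add: completion_def)
  also have "\<dots> = cl (\<lambda>n. c \<odot> s n)"
  proof (rule SUP_eq_const)
    fix s' assume "s' \<in> cl s"
    then have s': "s' \<in> CS" "cl s' = cl s" using cl_mem_eq[OF assms] by auto
    show "cl (\<lambda>n. c \<odot> s' n) = cl (\<lambda>n. c \<odot> s n)"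
      by (rule cl_smult[OF s'(1) assms s'(2)])
  qed (use cl_self[OF assms] in blast)
  finally show ?thesis .
qed

lemma norm_CS_convergent: 
  assumes s: "s \<in> CS" shows "convergent (\<lambda>n. anorm A (s n))"
proof (rule real_Cauchy_convergent, rule metric_CauchyI)
  fix e :: real assume "e > 0"
  then obtain N where N: "\<And>m n. m \<ge> N \<Longrightarrow> n \<ge> N \<Longrightarrow> anorm A (s m \<ominus> s n) < e"
    using CS_D[OF assms] by meson
  have "dist (anorm A (s m)) (anorm A (s n)) < e" if "m \<ge> N" "n \<ge> N" for m n
    using anorm_diff_ge[OF CS_in[OF s] CS_in[OF s], of m n] N[OF that] unfolding dist_real_def by (rule le_less_trans)
  then show "\<exists>M. \<forall>m\<ge>M. \<forall>n\<ge>M. dist (anorm A (s m)) (anorm A (s n)) < e" by (intro exI allI impI)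
qed

text \<open>
  Together with convergence of the norms along one representative, this makes the norm of a
  class well defined.
\<close>

lemma norm_limit_cl_cong:
  assumes t: "t \<in> cl s" "s \<in> CS" "(\<lambda>n. anorm A (s n)) \<longlonglongrightarrow> r" shows "(\<lambda>n. anorm A (t n)) \<longlonglongrightarrow> r"
proof (rule Lim_transform[OF t(3)])
  have tt: "t \<in> CS" "(\<lambda>n. anorm A (s n \<ominus> t n)) \<longlonglongrightarrow> 0" using t(1) by (simp_all add: mem_cl)
  have le: "norm (anorm A (t n) - anorm A (s n)) \<le> anorm A (s n \<ominus> t n)" for n
    using anorm_diff_ge[OF CS_in[OF t(2)] CS_in[OF tt(1)], of n n] by (simp add: abs_minus_commute)
  show "(\<lambda>n. anorm A (t n) - anorm A (s n)) \<longlonglongrightarrow> 0"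
    by (rule Lim_null_comparison[OF always_eventually[OF allI[OF le]] tt(2)]) 
qed

lemma completion_anorm:
  assumes "s \<in> CS" shows "(\<lambda>n. anorm A (s n)) \<longlonglongrightarrow> anorm C (cl s)"
proof -
  obtain r where r: "(\<lambda>n. anorm A (s n)) \<longlonglongrightarrow> r"
    using norm_CS_convergent[OF assms] by (rule convergentD[THEN exE])
  have "anorm C (cl s) = (THE r. \<forall>t\<in>cl s. (\<lambda>n. anorm A (t n)) \<longlonglongrightarrow> r)"
    by (simp add: completion_def)
  also have "\<dots> = r"
  proof (rule the_equality)
    show "\<forall>t\<in>cl s. (\<lambda>n. anorm A (t n)) \<longlonglongrightarrow> r"
      using norm_limit_cl_cong[OF _ assms r] by (intro ballI)
    fix r2 assume "\<forall>t\<in>cl s. (\<lambda>n. anorm A (t n)) \<longlonglongrightarrow> r2"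
    from bspec[OF this cl_self[OF assms]] show "r2 = r" using r by (rule LIMSEQ_unique)
  qed
  finally show ?thesis using r by (simp only:)
qed

lemma completion_anorm_const [simp]: "x \<in> carrier A \<Longrightarrow> anorm C (cl (\<lambda>n. x)) = anorm A x"
  using LIMSEQ_unique[OF completion_anorm[OF CS_const] tendsto_const] .

lemma completion_cases:
  assumes "S \<in> carrier C" obtains s where "s \<in> CS" "\<And>n. s n \<in> carrier A" "S = cl s"
proof -
  obtain s where s: "s \<in> CS" "S = cl s" using assms unfolding carrier_completion by (rule imageE)
  show thesis by (rule that[OF s(1) CS_in[OF s(1)] s(2)])
qed

lemma completion_ex: "S \<in> carrier C \<Longrightarrow> \<exists>s. s \<in> CS \<and> S = cl s"
  by (auto simp: carrier_completion)

lemma completion_seminormed: "seminormed_algebra C"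
proof -
  have "abelian_group C"
  proof (rule abelian_groupI)
    fix S assume "S \<in> carrier C"
    then obtain s where s: "s \<in> CS" "\<And>n. s n \<in> carrier A" "S = cl s"
      by (blast dest: completion_ex intro: CS_in)
    then have "cl (\<lambda>n. (-1) \<odot> s n) \<oplus>\<^bsub>C\<^esub> S = \<zero>\<^bsub>C\<^esub>"
      by (simp add: completion_zero smult_minus1 l_neg)
    moreover have "cl (\<lambda>n. (-1) \<odot> s n) \<in> carrier C" using s by simp
    ultimately show "\<exists>T\<in>carrier C. T \<oplus>\<^bsub>C\<^esub> S = \<zero>\<^bsub>C\<^esub>" by blast
  qed ((elim completion_cases)?, simp add: completion_zero a_ac)+
  then have mod: "module complex_field C"
    by (intro moduleI cring_complex_field)
      (assumption | (elim completion_cases, simp add: smult_add smult_smult smult_distrib))+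
  have add: "anorm C (S \<oplus>\<^bsub>C\<^esub> T) \<le> anorm C S + anorm C T"
    if S: "S \<in> carrier C" and T: "T \<in> carrier C" for S T
  proof -
    obtain s where s: "s \<in> CS" "S = cl s" using completion_ex[OF S] by (elim exE conjE)
    obtain t where t: "t \<in> CS" "T = cl t" using completion_ex[OF T] by (elim exE conjE)
    show ?thesis
      unfolding s(2) t(2) completion_add[OF s(1) t(1)]
    proof (rule LIMSEQ_le)
      show "(\<lambda>n. anorm A (s n \<oplus> t n)) \<longlonglongrightarrow> anorm C (cl (\<lambda>n. s n \<oplus> t n))"
        by (rule completion_anorm[OF CS_add[OF s(1) t(1)]])
      show "(\<lambda>n. anorm A (s n) + anorm A (t n)) \<longlonglongrightarrow> anorm C (cl s) + anorm C (cl t)"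
        by (rule tendsto_add[OF completion_anorm[OF s(1)] completion_anorm[OF t(1)]])
      show "\<exists>N. \<forall>n\<ge>N. anorm A (s n \<oplus> t n) \<le> anorm A (s n) + anorm A (t n)"
        by (intro exI allI impI anorm_add CS_in[OF s(1)] CS_in[OF t(1)])
    qed
  qed
  have mult: "anorm C (S \<otimes>\<^bsub>C\<^esub> T) \<le> anorm C S * anorm C T"
    if S: "S \<in> carrier C" and T: "T \<in> carrier C" for S T
  proof -
    obtain s where s: "s \<in> CS" "S = cl s" using completion_ex[OF S] by (elim exE conjE)
    obtain t where t: "t \<in> CS" "T = cl t" using completion_ex[OF T] by (elim exE conjE)
    show ?thesis
      unfolding s(2) t(2) completion_mult[OF s(1) t(1)]
    proof (rule LIMSEQ_le)
      show "(\<lambda>n. anorm A (s n \<otimes> t n)) \<longlonglongrightarrow> anorm C (cl (\<lambda>n. s n \<otimes> t n))"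
        by (rule completion_anorm[OF CS_mult[OF s(1) t(1)]])
      show "(\<lambda>n. anorm A (s n) * anorm A (t n)) \<longlonglongrightarrow> anorm C (cl s) * anorm C (cl t)"
        by (rule tendsto_mult[OF completion_anorm[OF s(1)] completion_anorm[OF t(1)]])
      show "\<exists>N. \<forall>n\<ge>N. anorm A (s n \<otimes> t n) \<le> anorm A (s n) * anorm A (t n)"
        by (intro exI allI impI anorm_mult CS_in[OF s(1)] CS_in[OF t(1)])
    qed
  qed
  have smult: "0 \<le> anorm C S \<and> anorm C (c \<odot>\<^bsub>C\<^esub> S) = cmod c * anorm C S"
    if S: "S \<in> carrier C" for S c
  proof -
    obtain s where s: "s \<in> CS" "S = cl s" using completion_ex[OF S] by (elim exE conjE)
    note lim = completion_anorm[OF s(1)]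
    have "(\<lambda>n. anorm A (c \<odot> s n)) \<longlonglongrightarrow> cmod c * anorm C (cl s)"
      unfolding anorm_smult[OF CS_in[OF s(1)]] by (rule tendsto_mult_left[OF lim])
    then have "anorm C (c \<odot>\<^bsub>C\<^esub> cl s) = cmod c * anorm C (cl s)"
      unfolding completion_smult[OF s(1)]
      using LIMSEQ_unique[OF completion_anorm[OF CS_smult[OF s(1)]]] by simp
    moreover have "0 \<le> anorm C (cl s)"
      by (rule LIMSEQ_le_const[OF lim]) (intro exI allI impI anorm_nonneg CS_in[OF s(1)])
    ultimately show ?thesis unfolding s(2) by (intro conjI)
  qed
  show ?thesis
  proof (intro seminormed_algebra.intro seminormed_algebra_axioms.intro mod)
    fix S T c assume ST: "S \<in> carrier C" "T \<in> carrier C"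
    show "anorm C (S \<oplus>\<^bsub>C\<^esub> T) \<le> anorm C S + anorm C T" using ST by (rule add)
    show "anorm C (S \<otimes>\<^bsub>C\<^esub> T) \<le> anorm C S * anorm C T" using ST by (rule mult)
    show "0 \<le> anorm C S" using smult[OF ST(1)] by (rule conjunct1)
    show "anorm C (c \<odot>\<^bsub>C\<^esub> S) = cmod c * anorm C S" using smult[OF ST(1)] by (rule conjunct2)
  qed (elim completion_cases, simp add: mult_assoc mult_add_left mult_add_right
    mult_smult_left mult_smult_right)+
qed

end

subsection \<open>Completeness\<close>

lemma (in normed_algebra) Metric_space_ndist: "Metric_space (carrier A) (ndist A)"
proof -
  interpret seminormed_algebra A
    by (rule normed_imp_seminormed) (rule normed_algebra_axioms)
  show ?thesis
    by unfold_locales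
      (auto simp: ndist_def anorm_diff_commute anorm_eq_zero diff_eq_zero anorm_diff_triangle)
qed

lemma (in seminormed_algebra) banach_algebraI:
  assumes definite: "\<And>x. x \<in> carrier A \<Longrightarrow> anorm A x = 0 \<Longrightarrow> x = \<zero>"
    and lim: "\<And>s. s \<in> cauchy_seqs A \<Longrightarrow> \<exists>x\<in>carrier A. (\<lambda>n. anorm A (s n \<ominus> x)) \<longlonglongrightarrow> 0"
  shows "banach_algebra A"
proof -
  interpret normed_algebra A using definite by (rule normed_algebraI)
  interpret Metric_space "carrier A" "ndist A" by (rule Metric_space_ndist)
  have "\<exists>x. limitin mtopology s x sequentially" if "MCauchy s" for s
  proof -
    have s: "s n \<in> carrier A" for n using that by (auto simp: MCauchy_def)
    then have "s \<in> cauchy_seqs A"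
      using that unfolding MCauchy_def cauchy_seqs_def ndist_def by simp
    then obtain x where x: "x \<in> carrier A" "(\<lambda>n. anorm A (s n \<ominus> x)) \<longlonglongrightarrow> 0" using lim by blast
    have "limitin mtopology s x sequentially"
      unfolding limit_metric_sequentially
    proof (intro conjI allI impI x)
      fix e :: real assume "e > 0"
      then show "\<exists>N. \<forall>n\<ge>N. s n \<in> carrier A \<and> ndist A (s n) x < e"
        using LIMSEQ_D[OF x(2)] s x(1) by (simp add: ndist_def)
    qed
    then show ?thesis ..
  qed
  then show ?thesis
    by unfold_locales (simp add: mcomplete_def)
qed

lemma (in seminormed_algebra) completion_banach: "banach_algebra C"
proof -
  interpret C: seminormed_algebra C by (rule completion_seminormed)
  have minus: "cl s \<ominus>\<^bsub>C\<^esub> cl t = cl (\<lambda>n. s n \<ominus> t n)" if "s \<in> CS" "t \<in> CS" for s t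
  proof -
    note [simp] = CS_in[OF that(1)] CS_in[OF that(2)]
    have "\<ominus>\<^bsub>C\<^esub> cl t = (-1) \<odot>\<^bsub>C\<^esub> cl t" using C.smult_minus1[of "cl t"] that by simp
    also have "\<dots> = cl (\<lambda>n. \<ominus> t n)" using that by (simp add: smult_minus1)
    finally show ?thesis using that by (simp add: minus_eq C.minus_eq)
  qed
  show ?thesis
  proof (rule C.banach_algebraI)
    fix S assume "S \<in> carrier C" "anorm C S = 0"
    then obtain s where s: "s \<in> CS" "S = cl s" "anorm C (cl s) = 0" by (blast dest: completion_ex)
    note [simp] = CS_in[OF s(1)]
    have "(\<lambda>n. anorm A (s n \<ominus> \<zero>)) \<longlonglongrightarrow> 0"
      using completion_anorm[OF s(1)] s(3) by simp
    then show "S = \<zero>\<^bsub>C\<^esub>"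
      unfolding s(2) completion_zero using cl_eq_iff[OF s(1) CS_const[OF zero_closed]] by blast
  next
    fix T assume T: "T \<in> cauchy_seqs C"
    note [simp] = C.CS_in[OF T]
    \<comment> \<open>Every class is a limit of constant classes, and the constants chosen this way converge to the
      same limit as the given sequence.\<close>
    have "\<exists>x. x \<in> carrier A \<and> anorm C (T n \<ominus>\<^bsub>C\<^esub> cl (\<lambda>_. x)) < inverse (Suc n)" for n
    proof -
      obtain s where s: "s \<in> CS" "T n = cl s" using completion_ex[of "T n"] C.CS_in[OF T] by blast
      note [simp] = CS_in[OF s(1)]
      obtain N where N: "\<And>k m. k \<ge> N \<Longrightarrow> m \<ge> N \<Longrightarrow> anorm A (s k \<ominus> s m) < inverse (Suc n) / 2"
        using CS_D[OF s(1), of "inverse (Suc n) / 2"] by auto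
      have "anorm C (cl (\<lambda>k. s k \<ominus> s N)) \<le> inverse (Suc n) / 2"
      proof (rule LIMSEQ_le_const2[OF completion_anorm])
        show "(\<lambda>k. s k \<ominus> s N) \<in> CS" using s by simp
        show "\<exists>M. \<forall>k\<ge>M. anorm A (s k \<ominus> s N) \<le> inverse (Suc n) / 2"
          using less_imp_le[OF N] by blast
      qed
      also have "\<dots> < inverse (Suc n)" by simp
      finally show ?thesis using s by (intro exI[of _ "s N"]) (simp add: minus)
    qed
    then obtain x where x: "\<And>n. x n \<in> carrier A"
      "\<And>n. anorm C (T n \<ominus>\<^bsub>C\<^esub> cl (\<lambda>_. x n)) < inverse (Suc n)" by metis
    have dist: "anorm A (x m \<ominus> x n) \<le> anorm C (T m \<ominus>\<^bsub>C\<^esub> T n) + inverse (Suc m) + inverse (Suc n)" for m n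
    proof -
      let ?x = "\<lambda>n. cl (\<lambda>_. x n)"
      have c: "?x k \<in> carrier C" "T k \<in> carrier C" for k using x T by auto
      have "anorm A (x m \<ominus> x n) = anorm C (?x m \<ominus>\<^bsub>C\<^esub> ?x n)" using x by (simp add: minus)
      also have "\<dots> \<le> anorm C (?x m \<ominus>\<^bsub>C\<^esub> T m) + anorm C (T m \<ominus>\<^bsub>C\<^esub> ?x n)"
        using c by (intro C.anorm_diff_triangle)
      also have "\<dots> \<le> anorm C (T m \<ominus>\<^bsub>C\<^esub> ?x m) + (anorm C (T m \<ominus>\<^bsub>C\<^esub> T n) + anorm C (T n \<ominus>\<^bsub>C\<^esub> ?x n))"
        using c C.anorm_diff_triangle[of "T m" "T n" "?x n"] C.anorm_diff_commute[of "?x m" "T m"] by simp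
      finally show ?thesis using x(2)[of m] x(2)[of n] by simp
    qed
    have xCS: "x \<in> CS"
    proof (rule CS_I)
      fix e :: real assume e: "e > 0"
      obtain N where N: "\<And>m n. m \<ge> N \<Longrightarrow> n \<ge> N \<Longrightarrow> anorm C (T m \<ominus>\<^bsub>C\<^esub> T n) < e/3"
        using C.CS_D[OF T, of "e/3"] e by auto
      obtain M where M: "inverse (real (Suc M)) < e/3" using reals_Archimedean[of "e/3"] e by auto
      have M': "inverse (real (Suc m)) < e/3" if "m \<ge> M" for m
        using that by (intro le_less_trans[OF _ M]) (simp add: field_simps)
      have "anorm A (x m \<ominus> x n) < e" if "m \<ge> max M N" "n \<ge> max M N" for m n
        using dist[of m n] N[of m n] M'[of m] M'[of n] that by simp
      then show "\<exists>N. \<forall>m\<ge>N. \<forall>n\<ge>N. anorm A (x m \<ominus> x n) < e" by blast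
    qed (rule x)
    note [simp] = CS_in[OF xCS]
    have "(\<lambda>n. anorm C (T n \<ominus>\<^bsub>C\<^esub> cl x)) \<longlonglongrightarrow> 0"
    proof (rule LIMSEQ_I)
      fix e :: real assume e: "e > 0"
      obtain N where N: "\<And>m n. m \<ge> N \<Longrightarrow> n \<ge> N \<Longrightarrow> anorm A (x m \<ominus> x n) < e/3"
        using CS_D[OF xCS, of "e/3"] e by auto
      obtain M where M: "inverse (real (Suc M)) < e/3" using reals_Archimedean[of "e/3"] e by auto
      have "norm (anorm C (T n \<ominus>\<^bsub>C\<^esub> cl x) - 0) < e" if "n \<ge> max M N" for n
      proof -
        have c: "cl (\<lambda>_. x n) \<in> carrier C" "T n \<in> carrier C" "cl x \<in> carrier C" using x T xCS by auto
        have CS': "(\<lambda>k. x n \<ominus> x k) \<in> CS" using x xCS by simp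
        have "anorm C (cl (\<lambda>k. x n \<ominus> x k)) \<le> e/3"
        proof (rule LIMSEQ_le_const2[OF completion_anorm[OF CS']])
          show "\<exists>M. \<forall>k\<ge>M. anorm A (x n \<ominus> x k) \<le> e/3"
            using less_imp_le[OF N] that by (meson max.bounded_iff)
        qed
        then have "anorm C (cl (\<lambda>_. x n) \<ominus>\<^bsub>C\<^esub> cl x) \<le> e/3" using x xCS by (simp add: minus)
        moreover have "inverse (real (Suc n)) < e/3"
          using that by (intro le_less_trans[OF _ M]) (simp add: field_simps)
        ultimately show ?thesis
          using c C.anorm_diff_triangle[OF c(2) c(1) c(3)] x(2)[of n] e by simp
      qed
      then show "\<exists>no. \<forall>n\<ge>no. norm (anorm C (T n \<ominus>\<^bsub>C\<^esub> cl x) - 0) < e" by blast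
    qed
    then show "\<exists>S\<in>carrier C. (\<lambda>n. anorm C (T n \<ominus>\<^bsub>C\<^esub> S)) \<longlonglongrightarrow> 0" using xCS by auto
  qed
qed

section \<open>Left ideals and the Jacobson radical\<close>

text \<open>
  Algebras here have no distinguished unit, so the empty product carries no meaning; the value
  zero merely keeps it in the carrier.
\<close>

fun word_product :: "'a nalg \<Rightarrow> 'a list \<Rightarrow> 'a" where
  "word_product A [] = \<zero>\<^bsub>A\<^esub>"
| "word_product A [x] = x"
| "word_product A (x # y # ws) = x \<otimes>\<^bsub>A\<^esub> word_product A (y # ws)"

lemma word_product_Cons: "ws \<noteq> [] \<Longrightarrow> word_product A (x # ws) = x \<otimes>\<^bsub>A\<^esub> word_product A ws"
  by (cases ws) auto

context seminormed_algebra
begin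

lemma word_product_closed: "set ws \<subseteq> carrier A \<Longrightarrow> word_product A ws \<in> carrier A"
  by (induction ws rule: induct_list012) auto

lemma word_product_append:
  assumes "set us \<subseteq> carrier A" "set vs \<subseteq> carrier A" "us \<noteq> []" "vs \<noteq> []"
  shows "word_product A (us @ vs) = word_product A us \<otimes> word_product A vs"
  using assms(1,3)
proof (induction us)
  case (Cons x us)
  show ?case
  proof (cases "us = []")
    case False
    then show ?thesis
      using Cons assms mult_assoc word_product_closed by (simp add: word_product_Cons)
  qed (use assms(4) in \<open>simp add: word_product_Cons\<close>)
qed simp

lemma left_ideal_subset: "left_ideal A L \<Longrightarrow> L \<subseteq> carrier A"
  using submoduleE(1) by (auto simp: left_ideal_def)

lemma left_ideal_add: "left_ideal A L \<Longrightarrow> x \<in> L \<Longrightarrow> y \<in> L \<Longrightarrow> x \<oplus> y \<in> L"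
  using submoduleE(5) by (auto simp: left_ideal_def)

lemma left_ideal_smult: "left_ideal A L \<Longrightarrow> x \<in> L \<Longrightarrow> c \<odot> x \<in> L"
  using submoduleE(4)[of L c x] by (simp add: left_ideal_def)

lemma left_ideal_mult: "left_ideal A L \<Longrightarrow> x \<in> carrier A \<Longrightarrow> y \<in> L \<Longrightarrow> x \<otimes> y \<in> L"
  by (simp add: left_ideal_def)

lemma left_ideal_zero:
  assumes L: "left_ideal A L" shows "\<zero> \<in> L"
proof -
  obtain x where x: "x \<in> L" using submoduleE(2)[of L] L by (auto simp: left_ideal_def)
  then have "0 \<odot> x = \<zero>" using left_ideal_subset[OF L] by (intro smult_zero_left) blast
  then show ?thesis using left_ideal_smult[OF L x, of 0] by simp
qed

lemma left_idealI:
  assumes "L \<subseteq> carrier A" "\<zero> \<in> L" "\<And>x y. x \<in> L \<Longrightarrow> y \<in> L \<Longrightarrow> x \<oplus> y \<in> L"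
    and sm: "\<And>c x. x \<in> L \<Longrightarrow> c \<odot> x \<in> L" and "\<And>x y. x \<in> carrier A \<Longrightarrow> y \<in> L \<Longrightarrow> x \<otimes> y \<in> L"
  shows "left_ideal A L"
proof -
  have "\<ominus> x \<in> L" if "x \<in> L" for x
    using sm[OF that, of "-1"] that assms(1) by (auto simp: smult_minus1)
  then show ?thesis
    using assms unfolding left_ideal_def by (intro conjI submoduleI) auto
qed

lemma left_ideal_diffs:
  assumes w: "w \<in> carrier A"
  shows "left_ideal A ((\<lambda>y. y \<ominus> y \<otimes> w) ` carrier A)"
proof (rule left_idealI)
  show "\<zero> \<in> (\<lambda>y. y \<ominus> y \<otimes> w) ` carrier A"
    using w by (intro image_eqI[of _ _ \<zero>]) auto
next
  fix x y assume "x \<in> (\<lambda>y. y \<ominus> y \<otimes> w) ` carrier A" "y \<in> (\<lambda>y. y \<ominus> y \<otimes> w) ` carrier A"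
  then obtain a b where ab: "a \<in> carrier A" "b \<in> carrier A" "x = a \<ominus> a \<otimes> w" "y = b \<ominus> b \<otimes> w"
    by auto
  then show "x \<oplus> y \<in> (\<lambda>y. y \<ominus> y \<otimes> w) ` carrier A"
    using w by (intro image_eqI[of _ _ "a \<oplus> b"]) (auto simp: mult_add_left add_diff_add)
next
  fix c x assume "x \<in> (\<lambda>y. y \<ominus> y \<otimes> w) ` carrier A"
  then obtain a where "a \<in> carrier A" "x = a \<ominus> a \<otimes> w" by auto
  then show "c \<odot> x \<in> (\<lambda>y. y \<ominus> y \<otimes> w) ` carrier A"
    using w by (intro image_eqI[of _ _ "c \<odot> a"]) (auto simp: smult_diff mult_smult_left)
next
  fix y x assume "y \<in> carrier A" "x \<in> (\<lambda>y. y \<ominus> y \<otimes> w) ` carrier A"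
  then obtain a where "y \<in> carrier A" "a \<in> carrier A" "x = a \<ominus> a \<otimes> w" by auto
  then show "y \<otimes> x \<in> (\<lambda>y. y \<ominus> y \<otimes> w) ` carrier A"
    using w by (intro image_eqI[of _ _ "y \<otimes> a"]) (auto simp: mult_diff_right mult_assoc)
qed (use w in auto)

lemma left_ideal_containing_modular_unit:
  assumes "left_ideal A L" "\<And>y. y \<in> carrier A \<Longrightarrow> y \<ominus> y \<otimes> u \<in> L" "u \<in> L"
  shows "L = carrier A"
proof -
  have u: "u \<in> carrier A" using left_ideal_subset assms by blast
  have "y \<in> L" if y: "y \<in> carrier A" for y
    using left_ideal_add[OF assms(1) assms(2)[OF y] left_ideal_mult[OF assms(1) y assms(3)]] y u
    by simp
  then show ?thesis using left_ideal_subset[OF assms(1)] by auto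
qed

text \<open>
  A modular left ideal is proper exactly as long as it misses its modular unit, and that
  condition survives unions of chains.
\<close>

lemma modular_left_ideal_below_maximal:
  assumes "modular_left_ideal A J" "J \<noteq> carrier A"
  shows "\<exists>L. maximal_modular_left_ideal A L \<and> J \<subseteq> L"
proof -
  obtain u where J: "left_ideal A J" and u: "u \<in> carrier A" "\<And>y. y \<in> carrier A \<Longrightarrow> y \<ominus> y \<otimes> u \<in> J"
    using assms(1) by (auto simp: modular_left_ideal_def)
  have proper: "u \<notin> K" if "left_ideal A K" "J \<subseteq> K" "K \<noteq> carrier A" for K
    using left_ideal_containing_modular_unit[OF that(1), of u] that u(2) by blast
  let ?I = "{K. left_ideal A K \<and> J \<subseteq> K \<and> u \<notin> K}"
  have "\<exists>L\<in>?I. \<forall>K\<in>?I. L \<subseteq> K \<longrightarrow> K = L"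
  proof (rule subset_Zorn_nonempty)
    show "?I \<noteq> {}" using J proper[of J] assms(2) by auto
    fix C assume C: "C \<noteq> {}" "subset.chain ?I C"
    then have I: "K \<in> C \<Longrightarrow> left_ideal A K \<and> J \<subseteq> K \<and> u \<notin> K" for K
      by (auto simp: subset.chain_def)
    have "left_ideal A (\<Union>C)"
    proof (rule left_idealI)
      show "\<Union>C \<subseteq> carrier A" using I left_ideal_subset by blast
      show "\<zero> \<in> \<Union>C" using I C(1) left_ideal_zero by blast
      fix x y assume "x \<in> \<Union>C" "y \<in> \<Union>C"
      then obtain K K' where K: "K \<in> C" "K' \<in> C" "x \<in> K" "y \<in> K'" by blast
      then have "K \<subseteq> K' \<or> K' \<subseteq> K" using C(2) by (auto simp: subset_chain_def)
      then obtain K'' where "K'' \<in> C" "x \<in> K''" "y \<in> K''" using K by blast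
      then show "x \<oplus> y \<in> \<Union>C" using I left_ideal_add by blast
    next
      fix c x assume "x \<in> \<Union>C" then show "c \<odot> x \<in> \<Union>C" using I left_ideal_smult by blast
    next
      fix x y assume "x \<in> carrier A" "y \<in> \<Union>C"
      then show "x \<otimes> y \<in> \<Union>C" using I left_ideal_mult by blast
    qed
    then show "\<Union>C \<in> ?I" using I C(1) by blast
  qed
  then obtain L where L: "left_ideal A L" "J \<subseteq> L" "u \<notin> L" and
    max: "\<And>K. left_ideal A K \<Longrightarrow> J \<subseteq> K \<Longrightarrow> u \<notin> K \<Longrightarrow> L \<subseteq> K \<Longrightarrow> K = L" by auto
  have "maximal_modular_left_ideal A L"
    unfolding maximal_modular_left_ideal_def modular_left_ideal_def
  proof (intro conjI allI impI)
    show "\<exists>u\<in>carrier A. \<forall>x\<in>carrier A. x \<ominus> x \<otimes> u \<in> L" using u L(2) by blast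
    fix K assume K: "left_ideal A K \<and> L \<subseteq> K \<and> K \<noteq> carrier A"
    then show "K = L" using L(2) proper[of K] max[of K] by blast
  qed (use L u in auto)
  then show ?thesis using L(2) by blast
qed

text \<open>
  This expresses that \<open>x\<close> acts nontrivially on the simple module \<open>A / L\<close>. The \<open>y\<close> with
  \<open>A y \<subseteq> L\<close> form a left ideal above \<open>L\<close>, and a proper one because of the modular unit \<open>u\<close>; so it is
  \<open>L\<close>, and \<open>A x\<close> is not contained in \<open>L\<close>. Then \<open>L + A x\<close> is everything, and writing
  \<open>u = l + t x\<close> shows that \<open>t x\<close> is a modular unit too.
\<close>

lemma maximal_modular_left_ideal_outside:
  assumes max: "maximal_modular_left_ideal A L" and x: "x \<in> carrier A" "x \<notin> L"
  shows "\<exists>t\<in>carrier A. \<forall>y\<in>carrier A. y \<ominus> y \<otimes> (t \<otimes> x) \<in> L"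
proof -
  obtain u where L: "left_ideal A L" "L \<noteq> carrier A"
    and u: "u \<in> carrier A" "\<And>y. y \<in> carrier A \<Longrightarrow> y \<ominus> y \<otimes> u \<in> L"
    and m: "\<And>J. left_ideal A J \<Longrightarrow> L \<subseteq> J \<Longrightarrow> J \<noteq> carrier A \<Longrightarrow> J = L"
    using max by (auto simp: maximal_modular_left_ideal_def modular_left_ideal_def)
  have Lc: "l \<in> carrier A" if "l \<in> L" for l using left_ideal_subset[OF L(1)] that by blast
  let ?Q = "{y \<in> carrier A. \<forall>z\<in>carrier A. z \<otimes> y \<in> L}"
  have Q: "left_ideal A ?Q"
    by (rule left_idealI) (auto simp: mult_add_right mult_smult_right left_ideal_zero[OF L(1)]
      left_ideal_add[OF L(1)] left_ideal_smult[OF L(1)] simp flip: mult_assoc)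
  have LQ: "L \<subseteq> ?Q" using Lc left_ideal_mult[OF L(1)] by blast
  have "?Q \<noteq> carrier A"
  proof
    assume Qc: "?Q = carrier A"
    have "y \<in> L" if y: "y \<in> carrier A" for y
    proof -
      have "y \<otimes> u \<in> L" using Qc u(1) y by blast
      then have "(y \<ominus> y \<otimes> u) \<oplus> y \<otimes> u \<in> L" by (rule left_ideal_add[OF L(1) u(2)[OF y]])
      then show ?thesis using y u(1) by simp
    qed
    then show False using L(2) left_ideal_subset[OF L(1)] by blast
  qed
  then have "x \<notin> ?Q" using m[OF Q LQ] x(2) by simp
  then obtain z where z: "z \<in> carrier A" "z \<otimes> x \<notin> L" using x(1) by blast
  let ?J = "{l \<oplus> t \<otimes> x |l t. l \<in> L \<and> t \<in> carrier A}"
  have "left_ideal A ?J"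
  proof (rule left_idealI)
    show "?J \<subseteq> carrier A" using Lc x by auto
    have "\<zero> = \<zero> \<oplus> \<zero> \<otimes> x" using x by simp
    then show "\<zero> \<in> ?J" using left_ideal_zero[OF L(1)] by blast
    fix a b assume "a \<in> ?J" "b \<in> ?J"
    then obtain l t l' t' where lt: "l \<in> L" "t \<in> carrier A" "l' \<in> L" "t' \<in> carrier A"
      "a = l \<oplus> t \<otimes> x" "b = l' \<oplus> t' \<otimes> x" by blast
    then have "a \<oplus> b = (l \<oplus> l') \<oplus> (t \<oplus> t') \<otimes> x" using Lc x by (simp add: mult_add_left a_ac)
    then show "a \<oplus> b \<in> ?J" using left_ideal_add[OF L(1) lt(1,3)] add.m_closed[OF lt(2,4)] by blast
  next
    fix c a assume "a \<in> ?J"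
    then obtain l t where lt: "l \<in> L" "t \<in> carrier A" "a = l \<oplus> t \<otimes> x" by blast
    then have "c \<odot> a = c \<odot> l \<oplus> (c \<odot> t) \<otimes> x" using Lc x by (simp add: smult_distrib mult_smult_left)
    then show "c \<odot> a \<in> ?J" using left_ideal_smult[OF L(1) lt(1)] smult_in[OF lt(2)] by blast
  next
    fix y a assume y: "y \<in> carrier A" and "a \<in> ?J"
    then obtain l t where lt: "l \<in> L" "t \<in> carrier A" "a = l \<oplus> t \<otimes> x" by blast
    then have "y \<otimes> a = y \<otimes> l \<oplus> (y \<otimes> t) \<otimes> x" using y Lc x by (simp add: mult_add_right mult_assoc)
    then show "y \<otimes> a \<in> ?J" using left_ideal_mult[OF L(1) y lt(1)] mult_closed[OF y lt(2)] by blast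
  qed
  moreover have "L \<subseteq> ?J"
  proof
    fix l assume l: "l \<in> L"
    then have "l = l \<oplus> \<zero> \<otimes> x" using Lc x by simp
    then show "l \<in> ?J" using l zero_closed by blast
  qed
  moreover have "z \<otimes> x \<in> ?J"
  proof -
    have "z \<otimes> x = \<zero> \<oplus> z \<otimes> x" using z x by simp
    then show ?thesis using left_ideal_zero[OF L(1)] z(1) by blast
  qed
  ultimately have "?J = carrier A" using m z(2) by blast
  then obtain l t where lt: "l \<in> L" "t \<in> carrier A" "u = l \<oplus> t \<otimes> x" using u(1) by blast
  have "y \<ominus> y \<otimes> (t \<otimes> x) \<in> L" if y: "y \<in> carrier A" for y
  proof -
    have lc: "l \<in> carrier A" using Lc lt by blast
    have "y \<otimes> u \<ominus> y \<otimes> (t \<otimes> x) = y \<otimes> l"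
      using lt y x lc by (simp add: mult_add_right minus_eq a_assoc r_neg)
    then have "y \<ominus> y \<otimes> (t \<otimes> x) = (y \<ominus> y \<otimes> u) \<oplus> y \<otimes> l"
      using diff_add_diff[of y "y \<otimes> u" "y \<otimes> (t \<otimes> x)"] y u(1) lt(2) x(1) by simp
    then show ?thesis using left_ideal_add[OF L(1) u(2)[OF y] left_ideal_mult[OF L(1) y lt(1)]] by simp
  qed
  then show ?thesis using lt(2) by blast
qed

end

sublocale normed_algebra \<subseteq> seminormed_algebra
  by (rule normed_imp_seminormed) (rule normed_algebra_axioms)

text \<open>
  An element with small powers is quasi-regular, so it cannot be a modular unit of a proper left
  ideal. If \<open>w\<close> is a modular unit of \<open>L\<close>, so is every power \<open>v\<close> of \<open>w\<close>, and when \<open>\<parallel>v\<parallel> < 1\<close>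
  every \<open>z\<close> has the form \<open>y - y v\<close>, by the contraction principle for \<open>y \<mapsto> z + y v\<close>.
\<close>

lemma (in banach_algebra) left_ideal_eq_carrier:
  assumes L: "left_ideal A L" and w: "w \<in> carrier A"
    and mod: "\<And>y. y \<in> carrier A \<Longrightarrow> y \<ominus> y \<otimes> w \<in> L"
    and n: "n \<ge> 1" "anorm A (word_product A (replicate n w)) < 1"
  shows "L = carrier A"
proof -
  let ?v = "\<lambda>n. word_product A (replicate n w)"
  have v: "?v k \<in> carrier A" for k by (rule word_product_closed) (use w in auto)
  have pow: "y \<ominus> y \<otimes> ?v (Suc k) \<in> L" if "y \<in> carrier A" for y k
    using that
  proof (induction k arbitrary: y)
    case 0
    then show ?case using mod by simp
  next
    case (Suc k)
    have e: "?v (Suc (Suc k)) = w \<otimes> ?v (Suc k)" by simp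
    have "(y \<ominus> y \<otimes> w) \<oplus> ((y \<otimes> w) \<ominus> (y \<otimes> w) \<otimes> ?v (Suc k)) \<in> L"
      using Suc w by (intro left_ideal_add[OF L] mod) auto
    also have "(y \<ominus> y \<otimes> w) \<oplus> ((y \<otimes> w) \<ominus> (y \<otimes> w) \<otimes> ?v (Suc k)) = y \<ominus> y \<otimes> ?v (Suc (Suc k))"
      unfolding e using Suc.prems w v[of "Suc k"] by (subst diff_add_diff) (simp_all add: mult_assoc)
    finally show ?case .
  qed
  interpret M: Metric_space "carrier A" "ndist A" by (rule Metric_space_ndist)
  have "z \<in> L" if z: "z \<in> carrier A" for z
  proof -
    have "\<exists>y. y \<in> carrier A \<and> z \<oplus> y \<otimes> ?v n = y"
    proof (rule M.Banach_fixedpoint_thm[OF complete])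
      show "carrier A \<noteq> {}" using z by blast
      show "(\<lambda>y. z \<oplus> y \<otimes> ?v n) \<in> carrier A \<rightarrow> carrier A" using z v by auto
      show "anorm A (?v n) < 1" by (rule n)
      fix x y assume xy: "x \<in> carrier A" "y \<in> carrier A"
      have "(z \<oplus> x \<otimes> ?v n) \<ominus> (z \<oplus> y \<otimes> ?v n) = (x \<ominus> y) \<otimes> ?v n"
        using xy z v[of n] by (simp add: add_diff_add mult_diff_left)
      then show "ndist A (z \<oplus> x \<otimes> ?v n) (z \<oplus> y \<otimes> ?v n) \<le> anorm A (?v n) * ndist A x y"
        using xy z v[of n] anorm_mult[of "x \<ominus> y" "?v n"] by (simp add: ndist_def mult.commute)
    qed blast
    then obtain y where y: "y \<in> carrier A" "z \<oplus> y \<otimes> ?v n = y" by blast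
    have "y \<ominus> y \<otimes> ?v n = z"
    proof -
      have "(z \<oplus> y \<otimes> ?v n) \<ominus> y \<otimes> ?v n = z" using y(1) z v[of n] by (simp add: minus_eq a_assoc r_neg)
      then show ?thesis using y(2) by simp
    qed
    moreover have "y \<ominus> y \<otimes> ?v n \<in> L" using pow[OF y(1), of "n - 1"] n(1) by simp
    ultimately show ?thesis by simp
  qed
  then show ?thesis using left_ideal_subset[OF L] by blast
qed

section \<open>The projective tensor seminorm\<close>

definition tensor_weight :: "'a nalg \<Rightarrow> 'b nalg \<Rightarrow> ('a \<times> 'b) list \<Rightarrow> real" where
  "tensor_weight A B l = (\<Sum>(x, y)\<leftarrow>l. anorm A x * anorm B y)"

definition tensor_product_list :: "'a nalg \<Rightarrow> 'b nalg \<Rightarrow> ('a \<times> 'b) list \<Rightarrow> ('a \<times> 'b) list \<Rightarrow> ('a \<times> 'b) list" where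
  "tensor_product_list A B l l' =
    concat (map (\<lambda>p. map (\<lambda>q. (fst p \<otimes>\<^bsub>A\<^esub> fst q, snd p \<otimes>\<^bsub>B\<^esub> snd q)) l') l)"

lemma sum_list_tensor_product_list:
  "(\<Sum>r\<leftarrow>tensor_product_list A B l l'. f r) =
    (\<Sum>p\<leftarrow>l. \<Sum>q\<leftarrow>l'. f (fst p \<otimes>\<^bsub>A\<^esub> fst q, snd p \<otimes>\<^bsub>B\<^esub> snd q))"
  by (induction l) (simp_all add: tensor_product_list_def o_def)

locale tensor_pair = A: seminormed_algebra A + B: seminormed_algebra B
  for A :: "'a nalg" and B :: "'b nalg"
begin

abbreviation "AT \<equiv> algebraic_tensor A B"
abbreviation "AB \<equiv> projective_tensor A B"
abbreviation "ts \<equiv> tensor_sum A B"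
abbreviation "BF \<equiv> bilinear_forms A B"
abbreviation "rep l \<equiv> set l \<subseteq> carrier A \<times> carrier B"

lemma ts_eval: "\<phi> \<in> BF \<Longrightarrow> ts l \<phi> = (\<Sum>p\<leftarrow>l. \<phi> (fst p) (snd p))"
  by (induction l) (auto simp: tensor_sum_def simple_tensor_def)

lemma ts_outside: "\<phi> \<notin> BF \<Longrightarrow> ts l \<phi> = 0"
  by (induction l) (auto simp: tensor_sum_def simple_tensor_def)

lemma ts_eqI: "(\<And>\<phi>. \<phi> \<in> BF \<Longrightarrow> ts l \<phi> = ts l' \<phi>) \<Longrightarrow> ts l = ts l'"
proof (rule ext)
  fix \<phi> assume "\<And>\<phi>. \<phi> \<in> BF \<Longrightarrow> ts l \<phi> = ts l' \<phi>"
  then show "ts l \<phi> = ts l' \<phi>" by (cases "\<phi> \<in> BF") (simp_all add: ts_outside)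
qed

lemma repD: "rep l \<Longrightarrow> p \<in> set l \<Longrightarrow> fst p \<in> carrier A" "rep l \<Longrightarrow> p \<in> set l \<Longrightarrow> snd p \<in> carrier B"
  by auto

lemma ts_append: "ts (l @ l') = (\<lambda>\<phi>. ts l \<phi> + ts l' \<phi>)"
  by (simp add: tensor_sum_def fun_eq_iff)

lemma simple_tensor_eq: "simple_tensor A B x y = ts [(x, y)]"
  by (simp add: tensor_sum_def)

lemma carrier_AT: "carrier AT = {ts l |l. rep l}"
  by (simp add: algebraic_tensor_def)

lemma ts_in [simp]: "rep l \<Longrightarrow> ts l \<in> carrier AT"
  by (auto simp: carrier_AT)

lemma AT_cases:
  assumes "u \<in> carrier AT" obtains l where "rep l" "u = ts l"
  using assms unfolding carrier_AT by blast

lemma BF_add1: "\<phi> \<in> BF \<Longrightarrow> x \<in> carrier A \<Longrightarrow> x' \<in> carrier A \<Longrightarrow> y \<in> carrier B \<Longrightarrow> \<phi> (x \<oplus>\<^bsub>A\<^esub> x') y = \<phi> x y + \<phi> x' y"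
  and BF_add2: "\<phi> \<in> BF \<Longrightarrow> x \<in> carrier A \<Longrightarrow> y \<in> carrier B \<Longrightarrow> y' \<in> carrier B \<Longrightarrow> \<phi> x (y \<oplus>\<^bsub>B\<^esub> y') = \<phi> x y + \<phi> x y'"
  and BF_smult1: "\<phi> \<in> BF \<Longrightarrow> x \<in> carrier A \<Longrightarrow> y \<in> carrier B \<Longrightarrow> \<phi> (c \<odot>\<^bsub>A\<^esub> x) y = c * \<phi> x y"
  and BF_smult2: "\<phi> \<in> BF \<Longrightarrow> x \<in> carrier A \<Longrightarrow> y \<in> carrier B \<Longrightarrow> \<phi> x (c \<odot>\<^bsub>B\<^esub> y) = c * \<phi> x y"
  by (auto simp: bilinear_forms_def)

lemma BF_cong:
  assumes "\<phi> \<in> BF" "\<And>x y. x \<in> carrier A \<Longrightarrow> y \<in> carrier B \<Longrightarrow> \<psi> x y = \<phi> x y"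
  shows "\<psi> \<in> BF"
  using assms by (simp add: bilinear_forms_def)

lemma BF_left_translate:
  "\<phi> \<in> BF \<Longrightarrow> a \<in> carrier A \<Longrightarrow> b \<in> carrier B \<Longrightarrow> (\<lambda>x y. \<phi> (a \<otimes>\<^bsub>A\<^esub> x) (b \<otimes>\<^bsub>B\<^esub> y)) \<in> BF"
  unfolding bilinear_forms_def
  by (simp add: A.mult_add_right B.mult_add_right A.mult_smult_right B.mult_smult_right)

lemma BF_right_translate:
  "\<phi> \<in> BF \<Longrightarrow> a \<in> carrier A \<Longrightarrow> b \<in> carrier B \<Longrightarrow> (\<lambda>x y. \<phi> (x \<otimes>\<^bsub>A\<^esub> a) (y \<otimes>\<^bsub>B\<^esub> b)) \<in> BF"
  unfolding bilinear_forms_def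
  by (simp add: A.mult_add_left B.mult_add_left A.mult_smult_left B.mult_smult_left)

lemma BF_zero: "(\<lambda>x y. 0) \<in> BF"
  by (simp add: bilinear_forms_def)

lemma BF_plus: "\<phi> \<in> BF \<Longrightarrow> \<psi> \<in> BF \<Longrightarrow> (\<lambda>x y. \<phi> x y + \<psi> x y) \<in> BF"
  by (simp add: bilinear_forms_def algebra_simps)

lemma BF_sum_list: "(\<And>q. q \<in> set l \<Longrightarrow> f q \<in> BF) \<Longrightarrow> (\<lambda>x y. \<Sum>q\<leftarrow>l. f q x y) \<in> BF"
  by (induction l) (simp_all add: BF_zero BF_plus)

lemma mult_eval:
  assumes \<phi>: "\<phi> \<in> BF" and l: "rep l" "rep l'"
  shows "(ts l \<otimes>\<^bsub>AT\<^esub> ts l') \<phi> =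
    (\<Sum>p\<leftarrow>l. \<Sum>q\<leftarrow>l'. \<phi> (fst p \<otimes>\<^bsub>A\<^esub> fst q) (snd p \<otimes>\<^bsub>B\<^esub> snd q))"
proof -
  let ?\<psi> = "\<lambda>x y. ts l' (\<lambda>x' y'. \<phi> (x \<otimes>\<^bsub>A\<^esub> x') (y \<otimes>\<^bsub>B\<^esub> y'))"
  have eq: "?\<psi> x y = (\<Sum>q\<leftarrow>l'. \<phi> (x \<otimes>\<^bsub>A\<^esub> fst q) (y \<otimes>\<^bsub>B\<^esub> snd q))"
    if "x \<in> carrier A" "y \<in> carrier B" for x y
    using BF_left_translate[OF \<phi> that] by (simp add: ts_eval)
  have "(\<lambda>x y. \<Sum>q\<leftarrow>l'. \<phi> (x \<otimes>\<^bsub>A\<^esub> fst q) (y \<otimes>\<^bsub>B\<^esub> snd q)) \<in> BF"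
    using l(2) by (intro BF_sum_list BF_right_translate \<phi>) auto
  then have "?\<psi> \<in> BF" by (rule BF_cong) (rule eq)
  then have "(ts l \<otimes>\<^bsub>AT\<^esub> ts l') \<phi> = (\<Sum>p\<leftarrow>l. ?\<psi> (fst p) (snd p))"
    using \<phi> by (simp add: algebraic_tensor_def ts_eval)
  also have "\<dots> = (\<Sum>p\<leftarrow>l. \<Sum>q\<leftarrow>l'. \<phi> (fst p \<otimes>\<^bsub>A\<^esub> fst q) (snd p \<otimes>\<^bsub>B\<^esub> snd q))"
    using l(1) by (intro arg_cong[where f=sum_list] map_cong refl eq) auto
  finally show ?thesis .
qed

lemma rep_tensor_product_list: "rep l \<Longrightarrow> rep l' \<Longrightarrow> rep (tensor_product_list A B l l')"
  by (auto simp: tensor_product_list_def intro!: A.mult_closed B.mult_closed)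

lemma ts_mult:
  assumes "rep l" "rep l'"
  shows "ts l \<otimes>\<^bsub>AT\<^esub> ts l' = ts (tensor_product_list A B l l')"
proof
  fix \<phi>
  show "(ts l \<otimes>\<^bsub>AT\<^esub> ts l') \<phi> = ts (tensor_product_list A B l l') \<phi>"
  proof (cases "\<phi> \<in> BF")
    case True
    then show ?thesis using assms by (simp add: mult_eval ts_eval sum_list_tensor_product_list)
  next
    case False
    then show ?thesis by (simp add: ts_outside) (simp add: algebraic_tensor_def)
  qed
qed

lemma ts_add: "ts l \<oplus>\<^bsub>AT\<^esub> ts l' = ts (l @ l')"
  by (simp add: ts_append algebraic_tensor_def)

lemma ts_zero: "\<zero>\<^bsub>AT\<^esub> = ts []"
  by (simp add: algebraic_tensor_def tensor_sum_def)

lemma ts_smult: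
  assumes "rep l" shows "c \<odot>\<^bsub>AT\<^esub> ts l = ts (map (\<lambda>p. (c \<odot>\<^bsub>A\<^esub> fst p, snd p)) l)"
proof
  fix \<phi>
  show "(c \<odot>\<^bsub>AT\<^esub> ts l) \<phi> = ts (map (\<lambda>p. (c \<odot>\<^bsub>A\<^esub> fst p, snd p)) l) \<phi>"
  proof (cases "\<phi> \<in> BF")
    case True
    have "(\<Sum>p\<leftarrow>l. \<phi> (c \<odot>\<^bsub>A\<^esub> fst p) (snd p)) = (\<Sum>p\<leftarrow>l. c * \<phi> (fst p) (snd p))"
      using assms True by (intro arg_cong[where f=sum_list] map_cong refl BF_smult1) auto
    then show ?thesis using True by (simp add: ts_eval o_def sum_list_const_mult algebraic_tensor_def)
  next
    case False
    then show ?thesis by (simp add: ts_outside algebraic_tensor_def)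
  qed
qed

lemma rep_smult: "rep l \<Longrightarrow> rep (map (\<lambda>p. (c \<odot>\<^bsub>A\<^esub> fst p, snd p)) l)"
  by (force simp: A.smult_in)

lemma weight_nonneg: "rep l \<Longrightarrow> 0 \<le> tensor_weight A B l"
  unfolding tensor_weight_def by (intro sum_list_nonneg) auto

lemma anorm_AT: "anorm AT u = Inf {tensor_weight A B l |l. rep l \<and> ts l = u}"
  by (simp add: algebraic_tensor_def tensor_weight_def)

lemma anorm_ts_le:
  assumes "rep l" shows "anorm AT (ts l) \<le> tensor_weight A B l"
  unfolding anorm_AT
  by (rule cInf_lower) (use assms weight_nonneg in \<open>auto intro!: bdd_belowI[of _ 0]\<close>)

lemma anorm_AT_nonneg: "u \<in> carrier AT \<Longrightarrow> 0 \<le> anorm AT u"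
  unfolding anorm_AT carrier_AT by (rule cInf_greatest) (auto intro: weight_nonneg)

lemma anorm_AT_less:
  assumes "u \<in> carrier AT" "anorm AT u < e"
  obtains l where "rep l" "ts l = u" "tensor_weight A B l < e"
proof -
  have "{tensor_weight A B l |l. rep l \<and> ts l = u} \<noteq> {}" using assms(1) unfolding carrier_AT by auto
  from cInf_lessD[OF this assms(2)[unfolded anorm_AT]] show thesis using that by auto
qed

lemma weight_append: "tensor_weight A B (l @ l') = tensor_weight A B l + tensor_weight A B l'"
  by (simp add: tensor_weight_def)

lemma weight_smult:
  "rep l \<Longrightarrow> tensor_weight A B (map (\<lambda>p. (c \<odot>\<^bsub>A\<^esub> fst p, snd p)) l) = cmod c * tensor_weight A B l"
  by (induction l) (auto simp: tensor_weight_def A.anorm_smult algebra_simps)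

lemma weight_tensor_product_list:
  assumes "rep l" "rep l'"
  shows "tensor_weight A B (tensor_product_list A B l l') \<le> tensor_weight A B l * tensor_weight A B l'"
proof -
  have le: "anorm A (fst p \<otimes>\<^bsub>A\<^esub> fst q) * anorm B (snd p \<otimes>\<^bsub>B\<^esub> snd q)
      \<le> (anorm A (fst p) * anorm B (snd p)) * (anorm A (fst q) * anorm B (snd q))"
    if "p \<in> set l" "q \<in> set l'" for p q
  proof -
    have c: "fst p \<in> carrier A" "fst q \<in> carrier A" "snd p \<in> carrier B" "snd q \<in> carrier B"
      using assms that by auto
    have "anorm A (fst p \<otimes>\<^bsub>A\<^esub> fst q) * anorm B (snd p \<otimes>\<^bsub>B\<^esub> snd q)
      \<le> (anorm A (fst p) * anorm A (fst q)) * (anorm B (snd p) * anorm B (snd q))"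
      using c by (intro mult_mono A.anorm_mult B.anorm_mult) auto
    then show ?thesis by (simp add: mult_ac)
  qed
  have "tensor_weight A B (tensor_product_list A B l l') =
    (\<Sum>p\<leftarrow>l. \<Sum>q\<leftarrow>l'. anorm A (fst p \<otimes>\<^bsub>A\<^esub> fst q) * anorm B (snd p \<otimes>\<^bsub>B\<^esub> snd q))"
    by (simp add: tensor_weight_def sum_list_tensor_product_list)
  also have "\<dots> \<le> (\<Sum>p\<leftarrow>l. \<Sum>q\<leftarrow>l'. (anorm A (fst p) * anorm B (snd p)) * (anorm A (fst q) * anorm B (snd q)))"
    by (intro sum_list_mono le)
  also have "\<dots> = tensor_weight A B l * tensor_weight A B l'"
    by (simp add: tensor_weight_def case_prod_unfold sum_list_const_mult sum_list_mult_const)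
  finally show ?thesis .
qed

lemma AT_uminus: "rep l \<Longrightarrow> ts (map (\<lambda>p. ((-1) \<odot>\<^bsub>A\<^esub> fst p, snd p)) l) \<oplus>\<^bsub>AT\<^esub> ts l = \<zero>\<^bsub>AT\<^esub>"
proof -
  assume l: "rep l"
  have "((-1) \<odot>\<^bsub>AT\<^esub> ts l) \<oplus>\<^bsub>AT\<^esub> ts l = \<zero>\<^bsub>AT\<^esub>"
    by (simp add: algebraic_tensor_def)
  then show ?thesis unfolding ts_smult[OF l] .
qed

lemma module_AT: "module complex_field AT"
proof -
  have "abelian_group AT"
  proof (rule abelian_groupI)
    fix u assume "u \<in> carrier AT"
    then obtain l where l: "rep l" "u = ts l" by (rule AT_cases)
    show "\<exists>v\<in>carrier AT. v \<oplus>\<^bsub>AT\<^esub> u = \<zero>\<^bsub>AT\<^esub>"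
      unfolding l(2) using AT_uminus[OF l(1)] ts_in[OF rep_smult[OF l(1), of "-1"]] by (rule bexI)
  next
    fix u v assume "u \<in> carrier AT" "v \<in> carrier AT"
    then obtain l l' where l: "rep l" "u = ts l" "rep l'" "v = ts l'" by (elim AT_cases) blast
    show "u \<oplus>\<^bsub>AT\<^esub> v \<in> carrier AT" unfolding l ts_add by (rule ts_in) (use l in simp)
  next
    show "\<zero>\<^bsub>AT\<^esub> \<in> carrier AT" by (simp add: ts_zero)
  qed (simp_all add: algebraic_tensor_def fun_eq_iff)
  moreover have "c \<odot>\<^bsub>AT\<^esub> u \<in> carrier AT" if u: "u \<in> carrier AT" for c u
  proof -
    obtain l where l: "rep l" "u = ts l" using u by (rule AT_cases)
    show ?thesis unfolding l(2) ts_smult[OF l(1)] by (rule ts_in[OF rep_smult[OF l(1)]])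
  qed
  ultimately show ?thesis
    by (intro moduleI cring_complex_field)
      (simp_all add: algebraic_tensor_def fun_eq_iff algebra_simps)
qed

lemma seminormed_AT: "seminormed_algebra AT"
proof (intro seminormed_algebra.intro seminormed_algebra_axioms.intro module_AT)
  fix u v assume u: "u \<in> carrier AT" and v: "v \<in> carrier AT"
  obtain l where l: "rep l" "u = ts l" using u by (rule AT_cases)
  obtain l' where l': "rep l'" "v = ts l'" using v by (rule AT_cases)
  note uv = l l'
  have sm: "c \<odot>\<^bsub>AT\<^esub> ts k \<in> carrier AT" if "rep k" for c k
    unfolding ts_smult[OF that] by (rule ts_in[OF rep_smult[OF that]])
  show uvc: "u \<otimes>\<^bsub>AT\<^esub> v \<in> carrier AT"
    unfolding uv using uv by (simp add: ts_mult rep_tensor_product_list)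
  show "(c \<odot>\<^bsub>AT\<^esub> u) \<otimes>\<^bsub>AT\<^esub> v = c \<odot>\<^bsub>AT\<^esub> (u \<otimes>\<^bsub>AT\<^esub> v)" for c
    by (simp add: algebraic_tensor_def fun_eq_iff)
  show "u \<otimes>\<^bsub>AT\<^esub> (c \<odot>\<^bsub>AT\<^esub> v) = c \<odot>\<^bsub>AT\<^esub> (u \<otimes>\<^bsub>AT\<^esub> v)" for c
  proof
    fix \<phi>
    have *: "(c \<odot>\<^bsub>AT\<^esub> w) \<phi> = c * w \<phi>" for w by (simp add: algebraic_tensor_def)
    show "(u \<otimes>\<^bsub>AT\<^esub> (c \<odot>\<^bsub>AT\<^esub> v)) \<phi> = (c \<odot>\<^bsub>AT\<^esub> (u \<otimes>\<^bsub>AT\<^esub> v)) \<phi>"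
    proof (cases "\<phi> \<in> BF")
      case True
      have "(u \<otimes>\<^bsub>AT\<^esub> (c \<odot>\<^bsub>AT\<^esub> v)) \<phi> =
        (\<Sum>p\<leftarrow>l. \<Sum>q\<leftarrow>l'. \<phi> (fst p \<otimes>\<^bsub>A\<^esub> (c \<odot>\<^bsub>A\<^esub> fst q)) (snd p \<otimes>\<^bsub>B\<^esub> snd q))"
        unfolding uv ts_smult[OF l'(1)] mult_eval[OF True l(1) rep_smult[OF l'(1)]] by (simp add: o_def)
      also have "\<dots> = (\<Sum>p\<leftarrow>l. \<Sum>q\<leftarrow>l'. c * \<phi> (fst p \<otimes>\<^bsub>A\<^esub> fst q) (snd p \<otimes>\<^bsub>B\<^esub> snd q))"
      proof (intro arg_cong[where f=sum_list] map_cong refl)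
        fix p q assume "p \<in> set l" "q \<in> set l'"
        note [simp] = repD[OF l(1) this(1)] repD[OF l'(1) this(2)]
        show "\<phi> (fst p \<otimes>\<^bsub>A\<^esub> (c \<odot>\<^bsub>A\<^esub> fst q)) (snd p \<otimes>\<^bsub>B\<^esub> snd q) =
          c * \<phi> (fst p \<otimes>\<^bsub>A\<^esub> fst q) (snd p \<otimes>\<^bsub>B\<^esub> snd q)"
          by (simp add: A.mult_smult_right BF_smult1[OF True])
      qed
      finally show ?thesis
        unfolding * using mult_eval[OF True l(1) l'(1)] uv by (simp add: sum_list_const_mult)
    next
      case False
      then show ?thesis by (simp add: algebraic_tensor_def)
    qed
  qed
  show "anorm AT (u \<oplus>\<^bsub>AT\<^esub> v) \<le> anorm AT u + anorm AT v"
  proof (rule field_le_epsilon)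
    fix e :: real assume e: "e > 0"
    have "anorm AT u < anorm AT u + e/2" "anorm AT v < anorm AT v + e/2" using e by auto
    then obtain k k' where k: "rep k" "ts k = u" "tensor_weight A B k < anorm AT u + e/2"
      and k': "rep k'" "ts k' = v" "tensor_weight A B k' < anorm AT v + e/2"
      using anorm_AT_less[OF u] anorm_AT_less[OF v] by metis
    have "u \<oplus>\<^bsub>AT\<^esub> v = ts (k @ k')" using k(2) k'(2) by (simp flip: ts_add)
    then have "anorm AT (u \<oplus>\<^bsub>AT\<^esub> v) \<le> tensor_weight A B (k @ k')"
      using anorm_ts_le[of "k @ k'"] k k' by simp
    then show "anorm AT (u \<oplus>\<^bsub>AT\<^esub> v) \<le> anorm AT u + anorm AT v + e"
      using k k' by (simp add: weight_append)
  qed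
  show "0 \<le> anorm AT u" by (rule anorm_AT_nonneg[OF u])
  have smult_le: "anorm AT (c \<odot>\<^bsub>AT\<^esub> w) \<le> cmod c * anorm AT w" if w: "w \<in> carrier AT" for c w
  proof (rule field_le_epsilon)
    fix e :: real assume e: "e > 0"
    have "anorm AT w < anorm AT w + e / (cmod c + 1)" using e by (simp add: add_nonneg_pos)
    then obtain k where k: "rep k" "ts k = w" "tensor_weight A B k < anorm AT w + e / (cmod c + 1)"
      using anorm_AT_less[OF w] by metis
    have "anorm AT (c \<odot>\<^bsub>AT\<^esub> w) \<le> cmod c * tensor_weight A B k"
      using anorm_ts_le[OF rep_smult[OF k(1), of c]] k by (simp add: weight_smult ts_smult[OF k(1), symmetric])
    also have "\<dots> \<le> cmod c * (anorm AT w + e / (cmod c + 1))" using k by (intro mult_left_mono) auto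
    also have "\<dots> \<le> cmod c * anorm AT w + e"
    proof -
      have "0 < cmod c + 1" by (simp add: add_nonneg_pos)
      then have "cmod c * (e / (cmod c + 1)) \<le> e"
        using e by (simp add: pos_divide_le_eq distrib_left mult.commute)
      then show ?thesis by (simp add: distrib_left)
    qed
    finally show "anorm AT (c \<odot>\<^bsub>AT\<^esub> w) \<le> cmod c * anorm AT w + e" .
  qed
  show "anorm AT (c \<odot>\<^bsub>AT\<^esub> u) = cmod c * anorm AT u" for c
  proof (rule antisym[OF smult_le[OF u]])
    show "cmod c * anorm AT u \<le> anorm AT (c \<odot>\<^bsub>AT\<^esub> u)"
    proof (cases "c = 0")
      case True
      have "c \<odot>\<^bsub>AT\<^esub> u \<in> carrier AT" using l sm by simp
      then show ?thesis using True anorm_AT_nonneg by simp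
    next
      case False
      have "u = inverse c \<odot>\<^bsub>AT\<^esub> (c \<odot>\<^bsub>AT\<^esub> u)" using False by (simp add: algebraic_tensor_def fun_eq_iff)
      then have "anorm AT u \<le> cmod (inverse c) * anorm AT (c \<odot>\<^bsub>AT\<^esub> u)"
        using smult_le[of "c \<odot>\<^bsub>AT\<^esub> u" "inverse c"] l sm by simp
      then show ?thesis using False by (simp add: norm_inverse norm_divide field_simps)
    qed
  qed
  show "anorm AT (u \<otimes>\<^bsub>AT\<^esub> v) \<le> anorm AT u * anorm AT v"
  proof (rule tendsto_lowerbound)
    show "((\<lambda>e. (anorm AT u + e) * (anorm AT v + e)) \<longlongrightarrow> anorm AT u * anorm AT v) (at_right 0)"
      by (auto intro!: tendsto_eq_intros)
    have "anorm AT (u \<otimes>\<^bsub>AT\<^esub> v) \<le> (anorm AT u + e) * (anorm AT v + e)" if e: "e > 0" for e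
    proof -
      have "anorm AT u < anorm AT u + e" "anorm AT v < anorm AT v + e" using e by auto
      then obtain k k' where k: "rep k" "ts k = u" "tensor_weight A B k < anorm AT u + e"
        and k': "rep k'" "ts k' = v" "tensor_weight A B k' < anorm AT v + e"
        using anorm_AT_less[OF u] anorm_AT_less[OF v] by metis
      have "anorm AT (u \<otimes>\<^bsub>AT\<^esub> v) \<le> tensor_weight A B (tensor_product_list A B k k')"
        using anorm_ts_le[OF rep_tensor_product_list[OF k(1) k'(1)]] ts_mult[OF k(1) k'(1)] k k' by simp
      also have "\<dots> \<le> tensor_weight A B k * tensor_weight A B k'"
        by (rule weight_tensor_product_list[OF k(1) k'(1)])
      also have "\<dots> \<le> (anorm AT u + e) * (anorm AT v + e)"
        using k k' weight_nonneg anorm_AT_nonneg[OF u] e by (intro mult_mono) auto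
      finally show ?thesis .
    qed
    then show "\<forall>\<^sub>F e in at_right 0. anorm AT (u \<otimes>\<^bsub>AT\<^esub> v) \<le> (anorm AT u + e) * (anorm AT v + e)"
      by (simp add: eventually_at_filter)
  qed simp
next
  fix u v w assume "u \<in> carrier AT" "v \<in> carrier AT" "w \<in> carrier AT"
  then obtain l l' l'' where l: "rep l" "u = ts l" "rep l'" "v = ts l'" "rep l''" "w = ts l''"
    by (elim AT_cases) blast
  show "(u \<oplus>\<^bsub>AT\<^esub> v) \<otimes>\<^bsub>AT\<^esub> w = u \<otimes>\<^bsub>AT\<^esub> w \<oplus>\<^bsub>AT\<^esub> v \<otimes>\<^bsub>AT\<^esub> w"
    by (simp add: algebraic_tensor_def fun_eq_iff)
  show "u \<otimes>\<^bsub>AT\<^esub> (v \<oplus>\<^bsub>AT\<^esub> w) = u \<otimes>\<^bsub>AT\<^esub> v \<oplus>\<^bsub>AT\<^esub> u \<otimes>\<^bsub>AT\<^esub> w"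
    unfolding l ts_add using l
    by (simp add: ts_mult ts_add rep_tensor_product_list)
      (rule ts_eqI, simp add: ts_eval sum_list_tensor_product_list sum_list_addf)
  show "(u \<otimes>\<^bsub>AT\<^esub> v) \<otimes>\<^bsub>AT\<^esub> w = u \<otimes>\<^bsub>AT\<^esub> (v \<otimes>\<^bsub>AT\<^esub> w)"
  proof -
    have "ts (tensor_product_list A B (tensor_product_list A B l l') l'') =
      ts (tensor_product_list A B l (tensor_product_list A B l' l''))"
    proof (rule ts_eqI)
      fix \<phi> assume \<phi>: "\<phi> \<in> BF"
      show "ts (tensor_product_list A B (tensor_product_list A B l l') l'') \<phi> =
        ts (tensor_product_list A B l (tensor_product_list A B l' l'')) \<phi>"
        unfolding ts_eval[OF \<phi>] sum_list_tensor_product_list fst_conv snd_conv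
      proof (intro arg_cong[where f=sum_list] map_cong refl)
        fix p q r assume "p \<in> set l" "q \<in> set l'" "r \<in> set l''"
        note [simp] = repD[OF l(1) this(1)] repD[OF l(3) this(2)] repD[OF l(5) this(3)]
        show "\<phi> (fst p \<otimes>\<^bsub>A\<^esub> fst q \<otimes>\<^bsub>A\<^esub> fst r) (snd p \<otimes>\<^bsub>B\<^esub> snd q \<otimes>\<^bsub>B\<^esub> snd r) =
          \<phi> (fst p \<otimes>\<^bsub>A\<^esub> (fst q \<otimes>\<^bsub>A\<^esub> fst r)) (snd p \<otimes>\<^bsub>B\<^esub> (snd q \<otimes>\<^bsub>B\<^esub> snd r))"
          by (simp add: A.mult_assoc B.mult_assoc)
      qed
    qed
    then show ?thesis using l by (simp add: ts_mult rep_tensor_product_list)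
  qed
qed

end

sublocale tensor_pair \<subseteq> AT: seminormed_algebra AT
  by (rule seminormed_AT)

lemma (in tensor_pair) banach_projective_tensor: "banach_algebra AB"
  unfolding projective_tensor_def by (rule AT.completion_banach)

subsection \<open>Powers of tensors\<close>

lemma sum_list_swap:
  fixes f :: "'a \<Rightarrow> 'b \<Rightarrow> 'c::comm_monoid_add"
  shows "(\<Sum>x\<leftarrow>xs. \<Sum>y\<leftarrow>ys. f x y) = (\<Sum>y\<leftarrow>ys. \<Sum>x\<leftarrow>xs. f x y)"
  by (induction xs) (simp_all add: sum_list_addf)

lemma sum_list_n_lists_Suc:
  fixes f :: "'a list \<Rightarrow> 'b::comm_monoid_add"
  shows "(\<Sum>ws\<leftarrow>List.n_lists (Suc n) l. f ws) = (\<Sum>p\<leftarrow>l. \<Sum>ws\<leftarrow>List.n_lists n l. f (p # ws))"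
proof -
  have eq: "(\<Sum>ws\<leftarrow>concat (map (\<lambda>ys. map (\<lambda>y. y # ys) l) L). f ws) = (\<Sum>ws\<leftarrow>L. \<Sum>p\<leftarrow>l. f (p # ws))" for L
    by (induction L) (simp_all add: o_def)
  show ?thesis unfolding List.n_lists.simps(2) eq by (rule sum_list_swap)
qed

lemma sum_list_n_lists_prod_list:
  fixes f :: "'a \<Rightarrow> real"
  shows "(\<Sum>ws\<leftarrow>List.n_lists n l. prod_list (map f ws)) = (\<Sum>p\<leftarrow>l. f p) ^ n"
proof (induction n)
  case (Suc n)
  then show ?case
    unfolding sum_list_n_lists_Suc by (simp add: sum_list_const_mult sum_list_mult_const)
qed simp

lemma sum_list_le_length:
  fixes f :: "'a \<Rightarrow> real"
  assumes "\<And>x. x \<in> set xs \<Longrightarrow> f x \<le> c" shows "(\<Sum>x\<leftarrow>xs. f x) \<le> real (length xs) * c"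
  using assms by (induction xs) (auto simp: algebra_simps intro: add_mono)

lemma (in seminormed_algebra) anorm_word_product:
  assumes "set ws \<subseteq> carrier A" "ws \<noteq> []"
  shows "anorm A (word_product A ws) \<le> prod_list (map (anorm A) ws)"
  using assms
proof (induction ws)
  case (Cons x ws)
  show ?case
  proof (cases "ws = []")
    case False
    have "anorm A (x \<otimes> word_product A ws) \<le> anorm A x * anorm A (word_product A ws)"
      using Cons.prems by (intro anorm_mult word_product_closed) auto
    also have "\<dots> \<le> anorm A x * prod_list (map (anorm A) ws)"
      using Cons False by (intro mult_left_mono) auto
    finally show ?thesis using False by (simp add: word_product_Cons)
  qed simp
qed simp

context tensor_pair
begin

definition tensor_words :: "nat \<Rightarrow> ('a \<times> 'b) list \<Rightarrow> ('a \<times> 'b) list" where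
  "tensor_words n l =
    map (\<lambda>ws. (word_product A (map fst ws), word_product B (map snd ws))) (List.n_lists n l)"

lemma rep_words: "rep l \<Longrightarrow> ws \<in> set (List.n_lists n l) \<Longrightarrow> set (map fst ws) \<subseteq> carrier A \<and> set (map snd ws) \<subseteq> carrier B"
  by (auto simp: set_n_lists)

lemma rep_tensor_words: "rep l \<Longrightarrow> rep (tensor_words n l)"
  using rep_words[of l _ n] A.word_product_closed B.word_product_closed
  unfolding tensor_words_def by fastforce

lemma ts_power:
  assumes l: "rep l"
  shows "word_product AT (replicate (Suc n) (ts l)) = ts (tensor_words (Suc n) l)"
proof (induction n)
  case 0
  show ?case
    by (simp add: tensor_words_def, rule ts_eqI) (simp add: ts_eval o_def)
next
  case (Suc n)
  have "word_product AT (replicate (Suc (Suc n)) (ts l)) = ts l \<otimes>\<^bsub>AT\<^esub> ts (tensor_words (Suc n) l)"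
    using Suc by simp
  also have "\<dots> = ts (tensor_product_list A B l (tensor_words (Suc n) l))"
    by (rule ts_mult[OF l rep_tensor_words[OF l]])
  also have "\<dots> = ts (tensor_words (Suc (Suc n)) l)"
  proof (rule ts_eqI)
    fix \<phi> assume \<phi>: "\<phi> \<in> BF"
    have "ts (tensor_words (Suc (Suc n)) l) \<phi> = (\<Sum>ws\<leftarrow>List.n_lists (Suc (Suc n)) l.
        \<phi> (word_product A (map fst ws)) (word_product B (map snd ws)))"
      unfolding ts_eval[OF \<phi>] tensor_words_def by (simp only: map_map o_def fst_conv snd_conv)
    also have "\<dots> = (\<Sum>p\<leftarrow>l. \<Sum>ws\<leftarrow>List.n_lists (Suc n) l.
        \<phi> (word_product A (map fst (p # ws))) (word_product B (map snd (p # ws))))"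
      by (rule sum_list_n_lists_Suc)
    also have "\<dots> = (\<Sum>p\<leftarrow>l. \<Sum>ws\<leftarrow>List.n_lists (Suc n) l.
        \<phi> (fst p \<otimes>\<^bsub>A\<^esub> word_product A (map fst ws)) (snd p \<otimes>\<^bsub>B\<^esub> word_product B (map snd ws)))"
    proof (intro arg_cong[where f=sum_list] map_cong refl)
      fix p ws assume "ws \<in> set (List.n_lists (Suc n) l)"
      then have "ws \<noteq> []" using length_n_lists_elem by fastforce
      then show "\<phi> (word_product A (map fst (p # ws))) (word_product B (map snd (p # ws))) =
        \<phi> (fst p \<otimes>\<^bsub>A\<^esub> word_product A (map fst ws)) (snd p \<otimes>\<^bsub>B\<^esub> word_product B (map snd ws))"
        by (simp add: word_product_Cons)
    qed
    finally show "ts (tensor_product_list A B l (tensor_words (Suc n) l)) \<phi> = ts (tensor_words (Suc (Suc n)) l) \<phi>"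
      unfolding ts_eval[OF \<phi>, of "tensor_product_list A B l (tensor_words (Suc n) l)"] sum_list_tensor_product_list
      unfolding tensor_words_def by (simp only: map_map o_def fst_conv snd_conv)
  qed
  finally show ?case .
qed

lemma anorm_power_le_sum:
  assumes l: "rep l" and n: "n \<ge> 1"
  shows "anorm AT (word_product AT (replicate n (ts l))) \<le>
    (\<Sum>ws\<leftarrow>List.n_lists n l. anorm A (word_product A (map fst ws)) * anorm B (word_product B (map snd ws)))"
proof -
  have "anorm AT (word_product AT (replicate n (ts l))) = anorm AT (ts (tensor_words n l))"
    using ts_power[OF l, of "n - 1"] n by simp
  also have "\<dots> \<le> tensor_weight A B (tensor_words n l)" by (rule anorm_ts_le[OF rep_tensor_words[OF l]])
  finally show ?thesis by (simp add: tensor_weight_def tensor_words_def o_def)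
qed

text \<open>
  The two bounds below suit the two inclusions: here only the left factors are controlled along
  words and the right factors are summable; in the next lemma the number of terms is what counts.
\<close>

lemma anorm_power_le_left:
  assumes l: "rep l" and n: "n \<ge> 1"
    and bound: "\<And>ws. length ws = n \<Longrightarrow> set ws \<subseteq> fst ` set l \<Longrightarrow> anorm A (word_product A ws) \<le> c"
  shows "anorm AT (word_product AT (replicate n (ts l))) \<le> c * (\<Sum>p\<leftarrow>l. anorm B (snd p)) ^ n"
proof -
  have "anorm A (word_product A (map fst ws)) * anorm B (word_product B (map snd ws))
    \<le> c * prod_list (map (\<lambda>p. anorm B (snd p)) ws)" if ws: "ws \<in> set (List.n_lists n l)" for ws
  proof (rule mult_mono)
    have len: "length ws = n" "set ws \<subseteq> set l" using ws by (auto simp: set_n_lists)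
    then show c: "anorm A (word_product A (map fst ws)) \<le> c" by (intro bound) auto
    have w: "set (map fst ws) \<subseteq> carrier A" "set (map snd ws) \<subseteq> carrier B" using rep_words[OF l ws] by auto
    have "map snd ws \<noteq> []" using len n by auto
    then show "anorm B (word_product B (map snd ws)) \<le> prod_list (map (\<lambda>p. anorm B (snd p)) ws)"
      using B.anorm_word_product[OF w(2)] by (simp add: o_def)
    show "0 \<le> c" by (rule order_trans[OF A.anorm_nonneg c]) (rule A.word_product_closed[OF w(1)])
    show "0 \<le> anorm B (word_product B (map snd ws))" by (rule B.anorm_nonneg[OF B.word_product_closed[OF w(2)]])
  qed
  then have "(\<Sum>ws\<leftarrow>List.n_lists n l. anorm A (word_product A (map fst ws)) * anorm B (word_product B (map snd ws)))
    \<le> (\<Sum>ws\<leftarrow>List.n_lists n l. c * prod_list (map (\<lambda>p. anorm B (snd p)) ws))"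
    by (rule sum_list_mono)
  also have "\<dots> = c * (\<Sum>p\<leftarrow>l. anorm B (snd p)) ^ n"
    by (simp add: sum_list_const_mult sum_list_n_lists_prod_list)
  finally show ?thesis using anorm_power_le_sum[OF l n] by linarith
qed

lemma anorm_power_le_card:
  assumes l: "rep l" and n: "n \<ge> 1"
    and bound: "\<And>ws. length ws = n \<Longrightarrow> set ws \<subseteq> set l \<Longrightarrow>
      anorm A (word_product A (map fst ws)) * anorm B (word_product B (map snd ws)) \<le> c"
  shows "anorm AT (word_product AT (replicate n (ts l))) \<le> real (length l) ^ n * c"
proof -
  have "(\<Sum>ws\<leftarrow>List.n_lists n l. anorm A (word_product A (map fst ws)) * anorm B (word_product B (map snd ws)))
    \<le> real (length (List.n_lists n l)) * c"
    by (rule sum_list_le_length) (use bound in \<open>auto simp: set_n_lists\<close>)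
  then show ?thesis using anorm_power_le_sum[OF l n] by (simp add: length_n_lists)
qed

end

subsection \<open>Linear functionals and slice maps\<close>

definition linear_functionals :: "'a nalg \<Rightarrow> ('a \<Rightarrow> complex) set" where
  "linear_functionals A = {f. (\<forall>x\<in>carrier A. \<forall>y\<in>carrier A. f (x \<oplus>\<^bsub>A\<^esub> y) = f x + f y) \<and>
     (\<forall>c. \<forall>x\<in>carrier A. f (c \<odot>\<^bsub>A\<^esub> x) = c * f x)}"

lemma (in seminormed_algebra) linear_functional_diff:
  assumes f: "f \<in> linear_functionals A" and x: "x \<in> carrier A" "y \<in> carrier A"
  shows "f (x \<ominus> y) = f x - f y"
proof -
  have "f (x \<oplus> (-1) \<odot> y) = f x + (-1) * f y" using f x by (simp add: linear_functionals_def)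
  then show ?thesis using x by (simp add: minus_eq smult_minus1)
qed

text \<open>
  A subspace \<open>L\<close> maximal among those avoiding \<open>x0\<close> is a complement of the line through \<open>x0\<close>, and
  the coordinate along that line is the functional.
\<close>

lemma (in seminormed_algebra) linear_functional_separates:
  assumes x0: "x0 \<in> carrier A" "x0 \<noteq> \<zero>"
  shows "\<exists>f\<in>linear_functionals A. f x0 \<noteq> 0"
proof -
  let ?S = "\<lambda>L. L \<subseteq> carrier A \<and> \<zero> \<in> L \<and> (\<forall>x\<in>L. \<forall>y\<in>L. x \<oplus> y \<in> L) \<and> (\<forall>c. \<forall>x\<in>L. c \<odot> x \<in> L)"
  let ?I = "{L. ?S L \<and> x0 \<notin> L}"
  have "\<exists>L\<in>?I. \<forall>K\<in>?I. L \<subseteq> K \<longrightarrow> K = L"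
  proof (rule subset_Zorn_nonempty)
    have "{\<zero>} \<in> ?I" using x0 by auto
    then show "?I \<noteq> {}" by blast
    fix C assume C: "C \<noteq> {}" "subset.chain ?I C"
    then have I: "K \<in> C \<Longrightarrow> ?S K \<and> x0 \<notin> K" for K by (auto simp: subset.chain_def)
    have add: "x \<oplus> y \<in> \<Union>C" if xy: "x \<in> \<Union>C" "y \<in> \<Union>C" for x y
    proof -
      obtain K K' where K: "K \<in> C" "K' \<in> C" "x \<in> K" "y \<in> K'" using xy by blast
      then have "K \<subseteq> K' \<or> K' \<subseteq> K" using C(2) by (auto simp: subset_chain_def)
      then obtain K'' where "K'' \<in> C" "x \<in> K''" "y \<in> K''" using K by blast
      then show "x \<oplus> y \<in> \<Union>C" using I by blast
    qed
    have sm: "c \<odot> x \<in> \<Union>C" if "x \<in> \<Union>C" for c x using that I by blast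
    have "\<Union>C \<subseteq> carrier A" "\<zero> \<in> \<Union>C" "x0 \<notin> \<Union>C" using I C(1) by blast+
    then show "\<Union>C \<in> ?I" using add sm by (intro CollectI conjI ballI allI)
  qed
  then obtain L where LI: "L \<in> ?I" and LM: "\<forall>K\<in>?I. L \<subseteq> K \<longrightarrow> K = L" by (rule bexE)
  have L: "?S L" "x0 \<notin> L" using LI by simp_all
  have max: "K = L" if "?S K" "x0 \<notin> K" "L \<subseteq> K" for K
    using LM that by simp
  have Lc: "l \<in> carrier A" if "l \<in> L" for l using L(1) that by blast
  have Ladd: "l \<oplus> l' \<in> L" if "l \<in> L" "l' \<in> L" for l l' using L(1) that by blast
  have Lsm: "c \<odot> l \<in> L" if "l \<in> L" for l c using L(1) that by blast
  have ex: "\<exists>c. x \<ominus> c \<odot> x0 \<in> L" if x: "x \<in> carrier A" for x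
  proof (cases "x \<in> L")
    case True
    then show ?thesis using x x0 by (intro exI[of _ 0]) simp
  next
    case False
    let ?K = "{l \<oplus> c \<odot> x |l c. l \<in> L}"
    have LK: "L \<subseteq> ?K"
    proof
      fix l assume l: "l \<in> L"
      then have "l = l \<oplus> 0 \<odot> x" using Lc x by simp
      then show "l \<in> ?K" using l by blast
    qed
    have zL: "\<zero> \<in> L" using L(1) by blast
    have "x = \<zero> \<oplus> 1 \<odot> x" using x by simp
    then have xK: "x \<in> ?K" using zL by blast
    have SK: "?S ?K"
    proof (intro conjI ballI allI)
      show "?K \<subseteq> carrier A" using Lc x by auto
      show "\<zero> \<in> ?K" using LK zL by blast
      fix a b assume "a \<in> ?K" "b \<in> ?K"
      then obtain l c l' c' where lc: "l \<in> L" "l' \<in> L" "a = l \<oplus> c \<odot> x" "b = l' \<oplus> c' \<odot> x" by blast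
      then have "a \<oplus> b = (l \<oplus> l') \<oplus> (c + c') \<odot> x" using Lc x by (simp add: smult_add a_ac)
      then show "a \<oplus> b \<in> ?K" using Ladd[OF lc(1,2)] by blast
    next
      fix d a assume "a \<in> ?K"
      then obtain l c where lc: "l \<in> L" "a = l \<oplus> c \<odot> x" by blast
      then have "d \<odot> a = d \<odot> l \<oplus> (d * c) \<odot> x" using Lc x by (simp add: smult_distrib smult_smult)
      then show "d \<odot> a \<in> ?K" using Lsm[OF lc(1)] by blast
    qed
    have "x0 \<in> ?K"
    proof (rule ccontr)
      assume "x0 \<notin> ?K"
      then have "?K = L" using max[OF SK _ LK] by simp
      then have "x \<in> L" using xK by simp
      then show False using False by simp
    qed
    then obtain l c where lc: "l \<in> L" "x0 = l \<oplus> c \<odot> x" by auto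
    have "c \<noteq> 0"
    proof
      assume "c = 0"
      then have "x0 = l" using lc x Lc[OF lc(1)] by simp
      then show False using lc(1) L(2) by simp
    qed
    have "inverse c \<odot> x0 = inverse c \<odot> l \<oplus> x"
      using \<open>c \<noteq> 0\<close> unfolding lc(2) using lc(1) Lc x by (simp add: smult_distrib smult_smult)
    then have "x \<ominus> inverse c \<odot> x0 = \<ominus> (inverse c \<odot> l)"
      using Lc[OF lc(1)] x by (simp add: minus_eq minus_add a_ac r_neg1 r_neg2)
    also have "\<dots> = (-1) \<odot> (inverse c \<odot> l)" using lc(1) Lc by (simp add: smult_minus1)
    finally show ?thesis using Lsm lc(1) by metis
  qed
  have uniq: "c = d" if x: "x \<in> carrier A" and cd: "x \<ominus> c \<odot> x0 \<in> L" "x \<ominus> d \<odot> x0 \<in> L" for x c d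
  proof (rule ccontr)
    assume "c \<noteq> d"
    have "(x \<ominus> d \<odot> x0) \<oplus> (-1) \<odot> (x \<ominus> c \<odot> x0) \<in> L" using cd Ladd Lsm by blast
    also have "(x \<ominus> d \<odot> x0) \<oplus> (-1) \<odot> (x \<ominus> c \<odot> x0) = c \<odot> x0 \<oplus> (x \<ominus> x) \<ominus> d \<odot> x0"
      using x x0 by (simp add: smult_minus1 minus_diff) (simp add: minus_eq a_ac r_neg1 r_neg2)
    also have "\<dots> = (c - d) \<odot> x0"
    proof -
      have "\<ominus> (d \<odot> x0) = (- d) \<odot> x0"
        using smult_smult[of x0 "-1" d] smult_minus1[of "d \<odot> x0"] x0 by simp
      then show ?thesis using x x0 smult_add[of x0 c "- d"] by (simp add: minus_eq r_neg)
    qed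
    finally have "inverse (c - d) \<odot> ((c - d) \<odot> x0) \<in> L" by (rule Lsm)
    then show False using \<open>c \<noteq> d\<close> x0 L(2) by (simp add: smult_smult)
  qed
  define f where "f x = (THE c. x \<ominus> c \<odot> x0 \<in> L)" for x
  have f: "x \<ominus> f x \<odot> x0 \<in> L" if x: "x \<in> carrier A" for x
    unfolding f_def using ex[OF x] uniq[OF x] by (metis (mono_tags, lifting) theI')
  have feq: "f x = c" if "x \<in> carrier A" "x \<ominus> c \<odot> x0 \<in> L" for x c
    using uniq f that by blast
  have f1: "f x0 = 1" using x0 L(1) by (intro feq) auto
  have "f \<in> linear_functionals A"
    unfolding linear_functionals_def
  proof (intro CollectI conjI ballI allI)
    fix x y assume xy: "x \<in> carrier A" "y \<in> carrier A"
    have "(x \<ominus> f x \<odot> x0) \<oplus> (y \<ominus> f y \<odot> x0) \<in> L" using f xy Ladd by blast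
    then have "(x \<oplus> y) \<ominus> (f x + f y) \<odot> x0 \<in> L"
      using xy x0 by (simp add: smult_add add_diff_add)
    then show "f (x \<oplus> y) = f x + f y" using xy by (intro feq) auto
  next
    fix c x assume x: "x \<in> carrier A"
    have "c \<odot> (x \<ominus> f x \<odot> x0) \<in> L" using f x Lsm by blast
    then have "c \<odot> x \<ominus> (c * f x) \<odot> x0 \<in> L" using x x0 by (simp add: smult_diff smult_smult)
    then show "f (c \<odot> x) = c * f x" using x by (intro feq) auto
  qed
  then show ?thesis by (rule bexI[rotated]) (simp add: f1)
qed

context tensor_pair
begin

text \<open>
  The slice map \<open>id \<otimes> g\<close>, which sends \<open>x \<otimes> y\<close> to \<open>g(y) x\<close>, first on representations and then on
  tensors.
\<close>

definition slice_list :: "('b \<Rightarrow> complex) \<Rightarrow> ('a \<times> 'b) list \<Rightarrow> 'a" where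
  "slice_list g l = foldr (\<lambda>p u. g (snd p) \<odot>\<^bsub>A\<^esub> fst p \<oplus>\<^bsub>A\<^esub> u) l \<zero>\<^bsub>A\<^esub>"

lemma slice_list_simps [simp]:
  "slice_list g [] = \<zero>\<^bsub>A\<^esub>"
  "slice_list g (p # l) = g (snd p) \<odot>\<^bsub>A\<^esub> fst p \<oplus>\<^bsub>A\<^esub> slice_list g l"
  by (simp_all add: slice_list_def)

lemma slice_list_closed: "rep l \<Longrightarrow> slice_list g l \<in> carrier A"
  by (induction l) auto

lemma slice_list_append:
  "rep l \<Longrightarrow> rep l' \<Longrightarrow> slice_list g (l @ l') = slice_list g l \<oplus>\<^bsub>A\<^esub> slice_list g l'"
proof (induction l)
  case (Cons p l)
  then have "fst p \<in> carrier A" by auto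
  with Cons show ?case by (simp add: A.a_assoc slice_list_closed)
qed (simp add: slice_list_closed)

lemma BF_product:
  "f \<in> linear_functionals A \<Longrightarrow> g \<in> linear_functionals B \<Longrightarrow> (\<lambda>x y. f x * g y) \<in> BF"
  unfolding linear_functionals_def bilinear_forms_def by (simp add: algebra_simps)

lemma linear_functional_slice_list:
  assumes f: "f \<in> linear_functionals A" and l: "rep l"
  shows "f (slice_list g l) = (\<Sum>p\<leftarrow>l. f (fst p) * g (snd p))"
  using l
proof (induction l)
  case Nil
  have "f (0 \<odot>\<^bsub>A\<^esub> \<zero>\<^bsub>A\<^esub>) = 0 * f \<zero>\<^bsub>A\<^esub>" using f unfolding linear_functionals_def by blast
  then show ?case by simp
next
  case (Cons p l)
  have p: "fst p \<in> carrier A" "rep l" using Cons.prems by auto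
  have "f (g (snd p) \<odot>\<^bsub>A\<^esub> fst p \<oplus>\<^bsub>A\<^esub> slice_list g l) = f (g (snd p) \<odot>\<^bsub>A\<^esub> fst p) + f (slice_list g l)"
    using f p slice_list_closed[OF p(2)] unfolding linear_functionals_def by simp
  also have "f (g (snd p) \<odot>\<^bsub>A\<^esub> fst p) = g (snd p) * f (fst p)"
    using f p unfolding linear_functionals_def by simp
  finally show ?case using Cons.IH[OF p(2)] by simp
qed

text \<open>
  Tensors are functionals on bilinear forms, and \<open>f(x) g(y)\<close> is such a form for every linear
  functional \<open>f\<close>; since these \<open>f\<close> separate points, the tensor determines its slice.
\<close>

lemma slice_list_cong:
  assumes g: "g \<in> linear_functionals B" and l: "rep l" "rep l'" "ts l = ts l'"
  shows "slice_list g l = slice_list g l'"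
proof (rule ccontr)
  assume ne: "slice_list g l \<noteq> slice_list g l'"
  have c: "slice_list g l \<in> carrier A" "slice_list g l' \<in> carrier A" using l slice_list_closed by auto
  then have d: "slice_list g l \<ominus>\<^bsub>A\<^esub> slice_list g l' \<in> carrier A" "slice_list g l \<ominus>\<^bsub>A\<^esub> slice_list g l' \<noteq> \<zero>\<^bsub>A\<^esub>"
    using ne A.diff_eq_zero[OF c] by auto
  obtain f where f: "f \<in> linear_functionals A" "f (slice_list g l \<ominus>\<^bsub>A\<^esub> slice_list g l') \<noteq> 0"
    using A.linear_functional_separates[OF d] by (rule bexE)
  have "f (slice_list g l) = ts l (\<lambda>x y. f x * g y)"
    using linear_functional_slice_list[OF f(1) l(1)] ts_eval[OF BF_product[OF f(1) g]] by simp
  also have "\<dots> = f (slice_list g l')"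
    using linear_functional_slice_list[OF f(1) l(2)] ts_eval[OF BF_product[OF f(1) g]] l(3) by simp
  finally show False using f A.linear_functional_diff[OF f(1) c] by simp
qed

definition slice :: "('b \<Rightarrow> complex) \<Rightarrow> ('a, 'b) tensor \<Rightarrow> 'a" where
  "slice g u = slice_list g (SOME l. rep l \<and> ts l = u)"

lemma slice_ts:
  assumes g: "g \<in> linear_functionals B" and l: "rep l"
  shows "slice g (ts l) = slice_list g l"
proof -
  have "rep (SOME k. rep k \<and> ts k = ts l) \<and> ts (SOME k. rep k \<and> ts k = ts l) = ts l"
    by (rule someI[of _ l]) (use l in simp)
  then show ?thesis unfolding slice_def using slice_list_cong[OF g _ l] by simp
qed

lemma slice_closed: "g \<in> linear_functionals B \<Longrightarrow> u \<in> carrier AT \<Longrightarrow> slice g u \<in> carrier A"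
  by (elim AT_cases) (simp add: slice_ts slice_list_closed)

lemma slice_add:
  assumes g: "g \<in> linear_functionals B" and u: "u \<in> carrier AT" "v \<in> carrier AT"
  shows "slice g (u \<oplus>\<^bsub>AT\<^esub> v) = slice g u \<oplus>\<^bsub>A\<^esub> slice g v"
proof -
  obtain l where l: "rep l" "u = ts l" using u(1) by (rule AT_cases)
  obtain k where k: "rep k" "v = ts k" using u(2) by (rule AT_cases)
  have "rep (l @ k)" using l k by simp
  then show ?thesis unfolding l(2) k(2) ts_add using l k
    by (simp add: slice_ts[OF g] slice_list_append)
qed

lemma slice_diff:
  assumes g: "g \<in> linear_functionals B" and u: "u \<in> carrier AT" "v \<in> carrier AT"
  shows "slice g (u \<ominus>\<^bsub>AT\<^esub> v) = slice g u \<ominus>\<^bsub>A\<^esub> slice g v"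
proof -
  have c: "slice g (u \<ominus>\<^bsub>AT\<^esub> v) \<in> carrier A" "slice g v \<in> carrier A" "slice g u \<in> carrier A"
    using slice_closed[OF g] u by auto
  have "slice g (u \<ominus>\<^bsub>AT\<^esub> v) \<oplus>\<^bsub>A\<^esub> slice g v = slice g u"
    using slice_add[OF g, of "u \<ominus>\<^bsub>AT\<^esub> v" v] u by simp
  then have "slice g u \<ominus>\<^bsub>A\<^esub> slice g v = (slice g (u \<ominus>\<^bsub>AT\<^esub> v) \<oplus>\<^bsub>A\<^esub> slice g v) \<ominus>\<^bsub>A\<^esub> slice g v" by simp
  also have "\<dots> = slice g (u \<ominus>\<^bsub>AT\<^esub> v)" using c by (simp add: A.minus_eq A.a_assoc A.r_neg)
  finally show ?thesis by simp
qed

lemma anorm_slice_le: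
  assumes g: "g \<in> linear_functionals B" and K: "K \<ge> 0" "\<And>y. y \<in> carrier B \<Longrightarrow> cmod (g y) \<le> K * anorm B y"
    and u: "u \<in> carrier AT"
  shows "anorm A (slice g u) \<le> K * anorm AT u"
proof -
  have le: "anorm A (slice_list g l) \<le> K * tensor_weight A B l" if "rep l" for l
    using that
  proof (induction l)
    case (Cons p l)
    have p: "fst p \<in> carrier A" "snd p \<in> carrier B" "rep l" using Cons.prems by auto
    have "anorm A (g (snd p) \<odot>\<^bsub>A\<^esub> fst p \<oplus>\<^bsub>A\<^esub> slice_list g l)
      \<le> cmod (g (snd p)) * anorm A (fst p) + anorm A (slice_list g l)"
      using A.anorm_add[of "g (snd p) \<odot>\<^bsub>A\<^esub> fst p" "slice_list g l"] p slice_list_closed[OF p(3)]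
      by (simp add: A.anorm_smult)
    also have "\<dots> \<le> K * anorm B (snd p) * anorm A (fst p) + K * tensor_weight A B l"
      using K(2)[OF p(2)] Cons.IH[OF p(3)] p by (intro add_mono mult_right_mono) auto
    finally show ?case by (simp add: tensor_weight_def case_prod_unfold algebra_simps)
  qed (simp add: tensor_weight_def)
  show ?thesis
  proof (rule tendsto_lowerbound)
    show "((\<lambda>e. K * (anorm AT u + e)) \<longlongrightarrow> K * anorm AT u) (at_right 0)"
      by (auto intro!: tendsto_eq_intros)
    have "anorm A (slice g u) \<le> K * (anorm AT u + e)" if "e > 0" for e
    proof -
      have "anorm AT u < anorm AT u + e" using that by simp
      with u obtain l where l: "rep l" "ts l = u" "tensor_weight A B l < anorm AT u + e"
        by (rule anorm_AT_less)
      have "anorm A (slice g u) \<le> K * tensor_weight A B l"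
        using le[OF l(1)] slice_ts[OF g l(1)] l(2) by simp
      also have "\<dots> \<le> K * (anorm AT u + e)" using l(3) K(1) by (intro mult_left_mono) auto
      finally show ?thesis .
    qed
    then show "\<forall>\<^sub>F e in at_right 0. anorm A (slice g u) \<le> K * (anorm AT u + e)"
      by (simp add: eventually_at_filter)
  qed simp
qed

lemma slice_mult_simple:
  assumes g: "g \<in> linear_functionals B" and h: "h \<in> linear_functionals B"
    and gh: "\<And>y. y \<in> carrier B \<Longrightarrow> g (y \<otimes>\<^bsub>B\<^esub> b) = c * h y"
    and u: "u \<in> carrier AT" and xb: "x \<in> carrier A" "b \<in> carrier B"
  shows "slice g (u \<otimes>\<^bsub>AT\<^esub> ts [(x, b)]) = c \<odot>\<^bsub>A\<^esub> (slice h u \<otimes>\<^bsub>A\<^esub> x)"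
proof -
  obtain l where l: "rep l" "u = ts l" using u by (rule AT_cases)
  have r: "rep [(x, b)]" using xb by simp
  have "slice_list g (tensor_product_list A B l [(x, b)]) = c \<odot>\<^bsub>A\<^esub> (slice_list h l \<otimes>\<^bsub>A\<^esub> x)"
    using l(1)
  proof (induction l)
    case (Cons p l)
    have p: "fst p \<in> carrier A" "snd p \<in> carrier B" "rep l" using Cons.prems by auto
    show ?case using Cons.IH[OF p(3)] p xb slice_list_closed[OF p(3)] gh[OF p(2)]
      by (simp add: tensor_product_list_def A.mult_add_left A.mult_smult_left A.smult_distrib A.smult_smult)
  qed (use xb in \<open>simp add: tensor_product_list_def\<close>)
  then show ?thesis
    using ts_mult[OF l(1) r] slice_ts[OF g rep_tensor_product_list[OF l(1) r]] slice_ts[OF h l(1)] l(2) by simp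
qed

end

section \<open>Words and the joint spectral radius\<close>

context normed_algebra
begin

lemma word_product_snoc:
  "set ws \<subseteq> carrier A \<Longrightarrow> x \<in> carrier A \<Longrightarrow> ws \<noteq> [] \<Longrightarrow> word_product A (ws @ [x]) = word_product A ws \<otimes> x"
  by (simp add: word_product_append)

lemma set_power_eq:
  assumes M: "M \<subseteq> carrier A"
  shows "set_power A M (Suc n) = {word_product A ws |ws. length ws = Suc n \<and> set ws \<subseteq> M}"
proof (induction n)
  case 0
  have "M = {word_product A ws |ws. length ws = Suc 0 \<and> set ws \<subseteq> M}"
  proof (intro equalityI subsetI)
    fix x assume "x \<in> M"
    then show "x \<in> {word_product A ws |ws. length ws = Suc 0 \<and> set ws \<subseteq> M}"
      by (intro CollectI exI[of _ "[x]"]) simp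
  qed (auto simp: length_Suc_conv)
  then show ?case by (simp add: set_power_def)
next
  case (Suc n)
  have "set_power A M (Suc (Suc n)) = set_power A M (Suc n) <#> M"
    by (simp add: set_power_def)
  also have "\<dots> = {word_product A ws |ws. length ws = Suc (Suc n) \<and> set ws \<subseteq> M}"
    unfolding Suc
  proof (intro equalityI subsetI)
    fix z assume "z \<in> {word_product A ws |ws. length ws = Suc n \<and> set ws \<subseteq> M} <#> M"
    then obtain ws x where w: "length ws = Suc n" "set ws \<subseteq> M" "x \<in> M" "z = word_product A ws \<otimes> x"
      by (auto simp: set_mult_def)
    have "z = word_product A (ws @ [x])"
      using w M by (subst word_product_snoc) auto
    then show "z \<in> {word_product A ws |ws. length ws = Suc (Suc n) \<and> set ws \<subseteq> M}"
      using w by (intro CollectI exI[of _ "ws @ [x]"]) simp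
  next
    fix z assume "z \<in> {word_product A ws |ws. length ws = Suc (Suc n) \<and> set ws \<subseteq> M}"
    then obtain us where us: "length us = Suc (Suc n)" "set us \<subseteq> M" "z = word_product A us" by auto
    then obtain ws x where w: "us = ws @ [x]" by (metis length_Suc_conv_rev)
    then have "ws \<noteq> []" "length ws = Suc n" "set ws \<subseteq> M" "x \<in> M" using us by auto
    moreover from this have "z = word_product A ws \<otimes> x" using us(3) w M by (simp add: word_product_snoc subset_iff)
    ultimately show "z \<in> {word_product A ws |ws. length ws = Suc n \<and> set ws \<subseteq> M} <#> M"
      unfolding set_mult_def by blast
  qed
  finally show ?case .
qed

lemma anorm_word_product_le_power:
  assumes "M \<subseteq> carrier A" "\<And>x. x \<in> M \<Longrightarrow> anorm A x \<le> K" "set ws \<subseteq> M" "ws \<noteq> []"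
  shows "anorm A (word_product A ws) \<le> K ^ length ws"
proof -
  have "prod_list (map (anorm A) ws) \<le> K ^ length ws \<and> 0 \<le> prod_list (map (anorm A) ws)"
    using assms(3)
  proof (induction ws)
    case (Cons x ws)
    have x: "x \<in> M" "x \<in> carrier A" using Cons.prems assms(1) by auto
    then have "0 \<le> K" using assms(2)[OF x(1)] anorm_nonneg[OF x(2)] by linarith
    then show ?case using Cons x assms(2)[OF x(1)] by (auto intro!: mult_mono)
  qed simp
  then show ?thesis using anorm_word_product[of ws] assms by force
qed

context
  fixes M :: "'a set" and K :: real
  assumes M: "M \<subseteq> carrier A" "M \<noteq> {}" and K: "\<And>x. x \<in> M \<Longrightarrow> anorm A x \<le> K"
begin

lemma bdd_above_set_power: "n \<ge> 1 \<Longrightarrow> bdd_above (anorm A ` set_power A M n)"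
  using set_power_eq[OF M(1), of "n - 1"] anorm_word_product_le_power[OF M(1) K]
  by (auto intro!: bdd_aboveI[of _ "K ^ n"]) (metis Suc_pred length_0_conv less_eq_Suc_le not_less0)?

lemma word_product_le_set_norm:
  assumes "ws \<noteq> []" "set ws \<subseteq> M"
  shows "anorm A (word_product A ws) \<le> set_norm A (set_power A M (length ws))"
proof -
  obtain n where n: "length ws = Suc n" using assms(1) by (cases ws) auto
  have "word_product A ws \<in> set_power A M (length ws)"
    unfolding n set_power_eq[OF M(1)] using assms n by blast
  then show ?thesis unfolding set_norm_def
    by (rule cSUP_upper) (rule bdd_above_set_power, simp add: n)
qed

lemma set_norm_le:
  assumes "n \<ge> 1" "\<And>ws. length ws = n \<Longrightarrow> set ws \<subseteq> M \<Longrightarrow> anorm A (word_product A ws) \<le> c"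
  shows "set_norm A (set_power A M n) \<le> c"
proof -
  obtain m where m: "n = Suc m" using assms(1) by (cases n) auto
  obtain x where "x \<in> M" using M(2) by blast
  then have "word_product A (replicate n x) \<in> set_power A M n"
    unfolding m set_power_eq[OF M(1)] by (intro CollectI exI conjI refl) auto
  then have "set_power A M n \<noteq> {}" by blast
  then show ?thesis unfolding set_norm_def
  proof (rule cSUP_least)
    fix y assume "y \<in> set_power A M n"
    then show "anorm A y \<le> c" using assms(2) unfolding m set_power_eq[OF M(1)] by auto
  qed
qed

lemma set_norm_nonneg: "n \<ge> 1 \<Longrightarrow> 0 \<le> set_norm A (set_power A M n)"
proof -
  assume n: "n \<ge> 1"
  obtain x where x: "x \<in> M" using M(2) by blast
  then have s: "set (replicate n x) \<subseteq> M" by auto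
  then have "0 \<le> anorm A (word_product A (replicate n x))"
    using M(1) by (intro anorm_nonneg word_product_closed) auto
  also have "\<dots> \<le> set_norm A (set_power A M n)"
    using word_product_le_set_norm[OF _ s] n by simp
  finally show ?thesis .
qed

lemma joint_spectral_radius_le_root:
  assumes "n \<ge> 1"
  shows "joint_spectral_radius A M \<le> root n (set_norm A (set_power A M n))"
  unfolding joint_spectral_radius_def
proof (rule cINF_lower)
  show "bdd_below ((\<lambda>n. root n (set_norm A (set_power A M n))) ` {1..})"
    using set_norm_nonneg by (intro bdd_belowI[of _ 0]) auto
qed (use assms in simp)

lemma joint_spectral_radius_nonneg: "0 \<le> joint_spectral_radius A M"
  unfolding joint_spectral_radius_def using set_norm_nonneg by (intro cINF_greatest) auto

lemma joint_spectral_radius_leI: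
  assumes n: "n \<ge> 1" and r: "r \<ge> 0"
    and "\<And>ws. length ws = n \<Longrightarrow> set ws \<subseteq> M \<Longrightarrow> anorm A (word_product A ws) \<le> r ^ n"
  shows "joint_spectral_radius A M \<le> r"
proof -
  have "root n (set_norm A (set_power A M n)) \<le> root n (r ^ n)"
    using n by (intro real_root_le_mono set_norm_le assms) auto
  also have "\<dots> = r" using n r by (simp add: real_root_power_cancel)
  finally show ?thesis using joint_spectral_radius_le_root[OF n] by linarith
qed

lemma joint_spectral_radius_lessD:
  assumes "joint_spectral_radius A M < r"
  obtains n where "n \<ge> 1" "\<And>ws. length ws = n \<Longrightarrow> set ws \<subseteq> M \<Longrightarrow> anorm A (word_product A ws) \<le> r ^ n"
proof -
  have "\<exists>n\<in>{1..}. root n (set_norm A (set_power A M n)) < r"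
  proof (rule ccontr)
    assume "\<not> ?thesis"
    then have "r \<le> joint_spectral_radius A M"
      unfolding joint_spectral_radius_def by (intro cINF_greatest) (auto simp: not_less)
    then show False using assms by simp
  qed
  then obtain n where n: "n \<ge> 1" "root n (set_norm A (set_power A M n)) < r" by auto
  have "set_norm A (set_power A M n) = root n (set_norm A (set_power A M n)) ^ n"
    using n(1) set_norm_nonneg[OF n(1)] by simp
  also have "\<dots> \<le> r ^ n"
    using n set_norm_nonneg[OF n(1)] by (intro power_mono) auto
  finally have le: "set_norm A (set_power A M n) \<le> r ^ n" .
  show thesis
  proof (rule that[OF n(1)])
    fix ws assume ws: "length ws = n" "set ws \<subseteq> M"
    then have "ws \<noteq> []" using n(1) by auto
    then show "anorm A (word_product A ws) \<le> r ^ n"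
      using word_product_le_set_norm[OF _ ws(2)] ws(1) le by force
  qed
qed

end

lemma precompact_bounded:
  assumes "M \<in> precompact_sets A"
  obtains K where "K > 0" "\<And>x. x \<in> M \<Longrightarrow> anorm A x \<le> K"
proof -
  interpret M: Metric_space "carrier A" "ndist A" by (rule Metric_space_ndist)
  have M: "M \<subseteq> carrier A" "M.mtotally_bounded M" using assms by (auto simp: precompact_sets_def)
  obtain F where F: "finite F" "F \<subseteq> M" "M \<subseteq> (\<Union>x\<in>F. M.mball x 1)"
    using M(2) unfolding M.mtotally_bounded_def by (meson zero_less_one)
  let ?K = "1 + (\<Sum>y\<in>F. anorm A y)"
  have nn: "y \<in> F \<Longrightarrow> 0 \<le> anorm A y" for y using F(2) M(1) by auto
  have "anorm A x \<le> ?K" if x: "x \<in> M" for x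
  proof -
    obtain y where y: "y \<in> F" "x \<in> carrier A" "y \<in> carrier A" "ndist A y x < 1"
      using F(3) x by auto
    have "anorm A x \<le> anorm A (y \<ominus> x) + anorm A y"
      using anorm_diff_ge[OF y(3,2)] by linarith
    moreover have "anorm A y \<le> (\<Sum>y\<in>F. anorm A y)" using F(1) y(1) nn by (intro member_le_sum) auto
    ultimately show ?thesis using y by (simp add: ndist_def)
  qed
  moreover have "?K > 0" using sum_nonneg[of F "anorm A"] nn by (simp add: add_pos_nonneg)
  ultimately show thesis using that by blast
qed

lemma precompact_smult:
  assumes "M \<in> precompact_sets A" "c \<noteq> 0"
  shows "(\<lambda>x. c \<odot> x) ` M \<in> precompact_sets A"
proof -
  interpret M: Metric_space "carrier A" "ndist A" by (rule Metric_space_ndist)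
  have M: "M \<subseteq> carrier A" "M.mtotally_bounded M" "M \<noteq> {}" using assms by (auto simp: precompact_sets_def)
  have "M.mtotally_bounded ((\<lambda>x. c \<odot> x) ` M)"
    unfolding M.mtotally_bounded_def
  proof (intro allI impI)
    fix e :: real assume "e > 0"
    then have "e / cmod c > 0" using assms(2) by simp
    then obtain F where F: "finite F" "F \<subseteq> M" "M \<subseteq> (\<Union>x\<in>F. M.mball x (e / cmod c))"
      using M(2) unfolding M.mtotally_bounded_def by meson
    have "c \<odot> x \<in> (\<Union>y\<in>(\<lambda>x. c \<odot> x) ` F. M.mball y e)" if x: "x \<in> M" for x
    proof -
      obtain y where y: "y \<in> F" "x \<in> carrier A" "y \<in> carrier A" "ndist A y x < e / cmod c"
        using F(3) x by auto
      have "anorm A (c \<odot> y \<ominus> c \<odot> x) = cmod c * anorm A (y \<ominus> x)"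
        using anorm_smult[of "y \<ominus> x" c] y by (simp add: smult_diff)
      also have "\<dots> < e" using y assms(2) by (simp add: ndist_def pos_less_divide_eq mult.commute)
      finally have "c \<odot> x \<in> M.mball (c \<odot> y) e" using y by (simp add: ndist_def)
      then show ?thesis using y(1) by blast
    qed
    then show "\<exists>K. finite K \<and> K \<subseteq> (\<lambda>x. c \<odot> x) ` M \<and> (\<lambda>x. c \<odot> x) ` M \<subseteq> (\<Union>x\<in>K. M.mball x e)"
      using F(1,2) by (intro exI[of _ "(\<lambda>x. c \<odot> x) ` F"]) blast
  qed
  then show ?thesis using M unfolding precompact_sets_def by auto
qed

lemma word_product_interleave:
  assumes "set xs \<subseteq> carrier A" "xs \<noteq> []" "a \<in> carrier A" "c \<noteq> 0"
  shows "word_product A (map (\<lambda>x. x \<otimes> a) xs) =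
    c ^ length xs \<odot> word_product A (concat (map (\<lambda>x. [inverse c \<odot> x, a]) xs))"
  using assms(1,2)
proof (induction xs)
  case (Cons x xs)
  have x: "x \<in> carrier A" using Cons.prems by simp
  show ?case
  proof (cases "xs = []")
    case True
    then show ?thesis using x assms(3,4) by (simp add: mult_smult_left smult_smult)
  next
    case False
    let ?ys = "concat (map (\<lambda>x. [inverse c \<odot> x, a]) xs)"
    have ys: "?ys \<noteq> []" "set ?ys \<subseteq> carrier A" using False Cons.prems assms(3) by auto
    note [simp] = word_product_closed[OF ys(2)]
    have "word_product A (map (\<lambda>x. x \<otimes> a) (x # xs)) = (x \<otimes> a) \<otimes> (c ^ length xs \<odot> word_product A ?ys)"
      using Cons False by (simp add: word_product_Cons)
    also have "\<dots> = c ^ length (x # xs) \<odot> ((inverse c \<odot> x) \<otimes> (a \<otimes> word_product A ?ys))"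
    proof -
      have e: "c * c ^ length xs * inverse c = c ^ length xs" using assms(4) by simp
      show ?thesis
        using x assms(3) by (simp add: mult_smult_left mult_smult_right smult_smult mult_assoc e)
    qed
    also have "(inverse c \<odot> x) \<otimes> (a \<otimes> word_product A ?ys) =
      word_product A (concat (map (\<lambda>x. [inverse c \<odot> x, a]) (x # xs)))"
      using ys by (simp add: word_product_Cons)
    finally show ?thesis .
  qed
qed simp

text \<open>
  Let \<open>S = {a} \<union> t\<^sup>-\<^sup>1 M\<close>. Then \<open>t\<^sup>-\<^sup>n (M a)\<^sup>n \<subseteq> S\<^sup>2\<^sup>n\<close>, whereas \<open>\<rho>(S) = \<rho>(t\<^sup>-\<^sup>1 M) \<le> \<parallel>M\<parallel> / t\<close>
  because \<open>a\<close> is in \<open>R_c A\<close>. So \<open>\<rho>(M a) \<le> t (\<parallel>M\<parallel> / t)\<^sup>2 = \<parallel>M\<parallel>\<^sup>2 / t\<close>, which is as small as desired.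
\<close>

lemma R_c_small_powers:
  assumes a: "a \<in> R_c A" and M: "M \<in> precompact_sets A" and e: "e > 0"
  obtains n where "n \<ge> 1"
    "\<And>ws. length ws = n \<Longrightarrow> set ws \<subseteq> (\<lambda>x. x \<otimes> a) ` M \<Longrightarrow> anorm A (word_product A ws) \<le> e ^ n"
proof -
  have ac: "a \<in> carrier A" using a by (simp add: R_c_def)
  have Mc: "M \<subseteq> carrier A" "M \<noteq> {}" using M by (auto simp: precompact_sets_def)
  obtain K where K: "K > 0" "\<And>x. x \<in> M \<Longrightarrow> anorm A x \<le> K" using M precompact_bounded by blast
  \<comment> \<open>Chosen so that \<open>t ((K + 1) / t)\<^sup>2 = e\<close>.\<close>
  define t where "t = (K + 1)\<^sup>2 / e"
  have t: "t > 0" using K e by (simp add: t_def)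
  define c where "c = complex_of_real t"
  have c: "c \<noteq> 0" "cmod c = t" using t by (auto simp: c_def)
  let ?M = "(\<lambda>x. inverse c \<odot> x) ` M"
  define r where "r = (K + 1) / t"
  have r: "r > 0" using K t by (simp add: r_def)
  have pre: "?M \<in> precompact_sets A" using M c by (intro precompact_smult) auto
  have M': "?M \<subseteq> carrier A" "?M \<noteq> {}" using Mc by auto
  have K': "anorm A y \<le> K / t" if "y \<in> ?M" for y
  proof -
    obtain x where x: "x \<in> M" "y = inverse c \<odot> x" using \<open>y \<in> ?M\<close> by auto
    then have "anorm A y = anorm A x / t"
      using Mc(1) c by (auto simp: anorm_smult norm_inverse divide_inverse mult.commute)
    then show ?thesis using K(2)[OF x(1)] t by (simp add: divide_right_mono)
  qed
  have "joint_spectral_radius A ?M \<le> K / t"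
  proof (rule joint_spectral_radius_leI[OF M' K', of 1])
    fix ws assume "length ws = 1" "set ws \<subseteq> ?M"
    then obtain y where "ws = [y]" "y \<in> ?M" by (auto simp: length_Suc_conv)
    then show "anorm A (word_product A ws) \<le> (K / t) ^ 1" using K' by simp
  qed (use K t in auto)
  also have "\<dots> < r" using t by (simp add: r_def divide_strict_right_mono)
  finally have "joint_spectral_radius A ({a} \<union> ?M) < r"
    using a pre by (simp add: R_c_def)
  moreover have S: "{a} \<union> ?M \<subseteq> carrier A" "{a} \<union> ?M \<noteq> {}" using M' ac by auto
  have KS: "anorm A x \<le> max (anorm A a) (K / t)" if "x \<in> {a} \<union> ?M" for x
    using that K' by (auto simp: le_max_iff_disj)
  ultimately obtain n where n: "n \<ge> 1"
    "\<And>ws. length ws = n \<Longrightarrow> set ws \<subseteq> {a} \<union> ?M \<Longrightarrow> anorm A (word_product A ws) \<le> r ^ n"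
    using joint_spectral_radius_lessD[OF S KS] by metis
  have double: "anorm A (word_product A ws) \<le> r ^ n * r ^ n"
    if ws: "length ws = n + n" "set ws \<subseteq> {a} \<union> ?M" for ws
  proof -
    let ?u = "take n ws" and ?v = "drop n ws"
    have u: "length ?u = n" "set ?u \<subseteq> {a} \<union> ?M" "length ?v = n" "set ?v \<subseteq> {a} \<union> ?M"
      using ws set_take_subset[of n ws] set_drop_subset[of n ws] by auto
    have ne: "?u \<noteq> []" "?v \<noteq> []" using u n(1) by force+
    have uc: "set ?u \<subseteq> carrier A" "set ?v \<subseteq> carrier A" using u(2,4) S(1) by (meson subset_trans)+
    have "anorm A (word_product A ws) = anorm A (word_product A ?u \<otimes> word_product A ?v)"
      using word_product_append[OF uc ne] by simp
    also have "\<dots> \<le> anorm A (word_product A ?u) * anorm A (word_product A ?v)"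
      using uc by (intro anorm_mult word_product_closed)
    also have "\<dots> \<le> r ^ n * r ^ n"
      using n(2)[OF u(1,2)] n(2)[OF u(3,4)] uc r by (intro mult_mono anorm_nonneg word_product_closed) auto
    finally show ?thesis .
  qed
  have "anorm A (word_product A ws) \<le> e ^ n"
    if ws: "length ws = n" "set ws \<subseteq> (\<lambda>x. x \<otimes> a) ` M" for ws
  proof -
    obtain xs where xs: "ws = map (\<lambda>x. x \<otimes> a) xs" "set xs \<subseteq> M"
    proof -
      have "ws \<in> lists ((\<lambda>x. x \<otimes> a) ` M)" using ws(2) by (simp add: lists_eq_set)
      then show thesis using that unfolding lists_image by (auto simp: lists_eq_set)
    qed
    let ?ys = "concat (map (\<lambda>x. [inverse c \<odot> x, a]) xs)"
    have len: "length ?ys = n + n"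
    proof -
      have "length ?ys = 2 * length xs" by (induction xs) auto
      then show ?thesis using ws xs by simp
    qed
    have ys: "set ?ys \<subseteq> {a} \<union> ?M" using xs(2) by auto
    have xc: "set xs \<subseteq> carrier A" "xs \<noteq> []" using xs Mc ws n by auto
    have "anorm A (word_product A ws) = t ^ n * anorm A (word_product A ?ys)"
    proof -
      have "word_product A ws = c ^ n \<odot> word_product A ?ys"
        using word_product_interleave[OF xc ac c(1)] ws xs by simp
      then show ?thesis
        using word_product_closed[OF subset_trans[OF ys S(1)]] c(2)
        by (simp add: anorm_smult norm_power)
    qed
    also have "\<dots> \<le> t ^ n * (r ^ n * r ^ n)" using double[OF len ys] t by (intro mult_left_mono) auto
    also have "\<dots> = (t * r * r) ^ n" by (simp add: power_mult_distrib mult_ac)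
    also have "t * r * r = e"
    proof -
      have "t * r * r = (K + 1)\<^sup>2 / t" using t by (simp add: r_def power2_eq_square)
      also have "\<dots> = e" using K e by (simp add: t_def)
      finally show ?thesis .
    qed
    finally show ?thesis .
  qed
  then show thesis using that n(1) by blast
qed

end

lemma (in seminormed_algebra) completion_power:
  assumes "s \<in> CS" 
  shows "word_product C (replicate (Suc n) (cl s)) = cl (\<lambda>k. word_product A (replicate (Suc n) (s k)))
    \<and> (\<lambda>k. word_product A (replicate (Suc n) (s k))) \<in> CS"
proof (induction n)
  case (Suc n)
  then have IH: "word_product C (replicate (Suc n) (cl s)) = cl (\<lambda>k. word_product A (replicate (Suc n) (s k)))"
    "(\<lambda>k. word_product A (replicate (Suc n) (s k))) \<in> CS" by auto
  have "word_product C (replicate (Suc (Suc n)) (cl s)) = cl s \<otimes>\<^bsub>C\<^esub> word_product C (replicate (Suc n) (cl s))"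
    by simp
  also have "\<dots> = cl (\<lambda>k. s k \<otimes> word_product A (replicate (Suc n) (s k)))"
    unfolding IH(1) by (rule completion_mult[OF assms IH(2)])
  finally show ?case using CS_mult[OF assms IH(2)] by simp
qed (use assms in simp)

lemma (in seminormed_algebra) completion_power_le:
  assumes s: "s \<in> CS" and n: "n \<ge> 1" and le: "\<And>k. anorm A (word_product A (replicate n (s k))) \<le> c"
  shows "anorm C (word_product C (replicate n (cl s))) \<le> c"
proof -
  obtain m where m: "n = Suc m" using n by (cases n) auto
  note p = completion_power[OF s, of m, folded m]
  show ?thesis
    unfolding conjunct1[OF p]
    by (rule LIMSEQ_le_const2[OF completion_anorm[OF conjunct2[OF p]]]) (intro exI allI impI le)
qed

lemma (in seminormed_algebra) cl_subseq:
  assumes s: "s \<in> CS" and f: "strict_mono f"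
  shows "cl (\<lambda>n. s (f n)) = cl s"
proof -
  have "(\<lambda>n. anorm A (s (f n) \<ominus> s n)) \<longlonglongrightarrow> 0"
  proof (rule LIMSEQ_I)
    fix e :: real assume "e > 0"
    then obtain N where N: "\<And>m n. m \<ge> N \<Longrightarrow> n \<ge> N \<Longrightarrow> anorm A (s m \<ominus> s n) < e"
      using CS_D[OF s] by meson
    have "norm (anorm A (s (f n) \<ominus> s n) - 0) < e" if "n \<ge> N" for n
      using N[of "f n" n] that seq_suble[OF f, of n] CS_in[OF s] by simp
    then show "\<exists>N. \<forall>n\<ge>N. norm (anorm A (s (f n) \<ominus> s n) - 0) < e" by blast
  qed
  then show ?thesis using cl_eq_iff[OF CS_subseq[OF s f] s] by simp
qed

lemma (in seminormed_algebra) CS_fast_subseq: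
  assumes s: "s \<in> CS"
  obtains f where "strict_mono f" "\<And>k. anorm A (s (f (Suc k)) \<ominus> s (f k)) < (1/4) ^ k"
proof -
  have "\<exists>N. \<forall>m\<ge>N. \<forall>n\<ge>N. anorm A (s m \<ominus> s n) < (1/4) ^ k" for k :: nat
    using CS_D[OF s, of "(1/4) ^ k"] by simp
  then obtain N where N: "\<And>k m n. m \<ge> N k \<Longrightarrow> n \<ge> N k \<Longrightarrow> anorm A (s m \<ominus> s n) < (1/4) ^ (k::nat)"
    by metis
  \<comment> \<open>Partial sums make the chosen indices strictly increasing.\<close>
  define f where "f k = (\<Sum>i\<le>k. Suc (N i))" for k
  have f: "f k \<ge> N k" for k
    by (cases k) (auto simp: f_def)
  have m: "strict_mono f" by (rule strict_mono_Suc_iff[THEN iffD2]) (simp add: f_def)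
  have "anorm A (s (f (Suc k)) \<ominus> s (f k)) < (1/4) ^ k" for k
  proof (rule N)
    show "f (Suc k) \<ge> N k" using f[of k] by (simp add: f_def)
  qed (rule f)
  then show thesis using that m by blast
qed

context tensor_pair
begin

text \<open>
  Scaling \<open>x \<otimes> y\<close> to \<open>(d / \<parallel>x\<parallel>) x \<otimes> (\<parallel>x\<parallel> / d) y\<close> moves all of the weight into the right factor.
\<close>

lemma balanced_representation:
  assumes definite: "\<And>x. x \<in> carrier A \<Longrightarrow> anorm A x = 0 \<Longrightarrow> x = \<zero>\<^bsub>A\<^esub>"
    and u: "u \<in> carrier AT" "anorm AT u < w" and d: "d > 0"
  shows "\<exists>l. rep l \<and> ts l = u \<and> (\<forall>p\<in>set l. anorm A (fst p) \<le> d) \<and>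
    (\<Sum>p\<leftarrow>l. anorm B (snd p)) \<le> w / d"
proof -
  obtain l where l: "rep l" "ts l = u" "tensor_weight A B l < w" using u by (rule anorm_AT_less)
  define h where "h p = (complex_of_real (d / anorm A (fst p)) \<odot>\<^bsub>A\<^esub> fst p,
    complex_of_real (anorm A (fst p) / d) \<odot>\<^bsub>B\<^esub> snd p)" for p :: "'a \<times> 'b"
  have fst_h: "fst (h p) = complex_of_real (d / anorm A (fst p)) \<odot>\<^bsub>A\<^esub> fst p"
    and snd_h: "snd (h p) = complex_of_real (anorm A (fst p) / d) \<odot>\<^bsub>B\<^esub> snd p" for p
    by (simp_all add: h_def)
  have rep: "rep (map h l)" using l(1) by (auto simp: h_def)
  have "ts (map h l) = ts l"
  proof (rule ts_eqI)
    fix \<phi> assume \<phi>: "\<phi> \<in> BF"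
    have "\<phi> (fst (h p)) (snd (h p)) = \<phi> (fst p) (snd p)" if p: "p \<in> set l" for p
    proof -
      note c = repD[OF l(1) p]
      have e: "\<phi> (fst (h p)) (snd (h p)) = complex_of_real (d / anorm A (fst p)) *
          (complex_of_real (anorm A (fst p) / d) * \<phi> (fst p) (snd p))"
        using c by (simp add: fst_h snd_h BF_smult1[OF \<phi>] BF_smult2[OF \<phi>])
      show ?thesis
      \<comment> \<open>Division by zero makes both rescaled factors vanish if \<open>fst p = 0\<close>, and then the
        tensor itself is \<open>0\<close>.\<close>
      proof (cases "anorm A (fst p) = 0")
        case True
        then have "fst p = \<zero>\<^bsub>A\<^esub>" using definite c by blast
        then have "\<phi> (fst p) (snd p) = 0"
          using BF_smult1[OF \<phi> A.zero_closed c(2), of 0] by simp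
        then show ?thesis using e by simp
      next
        case False
        then show ?thesis using e d by simp
      qed
    qed
    then show "ts (map h l) \<phi> = ts l \<phi>"
      unfolding ts_eval[OF \<phi>] map_map o_def by (intro arg_cong[where f=sum_list] map_cong refl)
  qed
  moreover have "\<forall>q\<in>set (map h l). anorm A (fst q) \<le> d"
  proof
    fix q assume "q \<in> set (map h l)"
    then obtain p where p: "q = h p" "p \<in> set l" unfolding set_map by (rule imageE)
    then show "anorm A (fst q) \<le> d" using repD[OF l(1) p(2)] d by (simp add: fst_h A.anorm_smult norm_divide)
  qed
  moreover have "(\<Sum>q\<leftarrow>map h l. anorm B (snd q)) \<le> w / d"
  proof -
    have "(\<Sum>q\<leftarrow>map h l. anorm B (snd q)) = (\<Sum>p\<leftarrow>l. anorm A (fst p) * anorm B (snd p) * (1 / d))"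
      unfolding map_map o_def
    proof (intro arg_cong[where f=sum_list] map_cong refl)
      fix p assume p: "p \<in> set l"
      show "anorm B (snd (h p)) = anorm A (fst p) * anorm B (snd p) * (1 / d)"
        using repD[OF l(1) p] d by (simp add: snd_h B.anorm_smult norm_divide)
    qed
    also have "\<dots> = tensor_weight A B l / d"
      by (simp add: tensor_weight_def case_prod_unfold sum_list_mult_const del: times_divide_eq_right) simp
    finally show ?thesis using l(3) d by (simp add: divide_right_mono)
  qed
  ultimately show ?thesis using rep l(2) by (intro exI[of _ "map h l"] conjI) auto
qed

lemma sum_list_concat_upt:
  fixes F :: "'c \<Rightarrow> real"
  shows "(\<Sum>p\<leftarrow>concat (map l [0..<Suc n]). F p) = (\<Sum>k\<le>n. \<Sum>p\<leftarrow>l k. F p)"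
  by (induction n) (simp_all add: atMost_Suc)

text \<open>
  Along a fast Cauchy sequence the increments have norm below \<open>4\<^sup>-\<^sup>k\<close>, so they can be balanced to
  left factors of norm at most \<open>2\<^sup>-\<^sup>k\<close> and right factors of total norm \<open>O(2\<^sup>-\<^sup>k)\<close>. Left factors that
  are finite in number in each block and tend to \<open>0\<close> form a precompact set. The infinite sum is
  given by the lists \<open>L n\<close> of its initial terms.
\<close>

lemma bounded_representation:
  assumes A: "normed_algebra A" and T: "T \<in> carrier AB"
  shows "\<exists>L M K. M \<in> precompact_sets A \<and> (\<forall>n. rep (L n)) \<and> (\<forall>n. fst ` set (L n) \<subseteq> M) \<and>
    (\<forall>n. (\<Sum>p\<leftarrow>L n. anorm B (snd p)) \<le> K) \<and> (\<lambda>n. ts (L n)) \<in> cauchy_seqs AT \<and>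
    T = cauchy_class AT (\<lambda>n. ts (L n))"
proof -
  interpret AN: normed_algebra A by fact
  interpret M: Metric_space "carrier A" "ndist A" by (rule AN.Metric_space_ndist)
  obtain s where s: "s \<in> AT.CS" "T = AT.cl s"
    using AT.completion_ex T unfolding projective_tensor_def by blast
  obtain f where f: "strict_mono f" "\<And>k. anorm AT (s (f (Suc k)) \<ominus>\<^bsub>AT\<^esub> s (f k)) < (1/4) ^ k"
    using AT.CS_fast_subseq[OF s(1)] by blast
  note sc = AT.CS_in[OF s(1)]
  define d where "d k = (case k of 0 \<Rightarrow> s (f 0) | Suc j \<Rightarrow> s (f (Suc j)) \<ominus>\<^bsub>AT\<^esub> s (f j))" for k
  define w where "w k = (case k of 0 \<Rightarrow> anorm AT (s (f 0)) + 1 | Suc j \<Rightarrow> (1/4) ^ j)" for k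
  have d: "d k \<in> carrier AT" "anorm AT (d k) < w k" for k
    using sc f(2) by (auto simp: d_def w_def split: nat.split)
  have "\<exists>l. rep l \<and> ts l = d k \<and> (\<forall>p\<in>set l. anorm A (fst p) \<le> (1/2) ^ k) \<and>
    (\<Sum>p\<leftarrow>l. anorm B (snd p)) \<le> w k / (1/2) ^ k" for k
    using AN.anorm_eq_zero by (intro balanced_representation[OF _ d]) auto
  then obtain l where l: "\<And>k. rep (l k)" "\<And>k. ts (l k) = d k"
    "\<And>k p. p \<in> set (l k) \<Longrightarrow> anorm A (fst p) \<le> (1/2) ^ k"
    "\<And>k. (\<Sum>p\<leftarrow>l k. anorm B (snd p)) \<le> w k / (1/2) ^ k"
    by metis
  define L where "L n = concat (map l [0..<Suc n])" for n
  have repL: "rep (L n)" for n using l(1) by (auto simp: L_def)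
  have tsL: "ts (L n) = s (f n)" for n
  proof (induction n)
    case 0
    show ?case using l(2)[of 0] by (simp add: L_def d_def)
  next
    case (Suc n)
    have "ts (L (Suc n)) = ts (L n) \<oplus>\<^bsub>AT\<^esub> ts (l (Suc n))"
      by (simp add: L_def ts_add)
    also have "\<dots> = s (f (Suc n))"
      unfolding Suc l(2) using sc by (simp add: d_def AT.a_comm[of "s (f n)"])
    finally show ?case .
  qed
  let ?M = "insert \<zero>\<^bsub>A\<^esub> (\<Union>k. fst ` set (l k))"
  have "x \<in> carrier A" if x: "x \<in> fst ` set (l k)" for x k
    using x repD(1)[OF l(1)] by blast
  then have Mc: "?M \<subseteq> carrier A" using A.zero_closed by blast
  have "M.mtotally_bounded ?M"
    unfolding M.mtotally_bounded_def
  proof (intro allI impI)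
    fix e :: real assume e: "e > 0"
    obtain N where N: "(1/2) ^ N < e" using real_arch_pow_inv[OF e, of "1/2"] by auto
    let ?F = "insert \<zero>\<^bsub>A\<^esub> (\<Union>k<N. fst ` set (l k))"
    have "x \<in> (\<Union>y\<in>?F. M.mball y e)" if x: "x \<in> ?M" for x
    proof (cases "x \<in> ?F")
      case True
      have "x \<in> carrier A" using x Mc by (rule subsetD[rotated])
      then have "x \<in> M.mball x e" using e by (simp add: ndist_def)
      then show ?thesis using True by blast
    next
      case False
      then obtain k where k: "x \<in> fst ` set (l k)" "\<not> k < N" using x by blast
      from k(1) obtain p where p: "x = fst p" "p \<in> set (l k)" by (rule imageE)
      have xc: "x \<in> carrier A" using x Mc by blast
      have "anorm A x \<le> (1/2) ^ k" using l(3) p by blast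
      also have "\<dots> \<le> (1/2) ^ N" using k(2) by (intro power_decreasing) auto
      finally have "anorm A (\<zero>\<^bsub>A\<^esub> \<ominus>\<^bsub>A\<^esub> x) < e"
        using N A.anorm_diff_commute[OF A.zero_closed xc] xc by simp
      then have "x \<in> M.mball \<zero>\<^bsub>A\<^esub> e" using xc by (simp add: ndist_def)
      then show ?thesis by blast
    qed
    then have "finite ?F \<and> ?F \<subseteq> ?M \<and> ?M \<subseteq> (\<Union>y\<in>?F. M.mball y e)" by blast
    then show "\<exists>K. finite K \<and> K \<subseteq> ?M \<and> ?M \<subseteq> (\<Union>y\<in>K. M.mball y e)" by (rule exI)
  qed
  then have pre: "?M \<in> precompact_sets A" using Mc unfolding precompact_sets_def by simp
  have sub: "fst ` set (L n) \<subseteq> ?M" for n by (auto simp: L_def)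
  have wle: "w k / (1/2) ^ k \<le> (w 0 + 4) * (1/2) ^ k" for k
  proof (cases k)
    case (Suc j)
    have "0 \<le> w 0" using sc by (simp add: w_def)
    have "(1/4::real) ^ j = (1/2) ^ j * (1/2) ^ j" by (simp flip: power_mult_distrib)
    then have "w k / (1/2) ^ k = 4 * (1/2) ^ k" using Suc by (simp add: w_def)
    also have "\<dots> \<le> (w 0 + 4) * (1/2) ^ k" using \<open>0 \<le> w 0\<close> by (intro mult_right_mono) auto
    finally show ?thesis .
  qed simp
  have sum: "(\<Sum>p\<leftarrow>L n. anorm B (snd p)) \<le> (w 0 + 4) * 2" for n
  proof -
    have "(\<Sum>p\<leftarrow>L n. anorm B (snd p)) \<le> (\<Sum>k\<le>n. (w 0 + 4) * (1/2) ^ k)"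
      unfolding L_def sum_list_concat_upt by (intro sum_mono order_trans[OF l(4) wle])
    also have "\<dots> = (w 0 + 4) * (\<Sum>k\<le>n. (1/2) ^ k)" by (simp add: sum_distrib_left)
    also have "\<dots> \<le> (w 0 + 4) * 2"
    proof (rule mult_left_mono)
      show "0 \<le> w 0 + 4" using sc by (simp add: w_def add_nonneg_nonneg)
      have "(\<Sum>k\<le>n. (1/2::real) ^ k) \<le> (\<Sum>k. (1/2) ^ k)"
        by (intro sum_le_suminf summable_geometric) auto
      then show "(\<Sum>k\<le>n. (1/2::real) ^ k) \<le> 2" using suminf_geometric[of "1/2::real"] by simp
    qed
    finally show ?thesis .
  qed
  have "(\<lambda>n. ts (L n)) \<in> AT.CS" unfolding tsL by (rule AT.CS_subseq[OF s(1) f(1)])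
  moreover have "T = AT.cl (\<lambda>n. ts (L n))" unfolding tsL s(2) by (rule AT.cl_subseq[OF s(1) f(1), symmetric])
  ultimately show ?thesis using pre repL sub sum by (intro exI conjI allI)
qed

end

text \<open>
  If \<open>a \<otimes> b\<close> missed a maximal modular left ideal \<open>L\<close>, some \<open>T (a \<otimes> b)\<close> would be a modular unit of
  \<open>L\<close>. Its powers are small, so \<open>L\<close> would be the whole algebra.
\<close>

theorem R_c_subset_tensor_radical:
  assumes A: "banach_algebra A"
  shows "R_c A \<subseteq> tensor_radical TYPE('u) A"
proof
  fix a assume a: "a \<in> R_c A"
  interpret A: banach_algebra A by fact
  have ac: "a \<in> carrier A" using a by (simp add: R_c_def)
  show "a \<in> tensor_radical TYPE('u) A"
    unfolding tensor_radical_def jacobson_radical_def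
  proof (intro CollectI conjI allI impI ac)
    fix B :: "'u nalg" and b assume B: "banach_algebra B" and b: "b \<in> carrier B"
    interpret B: banach_algebra B by fact
    interpret tensor_pair A B ..
    interpret P: banach_algebra AB by (rule banach_projective_tensor)
    have r: "rep [(a, b)]" using ac b by simp
    note cst = AT.CS_const[OF ts_in[OF r]]
    have e: "elementary_tensor A B a b = AT.cl (\<lambda>n. ts [(a, b)])"
      by (simp add: elementary_tensor_def simple_tensor_eq)
    show ein: "elementary_tensor A B a b \<in> carrier AB"
      unfolding e projective_tensor_def by (rule AT.cl_in_carrier[OF cst])
    fix L assume L: "maximal_modular_left_ideal AB L"
    show "elementary_tensor A B a b \<in> L"
    proof (rule ccontr)
      assume "elementary_tensor A B a b \<notin> L"
      then obtain T where T: "T \<in> carrier AB" and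
        mod: "\<forall>y\<in>carrier AB. y \<ominus>\<^bsub>AB\<^esub> y \<otimes>\<^bsub>AB\<^esub>
          (T \<otimes>\<^bsub>AB\<^esub> elementary_tensor A B a b) \<in> L"
        using P.maximal_modular_left_ideal_outside[OF L ein] by blast
      obtain S M K where S: "M \<in> precompact_sets A" "\<And>n. rep (S n)" "\<And>n. fst ` set (S n) \<subseteq> M"
        "\<And>n. (\<Sum>p\<leftarrow>S n. anorm B (snd p)) \<le> K" "(\<lambda>n. ts (S n)) \<in> AT.CS"
        "T = AT.cl (\<lambda>n. ts (S n))"
        using bounded_representation[OF A.normed_algebra_axioms T] by (elim exE conjE) auto
      define W where "W n = tensor_product_list A B (S n) [(a, b)]" for n
      have W: "rep (W n)" for n unfolding W_def by (rule rep_tensor_product_list[OF S(2) r])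
      have TW: "T \<otimes>\<^bsub>AB\<^esub> elementary_tensor A B a b = AT.cl (\<lambda>n. ts (W n))"
        and WCS: "(\<lambda>n. ts (W n)) \<in> AT.CS"
        using AT.CS_mult[OF S(5) cst] AT.completion_mult[OF S(5) cst]
        unfolding S(6) e projective_tensor_def W_def ts_mult[OF S(2) r] by auto
      define k where "k = \<bar>K\<bar> * anorm B b + 1"
      have k: "k > 0" using b by (simp add: k_def add_nonneg_pos)
      obtain n where n: "n \<ge> 1" "\<And>ws. length ws = n \<Longrightarrow> set ws \<subseteq> (\<lambda>x. x \<otimes>\<^bsub>A\<^esub> a) ` M \<Longrightarrow>
        anorm A (word_product A ws) \<le> (1 / (2 * k)) ^ n"
        using A.R_c_small_powers[OF a S(1), of "1 / (2 * k)"] k by auto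
      have "anorm AT (word_product AT (replicate n (ts (W j)))) \<le> (1/2) ^ n" for j
      proof -
        have "fst ` set (W j) \<subseteq> (\<lambda>x. x \<otimes>\<^bsub>A\<^esub> a) ` M"
          using S(3)[of j] by (auto simp: W_def tensor_product_list_def)
        then have "anorm AT (word_product AT (replicate n (ts (W j)))) \<le>
          (1 / (2 * k)) ^ n * (\<Sum>p\<leftarrow>W j. anorm B (snd p)) ^ n"
          using n(2) by (intro anorm_power_le_left[OF W n(1)]) blast
        also have "\<dots> \<le> (1 / (2 * k)) ^ n * k ^ n"
        proof (intro mult_left_mono power_mono)
          have "(\<Sum>p\<leftarrow>W j. anorm B (snd p)) = (\<Sum>p\<leftarrow>S j. anorm B (snd p \<otimes>\<^bsub>B\<^esub> b))"
            by (simp add: W_def sum_list_tensor_product_list)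
          also have "\<dots> \<le> (\<Sum>p\<leftarrow>S j. anorm B (snd p) * anorm B b)"
            using S(2)[of j] b by (intro sum_list_mono B.anorm_mult) auto
          also have "\<dots> \<le> \<bar>K\<bar> * anorm B b"
            using S(4)[of j] b by (simp add: sum_list_mult_const mult_right_mono)
          finally show "(\<Sum>p\<leftarrow>W j. anorm B (snd p)) \<le> k" by (simp add: k_def)
          show "0 \<le> (\<Sum>p\<leftarrow>W j. anorm B (snd p))"
            using W[of j] by (intro sum_list_nonneg) auto
          show "0 \<le> (1 / (2 * k)) ^ n" using k by simp
        qed
        also have "\<dots> = (1/2) ^ n" using k by (simp add: power_divide power_mult_distrib)
        finally show ?thesis .
      qed
      then have "anorm AB (word_product AB
        (replicate n (T \<otimes>\<^bsub>AB\<^esub> elementary_tensor A B a b))) \<le> (1/2) ^ n"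
        unfolding TW unfolding projective_tensor_def by (rule AT.completion_power_le[OF WCS n(1)])
      also have "(1/2::real) ^ n < 1" using n(1) by (simp add: power_less_one_iff)
      finally have "L = carrier AB"
        using L T ein mod n(1)
        by (intro P.left_ideal_eq_carrier[of L "T \<otimes>\<^bsub>AB\<^esub> elementary_tensor A B a b" n])
          (auto simp: maximal_modular_left_ideal_def modular_left_ideal_def)
      then show False using L by (simp add: maximal_modular_left_ideal_def)
    qed
  qed
qed

section \<open>Weighted free Banach algebras\<close>

text \<open>
  Convolution over the free monoid, that is, the sum of \<open>f u * g v\<close> over all factorisations
  \<open>w = u @ v\<close>. Recursion on the first letter reduces bilinearity and associativity to inductions.
\<close>

primrec conv :: "('i list \<Rightarrow> complex) \<Rightarrow> ('i list \<Rightarrow> complex) \<Rightarrow> 'i list \<Rightarrow> complex" where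
  "conv f g [] = f [] * g []"
| "conv f g (x # w) = f [] * g (x # w) + conv (\<lambda>v. f (x # v)) g w"

lemma conv_add_left: "conv (\<lambda>w. f w + f' w) g w = conv f g w + conv f' g w"
  by (induction w arbitrary: f f') (simp_all add: algebra_simps)

lemma conv_add_right: "conv f (\<lambda>w. g w + g' w) w = conv f g w + conv f g' w"
  by (induction w arbitrary: f) (simp_all add: algebra_simps)

lemma conv_smult_left: "conv (\<lambda>w. c * f w) g w = c * conv f g w"
  by (induction w arbitrary: f) (simp_all add: algebra_simps)

lemma conv_smult_right: "conv f (\<lambda>w. c * g w) w = c * conv f g w"
  by (induction w arbitrary: f) (simp_all add: algebra_simps)

lemma conv_zero_left: "conv (\<lambda>_. 0) g w = 0"
  by (induction w) simp_all

lemma conv_assoc: "conv (conv f g) h w = conv f (conv g h) w"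
  by (induction w arbitrary: f g)
    (simp_all add: algebra_simps conv_add_left conv_smult_left)

definition point_mass :: "'i list \<Rightarrow> 'i list \<Rightarrow> complex" where
  "point_mass u w = (if w = u then 1 else 0)"

lemma conv_point_mass: "conv (point_mass u) (point_mass v) w = point_mass (u @ v) w"
proof (induction u arbitrary: w)
  case Nil
  have "(\<lambda>u. point_mass [] (x # u)) = (\<lambda>_. 0)" for x :: 'a by (simp add: point_mass_def)
  then show ?case by (cases w) (simp_all add: conv_zero_left, simp_all add: point_mass_def)
next
  case (Cons x u)
  show ?case
  proof (cases w)
    case (Cons y w')
    have "(\<lambda>t. point_mass (x # u) (y # t)) = (if x = y then point_mass u else (\<lambda>_. 0))"
      by (auto simp: point_mass_def fun_eq_iff)
    then show ?thesis using Cons.IH unfolding Cons by (simp add: conv_zero_left, simp add: point_mass_def)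
  qed (simp add: point_mass_def)
qed

lemma conv_letter_Nil: "conv f (point_mass [i]) [] = 0"
  by (simp add: point_mass_def)

lemma conv_letter_snoc: "conv f (point_mass [i]) (v @ [j]) = (if i = j then f v else 0)"
  by (induction v arbitrary: f) (simp_all add: point_mass_def)

text \<open>
  The recursion for \<open>conv\<close> suits algebraic identities; norm estimates need the sum over
  factorisations.
\<close>

definition splits :: "'i list \<Rightarrow> ('i list \<times> 'i list) set" where
  "splits w = {(u, v). u @ v = w}"

lemma splits_Nil: "splits [] = {([], [])}"
  by (auto simp: splits_def)

lemma splits_Cons: "splits (x # w) = insert ([], x # w) ((\<lambda>(u, v). (x # u, v)) ` splits w)"
  by (auto simp: splits_def Cons_eq_append_conv append_eq_Cons_conv image_iff)

lemma finite_splits [simp]: "finite (splits w)"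
  by (induction w) (simp_all add: splits_Nil splits_Cons)

lemma cmod_conv_le: "cmod (conv f g w) \<le> (\<Sum>(u, v)\<in>splits w. cmod (f u) * cmod (g v))"
proof (induction w arbitrary: f)
  case (Cons x w)
  have inj: "inj_on (\<lambda>(u, v). (x # u, v)) (splits w)" by (auto simp: inj_on_def)
  have "cmod (conv f g (x # w)) \<le> cmod (f []) * cmod (g (x # w)) + cmod (conv (\<lambda>v. f (x # v)) g w)"
    using norm_triangle_ineq[of "f [] * g (x # w)"] by (simp add: norm_mult)
  also have "\<dots> \<le> cmod (f []) * cmod (g (x # w)) + (\<Sum>(u, v)\<in>splits w. cmod (f (x # u)) * cmod (g v))"
    using Cons by (intro add_left_mono)
  also have "\<dots> = (\<Sum>(u, v)\<in>splits (x # w). cmod (f u) * cmod (g v))"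
  proof -
    have "(\<Sum>p\<in>(\<lambda>(u, v). (x # u, v)) ` splits w. case p of (u, v) \<Rightarrow> cmod (f u) * cmod (g v)) =
      (\<Sum>(u, v)\<in>splits w. cmod (f (x # u)) * cmod (g v))"
      unfolding sum.reindex[OF inj] by (intro sum.cong refl) auto
    then show ?thesis unfolding splits_Cons by (subst sum.insert) auto
  qed
  finally show ?case .
qed (simp add: splits_Nil norm_mult)

locale word_weight =
  fixes \<omega> :: "'i list \<Rightarrow> real"
  assumes weight_pos: "\<omega> w > 0" and weight_append: "\<omega> (u @ v) \<le> \<omega> u * \<omega> v"
begin

definition l1 :: "('i list \<Rightarrow> complex) nalg" where
  "l1 = \<lparr>carrier = {f. (\<lambda>w. cmod (f w) * \<omega> w) summable_on UNIV},
     mult = conv, one = undefined, zero = (\<lambda>w. 0), add = (\<lambda>f g w. f w + g w),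
     smult = (\<lambda>c f w. c * f w), anorm = (\<lambda>f. \<Sum>\<^sub>\<infinity>w. cmod (f w) * \<omega> w)\<rparr>"

lemma weight_nonneg: "0 \<le> \<omega> w"
  using weight_pos[of w] by simp

lemma l1I:
  assumes "\<And>F. finite F \<Longrightarrow> (\<Sum>w\<in>F. cmod (f w) * \<omega> w) \<le> K"
  shows "f \<in> carrier l1" "anorm l1 f \<le> K"
proof -
  have s: "(\<lambda>w. cmod (f w) * \<omega> w) summable_on UNIV"
    by (rule nonneg_bdd_above_summable_on) (use assms weight_nonneg in \<open>auto intro!: bdd_aboveI[of _ K]\<close>)
  then show "f \<in> carrier l1" by (simp add: l1_def)
  show "anorm l1 f \<le> K" unfolding l1_def nalg.simps
    by (rule infsum_le_finite_sums[OF s]) (use assms in auto)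
qed

lemma l1D: "f \<in> carrier l1 \<Longrightarrow> finite F \<Longrightarrow> (\<Sum>w\<in>F. cmod (f w) * \<omega> w) \<le> anorm l1 f"
  unfolding l1_def by (auto intro!: finite_sum_le_infsum simp: weight_nonneg)

lemma l1_coeff: "f \<in> carrier l1 \<Longrightarrow> cmod (f w) * \<omega> w \<le> anorm l1 f"
  using l1D[of f "{w}"] by simp

lemma l1_add:
  assumes "f \<in> carrier l1" "g \<in> carrier l1"
  shows "(\<lambda>w. f w + g w) \<in> carrier l1" "anorm l1 (\<lambda>w. f w + g w) \<le> anorm l1 f + anorm l1 g"
proof -
  have "(\<Sum>w\<in>F. cmod (f w + g w) * \<omega> w) \<le> anorm l1 f + anorm l1 g" if "finite F" for F
  proof -
    have "(\<Sum>w\<in>F. cmod (f w + g w) * \<omega> w) \<le> (\<Sum>w\<in>F. cmod (f w) * \<omega> w + cmod (g w) * \<omega> w)"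
      by (intro sum_mono) (simp flip: distrib_right add: mult_right_mono norm_triangle_ineq weight_nonneg)
    also have "\<dots> \<le> anorm l1 f + anorm l1 g"
      using l1D[OF assms(1) that] l1D[OF assms(2) that] by (simp add: sum.distrib)
    finally show ?thesis .
  qed
  from l1I[OF this] show "(\<lambda>w. f w + g w) \<in> carrier l1" "anorm l1 (\<lambda>w. f w + g w) \<le> anorm l1 f + anorm l1 g"
    by blast+
qed

lemma l1_smult_le:
  assumes "f \<in> carrier l1"
  shows "(\<lambda>w. c * f w) \<in> carrier l1" "anorm l1 (\<lambda>w. c * f w) \<le> cmod c * anorm l1 f"
proof -
  have "(\<Sum>w\<in>F. cmod (c * f w) * \<omega> w) \<le> cmod c * anorm l1 f" if "finite F" for F
    using l1D[OF assms that] by (simp add: norm_mult mult.assoc mult_left_mono flip: sum_distrib_left)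
  from l1I[OF this] show "(\<lambda>w. c * f w) \<in> carrier l1" "anorm l1 (\<lambda>w. c * f w) \<le> cmod c * anorm l1 f"
    by blast+
qed

lemma l1_smult:
  assumes f: "f \<in> carrier l1"
  shows "anorm l1 (\<lambda>w. c * f w) = cmod c * anorm l1 f"
proof (cases "c = 0")
  case False
  have "(\<lambda>w. inverse c * (c * f w)) = f" using False by (simp add: mult.assoc[symmetric])
  then have "anorm l1 f \<le> cmod (inverse c) * anorm l1 (\<lambda>w. c * f w)"
    using l1_smult_le(2)[OF l1_smult_le(1)[OF f, of c], of "inverse c"] by simp
  then have "cmod c * anorm l1 f \<le> anorm l1 (\<lambda>w. c * f w)"
    using False by (simp add: norm_inverse norm_divide field_simps)
  then show ?thesis using l1_smult_le(2)[OF f, of c] by simp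
qed (simp add: l1_def)

lemma l1_nonneg: "f \<in> carrier l1 \<Longrightarrow> 0 \<le> anorm l1 f"
  using l1D[of f "{}"] by simp

lemma l1_conv:
  assumes f: "f \<in> carrier l1" and g: "g \<in> carrier l1"
  shows "conv f g \<in> carrier l1" "anorm l1 (conv f g) \<le> anorm l1 f * anorm l1 g"
proof -
  let ?a = "\<lambda>(u, v). (cmod (f u) * \<omega> u) * (cmod (g v) * \<omega> v)"
  have a: "?a p \<ge> 0" for p by (auto simp: weight_nonneg split: prod.split)
  have "(\<Sum>w\<in>F. cmod (conv f g w) * \<omega> w) \<le> anorm l1 f * anorm l1 g" if F: "finite F" for F
  proof -
    let ?P = "\<Union>w\<in>F. splits w"
    have P: "finite ?P" using F by simp
    have "cmod (conv f g w) * \<omega> w \<le> (\<Sum>p\<in>splits w. ?a p)" for w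
    proof -
      have "cmod (conv f g w) * \<omega> w \<le> (\<Sum>(u, v)\<in>splits w. cmod (f u) * cmod (g v)) * \<omega> w"
        by (intro mult_right_mono cmod_conv_le weight_nonneg)
      also have "\<dots> = (\<Sum>p\<in>splits w. cmod (f (fst p)) * cmod (g (snd p)) * \<omega> w)"
        by (simp add: sum_distrib_right case_prod_unfold)
      also have "\<dots> \<le> (\<Sum>p\<in>splits w. cmod (f (fst p)) * cmod (g (snd p)) * (\<omega> (fst p) * \<omega> (snd p)))"
      proof (intro sum_mono mult_left_mono)
        fix p assume "p \<in> splits w"
        then have "w = fst p @ snd p" by (auto simp: splits_def)
        then show "\<omega> w \<le> \<omega> (fst p) * \<omega> (snd p)" using weight_append by blast
      qed simp
      finally show ?thesis by (simp add: case_prod_unfold mult_ac)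
    qed
    then have "(\<Sum>w\<in>F. cmod (conv f g w) * \<omega> w) \<le> (\<Sum>w\<in>F. \<Sum>p\<in>splits w. ?a p)" by (intro sum_mono)
    also have "\<dots> = (\<Sum>p\<in>?P. ?a p)"
    proof (rule sum.UNION_disjoint[symmetric])
      show "\<forall>w\<in>F. \<forall>w'\<in>F. w \<noteq> w' \<longrightarrow> splits w \<inter> splits w' = {}" by (auto simp: splits_def)
    qed (use F in auto)
    also have "\<dots> \<le> (\<Sum>p\<in>fst ` ?P \<times> snd ` ?P. ?a p)"
    proof (rule sum_mono2)
      show "?P \<subseteq> fst ` ?P \<times> snd ` ?P" by force
    qed (use P a in auto)
    also have "\<dots> = (\<Sum>u\<in>fst ` ?P. cmod (f u) * \<omega> u) * (\<Sum>v\<in>snd ` ?P. cmod (g v) * \<omega> v)"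
      by (simp add: sum_product sum.cartesian_product)
    also have "\<dots> \<le> anorm l1 f * anorm l1 g"
      using P by (intro mult_mono l1D f g l1_nonneg sum_nonneg) (auto simp: weight_nonneg)
    finally show ?thesis .
  qed
  from l1I[OF this] show "conv f g \<in> carrier l1" "anorm l1 (conv f g) \<le> anorm l1 f * anorm l1 g" by blast+
qed

lemma l1_zero: "(\<lambda>w. 0) \<in> carrier l1"
  by (rule l1I[of _ 0]) simp

lemma l1_point_mass: "point_mass u \<in> carrier l1" "anorm l1 (point_mass u) \<le> \<omega> u"
proof -
  have "(\<Sum>w\<in>F. cmod (point_mass u w) * \<omega> w) \<le> \<omega> u" if "finite F" for F
  proof -
    have "(\<Sum>w\<in>F. cmod (point_mass u w) * \<omega> w) = (\<Sum>w\<in>F. if w = u then \<omega> w else 0)"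
      by (intro sum.cong) (auto simp: point_mass_def)
    also have "\<dots> \<le> \<omega> u" using that by (simp add: sum.delta' weight_nonneg) 
    finally show ?thesis .
  qed
  from l1I[OF this] show "point_mass u \<in> carrier l1" "anorm l1 (point_mass u) \<le> \<omega> u" by blast+
qed

lemma l1_seminormed: "seminormed_algebra l1"
proof (intro seminormed_algebra.intro seminormed_algebra_axioms.intro moduleI cring_complex_field abelian_groupI)
  fix f assume f: "f \<in> carrier l1"
  have "(\<lambda>w. (-1) * f w) \<oplus>\<^bsub>l1\<^esub> f = \<zero>\<^bsub>l1\<^esub>" by (simp add: l1_def)
  then show "\<exists>g\<in>carrier l1. g \<oplus>\<^bsub>l1\<^esub> f = \<zero>\<^bsub>l1\<^esub>" using l1_smult_le(1)[OF f, of "-1"] by blast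
  show "c \<odot>\<^bsub>l1\<^esub> f \<in> carrier l1" "anorm l1 (c \<odot>\<^bsub>l1\<^esub> f) = cmod c * anorm l1 f" for c
    using l1_smult_le(1)[OF f, of c] l1_smult[OF f, of c] by (simp_all add: l1_def)
  show "0 \<le> anorm l1 f" by (rule l1_nonneg[OF f])
  fix g assume g: "g \<in> carrier l1"
  show "f \<oplus>\<^bsub>l1\<^esub> g \<in> carrier l1" "anorm l1 (f \<oplus>\<^bsub>l1\<^esub> g) \<le> anorm l1 f + anorm l1 g"
    using l1_add[OF f g] by (simp_all add: l1_def)
  show "f \<otimes>\<^bsub>l1\<^esub> g \<in> carrier l1" "anorm l1 (f \<otimes>\<^bsub>l1\<^esub> g) \<le> anorm l1 f * anorm l1 g"
    using l1_conv[OF f g] by (simp_all add: l1_def)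
next
  show "\<zero>\<^bsub>l1\<^esub> \<in> carrier l1" using l1_zero by (simp add: l1_def)
qed (simp_all add: l1_def fun_eq_iff algebra_simps conv_add_left conv_add_right conv_smult_left
  conv_smult_right conv_assoc)

lemma l1_banach: "banach_algebra l1"
proof -
  interpret L: seminormed_algebra l1 by (rule l1_seminormed)
  have diff: "f \<ominus>\<^bsub>l1\<^esub> g = (\<lambda>w. f w - g w)" if "g \<in> carrier l1" for f g
  proof -
    have "\<ominus>\<^bsub>l1\<^esub> g = (\<lambda>w. - g w)" using L.smult_minus1[OF that] by (simp add: l1_def)
    then show ?thesis by (simp add: L.minus_eq) (simp add: l1_def)
  qed
  show ?thesis
  proof (rule L.banach_algebraI)
    fix f assume f: "f \<in> carrier l1" "anorm l1 f = 0"
    have "f w = 0" for w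
      using l1_coeff[OF f(1), of w] f(2) weight_pos[of w] by (simp add: mult_le_0_iff)
    then show "f = \<zero>\<^bsub>l1\<^esub>" by (simp add: l1_def fun_eq_iff)
  next
    fix s assume s: "s \<in> cauchy_seqs l1"
    note sc = L.CS_in[OF s]
    have "convergent (\<lambda>n. s n w)" for w
    proof -
      have "Cauchy (\<lambda>n. s n w)"
      proof (rule metric_CauchyI)
        fix e :: real assume "e > 0"
        then have "e * \<omega> w > 0" using weight_pos by simp
        then obtain N where N: "\<And>m n. m \<ge> N \<Longrightarrow> n \<ge> N \<Longrightarrow> anorm l1 (s m \<ominus>\<^bsub>l1\<^esub> s n) < e * \<omega> w"
          using L.CS_D[OF s] by meson
        have "dist (s m w) (s n w) < e" if mn: "m \<ge> N" "n \<ge> N" for m n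
        proof -
          have "s m \<ominus>\<^bsub>l1\<^esub> s n \<in> carrier l1" using sc by simp
          from l1_coeff[OF this, of w] have "cmod (s m w - s n w) * \<omega> w < e * \<omega> w"
            using N[OF mn] by (simp add: diff[OF sc])
          then show ?thesis using weight_pos[of w] by (simp add: dist_norm)
        qed
        then show "\<exists>M. \<forall>m\<ge>M. \<forall>n\<ge>M. dist (s m w) (s n w) < e" by (intro exI allI impI)
      qed
      then show ?thesis by (simp add: Cauchy_convergent_iff)
    qed
    then have "\<exists>l. (\<lambda>n. s n w) \<longlonglongrightarrow> l" for w by (simp add: convergent_def)
    then obtain g where g: "\<And>w. (\<lambda>n. s n w) \<longlonglongrightarrow> g w" by metis
    have lim: "\<exists>N. \<forall>n\<ge>N. (\<lambda>w. s n w - g w) \<in> carrier l1 \<and> anorm l1 (\<lambda>w. s n w - g w) \<le> e"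
      if e: "e > 0" for e
    proof -
      obtain N where N: "\<And>m n. m \<ge> N \<Longrightarrow> n \<ge> N \<Longrightarrow> anorm l1 (s m \<ominus>\<^bsub>l1\<^esub> s n) < e"
        using L.CS_D[OF s e] by meson
      have "(\<Sum>w\<in>F. cmod (s n w - g w) * \<omega> w) \<le> e" if n: "n \<ge> N" and F: "finite F" for n F
      proof (rule LIMSEQ_le_const2)
        show "(\<lambda>m. \<Sum>w\<in>F. cmod (s n w - s m w) * \<omega> w) \<longlonglongrightarrow> (\<Sum>w\<in>F. cmod (s n w - g w) * \<omega> w)"
          by (intro tendsto_intros g)
        have "(\<Sum>w\<in>F. cmod (s n w - s m w) * \<omega> w) \<le> e" if m: "m \<ge> N" for m
        proof -
          have "s n \<ominus>\<^bsub>l1\<^esub> s m \<in> carrier l1" using sc by simp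
          from l1D[OF this F] show ?thesis using N[OF n m] by (simp add: diff[OF sc])
        qed
        then show "\<exists>M. \<forall>m\<ge>M. (\<Sum>w\<in>F. cmod (s n w - s m w) * \<omega> w) \<le> e" by (intro exI allI impI)
      qed
      then have "(\<lambda>w. s n w - g w) \<in> carrier l1 \<and> anorm l1 (\<lambda>w. s n w - g w) \<le> e" if "n \<ge> N" for n
        using l1I[of "\<lambda>w. s n w - g w" e] that by simp
      then show ?thesis by (intro exI[of _ N] allI impI)
    qed
    obtain N where N: "(\<lambda>w. s N w - g w) \<in> carrier l1" using lim[of 1] by auto
    have "s N \<ominus>\<^bsub>l1\<^esub> (\<lambda>w. s N w - g w) \<in> carrier l1" using sc N by simp
    then have gc: "g \<in> carrier l1" by (simp add: diff[OF N])
    have "(\<lambda>n. anorm l1 (s n \<ominus>\<^bsub>l1\<^esub> g)) \<longlonglongrightarrow> 0"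
    proof (rule LIMSEQ_I)
      fix e :: real assume e: "e > 0"
      then obtain N where N: "\<And>n. n \<ge> N \<Longrightarrow> anorm l1 (\<lambda>w. s n w - g w) \<le> e / 2"
        using lim[of "e/2"] by auto
      have "norm (anorm l1 (s n \<ominus>\<^bsub>l1\<^esub> g) - 0) < e" if "n \<ge> N" for n
        using N[OF that] e L.anorm_nonneg[OF L.minus_closed[OF sc[of n] gc]] unfolding diff[OF gc] by simp
      then show "\<exists>no. \<forall>n\<ge>no. norm (anorm l1 (s n \<ominus>\<^bsub>l1\<^esub> g) - 0) < e" by (intro exI allI impI)
    qed
    then show "\<exists>x\<in>carrier l1. (\<lambda>n. anorm l1 (s n \<ominus>\<^bsub>l1\<^esub> x)) \<longlonglongrightarrow> 0" using gc by (rule bexI)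
  qed
qed

end

subsection \<open>Transport along an injection\<close>

definition transport :: "('a \<Rightarrow> 'b) \<Rightarrow> 'a nalg \<Rightarrow> 'b nalg" where
  "transport h A = (let k = inv_into (carrier A) h in
    \<lparr>carrier = h ` carrier A, mult = (\<lambda>u v. h (k u \<otimes>\<^bsub>A\<^esub> k v)), one = undefined, zero = h \<zero>\<^bsub>A\<^esub>,
     add = (\<lambda>u v. h (k u \<oplus>\<^bsub>A\<^esub> k v)), smult = (\<lambda>c u. h (c \<odot>\<^bsub>A\<^esub> k u)), anorm = (\<lambda>u. anorm A (k u))\<rparr>)"

lemma transport_simps:
  assumes "inj_on h (carrier A)"
  shows "carrier (transport h A) = h ` carrier A"
    "x \<in> carrier A \<Longrightarrow> y \<in> carrier A \<Longrightarrow> h x \<otimes>\<^bsub>transport h A\<^esub> h y = h (x \<otimes>\<^bsub>A\<^esub> y)"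
    "x \<in> carrier A \<Longrightarrow> y \<in> carrier A \<Longrightarrow> h x \<oplus>\<^bsub>transport h A\<^esub> h y = h (x \<oplus>\<^bsub>A\<^esub> y)"
    "x \<in> carrier A \<Longrightarrow> c \<odot>\<^bsub>transport h A\<^esub> h x = h (c \<odot>\<^bsub>A\<^esub> x)"
    "\<zero>\<^bsub>transport h A\<^esub> = h \<zero>\<^bsub>A\<^esub>"
    "x \<in> carrier A \<Longrightarrow> anorm (transport h A) (h x) = anorm A x"
  using assms by (simp_all add: transport_def Let_def)

lemma (in banach_algebra) cauchy_seq_limit:
  assumes s: "s \<in> cauchy_seqs A"
  shows "\<exists>x\<in>carrier A. (\<lambda>n. anorm A (s n \<ominus> x)) \<longlonglongrightarrow> 0"
proof -
  interpret M: Metric_space "carrier A" "ndist A" by (rule Metric_space_ndist)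
  note sc = CS_in[OF s]
  have "M.MCauchy s"
    unfolding M.MCauchy_def
  proof (intro conjI allI impI)
    show "range s \<subseteq> carrier A" using sc by (rule image_subsetI)
    fix e :: real assume "e > 0"
    then obtain N where N: "\<forall>m\<ge>N. \<forall>n\<ge>N. anorm A (s m \<ominus> s n) < e" using CS_D[OF s] by blast
    show "\<exists>N. \<forall>n n'. N \<le> n \<longrightarrow> N \<le> n' \<longrightarrow> ndist A (s n) (s n') < e"
      by (rule exI[of _ N]) (simp add: ndist_def sc N)
  qed
  then obtain x where x: "limitin M.mtopology s x sequentially"
    using complete unfolding M.mcomplete_def by metis
  then have x': "x \<in> carrier A \<and> (\<forall>e>0. \<exists>N. \<forall>n\<ge>N. s n \<in> carrier A \<and> ndist A (s n) x < e)"
    by (rule M.limit_metric_sequentially[THEN iffD1])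
  then have xc: "x \<in> carrier A" by (rule conjunct1)
  have lim: "\<exists>N. \<forall>n\<ge>N. ndist A (s n) x < e" if "e > 0" for e
    using conjunct2[OF x'] that by meson
  have "(\<lambda>n. anorm A (s n \<ominus> x)) \<longlonglongrightarrow> 0"
  proof (rule LIMSEQ_I)
    fix e :: real assume "e > 0"
    then show "\<exists>N. \<forall>n\<ge>N. norm (anorm A (s n \<ominus> x) - 0) < e"
      using lim[of e] sc xc by (simp add: ndist_def)
  qed
  then show ?thesis using xc by (rule bexI)
qed

lemma transport_banach:
  assumes A: "banach_algebra A" and h: "inj_on h (carrier A)"
  shows "banach_algebra (transport h A)"
proof -
  interpret A: banach_algebra A by fact
  note t = transport_simps[OF h]
  have "abelian_group (transport h A)"
  proof (rule abelian_groupI)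
    fix u assume "u \<in> carrier (transport h A)"
    then obtain x where x: "u = h x" "x \<in> carrier A" unfolding t by (rule imageE)
    have "h (\<ominus>\<^bsub>A\<^esub> x) \<oplus>\<^bsub>transport h A\<^esub> u = \<zero>\<^bsub>transport h A\<^esub>"
      using x by (simp add: t A.l_neg)
    moreover have "h (\<ominus>\<^bsub>A\<^esub> x) \<in> carrier (transport h A)" using x by (simp add: t)
    ultimately show "\<exists>v\<in>carrier (transport h A). v \<oplus>\<^bsub>transport h A\<^esub> u = \<zero>\<^bsub>transport h A\<^esub>" by (rule bexI)
  qed (auto simp: t A.a_ac)
  then have "module complex_field (transport h A)"
    by (intro moduleI cring_complex_field) (auto simp: t A.smult_add A.smult_smult A.smult_distrib)
  then interpret T: seminormed_algebra "transport h A"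
    by (intro seminormed_algebra.intro seminormed_algebra_axioms.intro)
      (auto simp: t A.mult_assoc A.mult_add_left A.mult_add_right A.mult_smult_left A.mult_smult_right
        A.anorm_add A.anorm_smult A.anorm_mult)
  have diff: "h x \<ominus>\<^bsub>transport h A\<^esub> h y = h (x \<ominus>\<^bsub>A\<^esub> y)" if "x \<in> carrier A" "y \<in> carrier A" for x y
  proof -
    have "\<ominus>\<^bsub>transport h A\<^esub> h y = (-1) \<odot>\<^bsub>transport h A\<^esub> h y"
      using T.smult_minus1[of "h y"] that by (simp add: t)
    also have "\<dots> = h (\<ominus>\<^bsub>A\<^esub> y)" using that by (simp add: t A.smult_minus1)
    finally show ?thesis using that by (simp add: T.minus_eq A.minus_eq t)
  qed
  show ?thesis
  proof (rule T.banach_algebraI)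
    fix u assume "u \<in> carrier (transport h A)" "anorm (transport h A) u = 0"
    then show "u = \<zero>\<^bsub>transport h A\<^esub>" using A.anorm_eq_zero by (auto simp: t)
  next
    fix s assume s: "s \<in> cauchy_seqs (transport h A)"
    have "\<exists>x. x \<in> carrier A \<and> s n = h x" for n using T.CS_in[OF s, of n] by (auto simp: t)
    then obtain r where r: "\<And>n. r n \<in> carrier A" "\<And>n. s n = h (r n)" by metis
    have "r \<in> cauchy_seqs A"
    proof (rule A.CS_I[OF r(1)])
      fix e :: real assume "e > 0"
      then show "\<exists>N. \<forall>m\<ge>N. \<forall>n\<ge>N. anorm A (r m \<ominus>\<^bsub>A\<^esub> r n) < e"
        using T.CS_D[OF s] r(1) by (simp add: r(2) diff t)
    qed
    then obtain x where x: "x \<in> carrier A" "(\<lambda>n. anorm A (r n \<ominus>\<^bsub>A\<^esub> x)) \<longlonglongrightarrow> 0"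
      using A.cauchy_seq_limit by blast
    have "(\<lambda>n. anorm (transport h A) (s n \<ominus>\<^bsub>transport h A\<^esub> h x)) \<longlonglongrightarrow> 0"
      using x r(1) by (simp add: r(2) diff t)
    moreover have "h x \<in> carrier (transport h A)" using x(1) by (simp add: t)
    ultimately show "\<exists>u\<in>carrier (transport h A). (\<lambda>n. anorm (transport h A) (s n \<ominus>\<^bsub>transport h A\<^esub> u)) \<longlonglongrightarrow> 0"
      by (rule bexI)
  qed
qed

text \<open>
  A real is encoded as a set of naturals, so a family of complex numbers indexed by a countable
  type becomes one set of naturals, and this in turn a real.
\<close>

lemma inj_complex_functions:
  assumes "inj (r :: real \<Rightarrow> 'u)"
  shows "\<exists>h :: ('i::countable \<Rightarrow> complex) \<Rightarrow> 'u. inj h"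
proof -
  obtain q where q: "bij_betw q (UNIV :: nat set set) (UNIV :: real set)"
    using nat_sets_eqpoll_reals unfolding eqpoll_def by blast
  define p where "p = inv_into UNIV q"
  have p: "p x = p y \<longleftrightarrow> x = y" for x y
    using q unfolding p_def by (metis bij_inv_eq_iff)
  define E where "E f = {to_nat (w, b, n) |w b n. n \<in> p (if b then Re (f w) else Im (f w))}"
    for f :: "'i \<Rightarrow> complex"
  have E: "to_nat (w, b, n) \<in> E f \<longleftrightarrow> n \<in> p (if b then Re (f w) else Im (f w))" for w b n f
    unfolding E_def by auto
  have "inj E"
  proof (rule injI, rule ext)
    fix f g :: "'i \<Rightarrow> complex" and w assume eq: "E f = E g"
    have "p (if b then Re (f w) else Im (f w)) = p (if b then Re (g w) else Im (g w))" for b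
      using E[of w b _ f] E[of w b _ g] eq by blast
    from this[of True] this[of False] show "f w = g w" by (simp add: p complex_eq_iff)
  qed
  moreover have "inj q" using q by (rule bij_is_inj)
  ultimately have "inj (\<lambda>f. r (q (E f)))" using assms by (auto simp: inj_def)
  then show ?thesis by blast
qed

text \<open>
  The copy of the weighted algebra is used only through these properties: free generators \<open>e\<close> of
  controlled norm and bounded coefficient functionals \<open>g\<close> that turn right multiplication by a
  generator into deletion of the last letter.
\<close>

lemma (in word_weight) transported_l1:
  fixes h :: "('i list \<Rightarrow> complex) \<Rightarrow> 'u"
  assumes h: "inj h"
  defines "B \<equiv> transport h l1" and "e \<equiv> \<lambda>i. h (point_mass [i])" and "g \<equiv> \<lambda>w y. inv_into UNIV h y w"
  shows "banach_algebra B" "e i \<in> carrier B" "g w \<in> linear_functionals B"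
    "y \<in> carrier B \<Longrightarrow> cmod (g w y) * \<omega> w \<le> anorm B y"
    "y \<in> carrier B \<Longrightarrow> g [] (y \<otimes>\<^bsub>B\<^esub> e i) = 0"
    "y \<in> carrier B \<Longrightarrow> g (v @ [j]) (y \<otimes>\<^bsub>B\<^esub> e i) = (if i = j then g v y else 0)"
    "g w (e i) = (if w = [i] then 1 else 0)"
    "ws \<noteq> [] \<Longrightarrow> anorm B (word_product B (map e ws)) \<le> \<omega> ws"
proof -
  have inj: "inj_on h (carrier l1)" using h by (rule inj_on_subset) simp
  note t = transport_simps[OF inj]
  have k: "inv_into UNIV h (h f) = f" for f using h by simp
  show "banach_algebra B" unfolding B_def by (rule transport_banach[OF l1_banach inj])
  show "e i \<in> carrier B" by (simp add: B_def e_def t l1_point_mass)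
  have conv: "h f \<otimes>\<^bsub>B\<^esub> h f' = h (conv f f')" if "f \<in> carrier l1" "f' \<in> carrier l1" for f f'
    using t(2)[OF that] by (simp add: B_def) (simp add: l1_def)
  show "g w \<in> linear_functionals B"
    unfolding linear_functionals_def B_def g_def
    by (auto simp: t k) (simp_all add: l1_def)
  show "cmod (g w y) * \<omega> w \<le> anorm B y" if "y \<in> carrier B"
    using that l1_coeff by (auto simp: B_def g_def t k)
  show "g [] (y \<otimes>\<^bsub>B\<^esub> e i) = 0" if y: "y \<in> carrier B"
  proof -
    obtain f where "y = h f" "f \<in> carrier l1" using y unfolding B_def t by (rule imageE)
    then show ?thesis by (simp add: conv[OF _ l1_point_mass(1)] e_def g_def k conv_letter_Nil del: conv.simps)
  qed
  show "g (v @ [j]) (y \<otimes>\<^bsub>B\<^esub> e i) = (if i = j then g v y else 0)" if y: "y \<in> carrier B"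
  proof -
    obtain f where "y = h f" "f \<in> carrier l1" using y unfolding B_def t by (rule imageE)
    then show ?thesis by (simp add: conv[OF _ l1_point_mass(1)] e_def g_def k conv_letter_snoc)
  qed
  show "g w (e i) = (if w = [i] then 1 else 0)" by (simp add: g_def e_def k point_mass_def)
  show "anorm B (word_product B (map e ws)) \<le> \<omega> ws" if "ws \<noteq> []"
  proof -
    have "word_product B (map e ws) = h (point_mass ws)"
      using that
    proof (induction ws)
      case (Cons i ws)
      show ?case
      proof (cases "ws = []")
        case False
        have "conv (point_mass [i]) (point_mass ws) = point_mass ([i] @ ws)"
          by (rule ext) (rule conv_point_mass)
        then show ?thesis using Cons False by (simp add: word_product_Cons e_def conv l1_point_mass(1))
      qed (simp add: e_def)
    qed simp
    then show ?thesis using l1_point_mass[of ws] by (simp add: B_def t)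
  qed
qed

section \<open>The tensor radical and finite sets\<close>

lemma (in seminormed_algebra) word_product_smult:
  assumes "\<And>i. i \<in> set ws \<Longrightarrow> x i \<in> carrier A" "ws \<noteq> []"
  shows "word_product A (map (\<lambda>i. c \<odot> x i) ws) = c ^ length ws \<odot> word_product A (map x ws)"
  using assms
proof (induction ws)
  case (Cons i ws)
  show ?case
  proof (cases "ws = []")
    case False
    have xi: "x i \<in> carrier A" using Cons.prems(1) by simp
    have w: "word_product A (map x ws) \<in> carrier A"
      using Cons.prems(1) by (intro word_product_closed) auto
    have "word_product A (map (\<lambda>i. c \<odot> x i) (i # ws)) = (c \<odot> x i) \<otimes> (c ^ length ws \<odot> word_product A (map x ws))"
      using Cons False by (simp add: word_product_Cons)
    also have "\<dots> = c ^ length (i # ws) \<odot> (x i \<otimes> word_product A (map x ws))"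
      using xi w by (simp add: mult_smult_left mult_smult_right smult_smult mult.commute)
    finally show ?thesis using False by (simp add: word_product_Cons)
  qed simp
qed simp

context tensor_pair
begin

context
  fixes x :: "nat \<Rightarrow> 'a" and e :: "nat \<Rightarrow> 'b" and g :: "nat list \<Rightarrow> 'b \<Rightarrow> complex"
    and \<omega> :: "nat list \<Rightarrow> real" and c :: complex
  assumes x: "\<And>i. x i \<in> carrier A" and e: "\<And>i. e i \<in> carrier B"
    and g: "\<And>w. g w \<in> linear_functionals B"
    and \<omega>: "\<And>w. \<omega> w > 0" and g_bound: "\<And>w y. y \<in> carrier B \<Longrightarrow> cmod (g w y) * \<omega> w \<le> anorm B y"
    and g_Nil: "\<And>y i. y \<in> carrier B \<Longrightarrow> g [] (y \<otimes>\<^bsub>B\<^esub> e i) = 0"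
    and g_snoc: "\<And>v j y i. y \<in> carrier B \<Longrightarrow> g (v @ [j]) (y \<otimes>\<^bsub>B\<^esub> e i) = (if i = j then g v y else 0)"
    and g_letter: "\<And>w i. g w (e i) = (if w = [i] then 1 else 0)"
begin

abbreviation "letters is \<equiv> map (\<lambda>i. (x i, c \<odot>\<^bsub>B\<^esub> e i)) is"

lemma rep_letters: "rep (letters is)"
  using x e by auto

lemma g_smult: "y \<in> carrier B \<Longrightarrow> g w (d \<odot>\<^bsub>B\<^esub> y) = d * g w y"
  using g[of w] unfolding linear_functionals_def by blast

lemma slice_letters:
  assumes "distinct is"
  shows "slice (g w) (ts (letters is)) =
    (if \<exists>j\<in>set is. w = [j] then c \<odot>\<^bsub>A\<^esub> x (hd w) else \<zero>\<^bsub>A\<^esub>)"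
  unfolding slice_ts[OF g rep_letters]
  using assms by (induction "is") (auto simp: g_smult[OF e] g_letter x)

lemma slice_mult_letters:
  assumes "distinct is" and u: "u \<in> carrier AT"
  shows "slice (g w) (u \<otimes>\<^bsub>AT\<^esub> ts (letters is)) =
    (if w \<noteq> [] \<and> last w \<in> set is then c \<odot>\<^bsub>A\<^esub> (slice (g (butlast w)) u \<otimes>\<^bsub>A\<^esub> x (last w)) else \<zero>\<^bsub>A\<^esub>)"
  using assms(1)
proof (induction "is")
  case Nil
  have "ts [] = \<zero>\<^bsub>AT\<^esub>" by (simp add: ts_zero)
  then have "u \<otimes>\<^bsub>AT\<^esub> ts [] = ts []" using u by simp
  then show ?case by (simp add: slice_ts[OF g])
next
  case (Cons i "is")
  let ?d = "if w \<noteq> [] \<and> last w = i then c else 0"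
  have ci: "c \<odot>\<^bsub>B\<^esub> e i \<in> carrier B" using e by simp
  have r: "rep [(x i, c \<odot>\<^bsub>B\<^esub> e i)]" using x e by simp
  have *: "g w (y \<otimes>\<^bsub>B\<^esub> (c \<odot>\<^bsub>B\<^esub> e i)) = ?d * g (butlast w) y" if y: "y \<in> carrier B" for y
  proof -
    have "g w (y \<otimes>\<^bsub>B\<^esub> (c \<odot>\<^bsub>B\<^esub> e i)) = c * g w (y \<otimes>\<^bsub>B\<^esub> e i)"
      using y e by (simp add: B.mult_smult_right g_smult)
    then show ?thesis
    proof (cases w rule: rev_cases)
      case (snoc v j)
      then show ?thesis using g_snoc[OF y, of v j i] y e by (simp add: B.mult_smult_right g_smult)
    qed (use g_Nil[OF y, of i] in simp)
  qed
  have "ts (letters (i # is)) = ts [(x i, c \<odot>\<^bsub>B\<^esub> e i)] \<oplus>\<^bsub>AT\<^esub> ts (letters is)"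
    by (simp add: ts_add)
  then have "u \<otimes>\<^bsub>AT\<^esub> ts (letters (i # is)) =
    u \<otimes>\<^bsub>AT\<^esub> ts [(x i, c \<odot>\<^bsub>B\<^esub> e i)] \<oplus>\<^bsub>AT\<^esub> u \<otimes>\<^bsub>AT\<^esub> ts (letters is)"
    using AT.mult_add_right[OF u ts_in[OF r] ts_in[OF rep_letters]] by simp
  then have "slice (g w) (u \<otimes>\<^bsub>AT\<^esub> ts (letters (i # is))) =
    ?d \<odot>\<^bsub>A\<^esub> (slice (g (butlast w)) u \<otimes>\<^bsub>A\<^esub> x i) \<oplus>\<^bsub>A\<^esub> slice (g w) (u \<otimes>\<^bsub>AT\<^esub> ts (letters is))"
    using slice_add[OF g AT.mult_closed[OF u ts_in[OF r]] AT.mult_closed[OF u ts_in[OF rep_letters]]]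
      slice_mult_simple[OF g g * u x ci] by simp
  then show ?case
    using Cons x slice_closed[OF g u] by auto
qed

text \<open>
  The equation \<open>Y = T + Y T\<close> determines the coefficients of \<open>Y\<close> recursively. Slices
  are defined before completion, so the recursion is carried out in the limit along a Cauchy
  sequence that represents \<open>Y\<close>.
\<close>

lemma coefficient_bound:
  assumes dist: "distinct is" and Y: "Y \<in> carrier AB"
    and eq: "cauchy_class AT (\<lambda>_. ts (letters is)) \<oplus>\<^bsub>AB\<^esub>
      Y \<otimes>\<^bsub>AB\<^esub> cauchy_class AT (\<lambda>_. ts (letters is)) = Y"
  shows "\<exists>C\<ge>0. \<forall>w. w \<noteq> [] \<longrightarrow> set w \<subseteq> set is \<longrightarrow>
    cmod c ^ length w * anorm A (word_product A (map x w)) * \<omega> w \<le> C"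
proof -
  obtain q where q: "q \<in> AT.CS" "Y = AT.cl q"
    using AT.completion_ex Y unfolding projective_tensor_def by blast
  note qc = AT.CS_in[OF q(1)]
  let ?t = "ts (letters is)"
  have t: "?t \<in> carrier AT" by (rule ts_in[OF rep_letters])
  note tCS = AT.CS_const[OF t]
  have "AT.cl (\<lambda>n. ?t \<oplus>\<^bsub>AT\<^esub> q n \<otimes>\<^bsub>AT\<^esub> ?t) = AT.cl q"
    using eq unfolding projective_tensor_def q(2) AT.completion_mult[OF q(1) tCS]
      AT.completion_add[OF tCS AT.CS_mult[OF q(1) tCS]] .
  then have null: "(\<lambda>n. anorm AT ((?t \<oplus>\<^bsub>AT\<^esub> q n \<otimes>\<^bsub>AT\<^esub> ?t) \<ominus>\<^bsub>AT\<^esub> q n)) \<longlonglongrightarrow> 0"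
    using AT.cl_eq_iff[OF AT.CS_add[OF tCS AT.CS_mult[OF q(1) tCS]] q(1)] by simp
  obtain C where C: "C > 0" "\<And>n. anorm AT (q n) \<le> C" using AT.CS_bounded[OF q(1)] by blast
  have bound: "anorm A (slice (g w) u) \<le> (1 / \<omega> w) * anorm AT u" if "u \<in> carrier AT" for w u
  proof (rule anorm_slice_le[OF g _ _ that])
    show "0 \<le> 1 / \<omega> w" using \<omega>[of w] by simp
    show "cmod (g w y) \<le> 1 / \<omega> w * anorm B y" if "y \<in> carrier B" for y
      using g_bound[OF that, of w] \<omega>[of w] by (simp add: field_simps)
  qed
  define z where "z w = (if w = [] then \<zero>\<^bsub>A\<^esub> else c ^ length w \<odot>\<^bsub>A\<^esub> word_product A (map x w))" for w
  have wp: "word_product A (map x w) \<in> carrier A" for w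
    by (rule A.word_product_closed) (use x in auto)
  have zc: "z w \<in> carrier A" for w using wp by (simp add: z_def)
  have D: "slice (g w) (q n) \<in> carrier A" for w n by (rule slice_closed[OF g qc])
  have lim: "(\<lambda>n. anorm A (z w \<ominus>\<^bsub>A\<^esub> slice (g w) (q n))) \<longlonglongrightarrow> 0" if "set w \<subseteq> set is" for w
    using that
  proof (induction w rule: rev_induct)
    \<comment> \<open>Comparing coefficients in \<open>Y = T + Y T\<close> expresses the coefficient at \<open>w\<close> by the one at the
      word without its last letter.\<close>
    have step: "(\<lambda>n. anorm A (z w \<ominus>\<^bsub>A\<^esub> slice (g w) (q n))) \<longlonglongrightarrow> 0"
      if r: "(\<lambda>n. anorm A (z w \<ominus>\<^bsub>A\<^esub> slice (g w) (?t \<oplus>\<^bsub>AT\<^esub> q n \<otimes>\<^bsub>AT\<^esub> ?t))) \<longlonglongrightarrow> 0" for w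
    proof (rule tendsto_sandwich[OF _ _ tendsto_const])
      let ?v = "\<lambda>n. ?t \<oplus>\<^bsub>AT\<^esub> q n \<otimes>\<^bsub>AT\<^esub> ?t"
      have v: "?v n \<in> carrier AT" for n using t qc by simp
      have "(\<lambda>n. anorm A (z w \<ominus>\<^bsub>A\<^esub> slice (g w) (?v n)) + (1 / \<omega> w) * anorm AT (?v n \<ominus>\<^bsub>AT\<^esub> q n))
        \<longlonglongrightarrow> 0 + (1 / \<omega> w) * 0"
        by (intro tendsto_intros r null)
      then show "(\<lambda>n. anorm A (z w \<ominus>\<^bsub>A\<^esub> slice (g w) (?v n)) + (1 / \<omega> w) * anorm AT (?v n \<ominus>\<^bsub>AT\<^esub> q n)) \<longlonglongrightarrow> 0"
        by simp
      have "anorm A (z w \<ominus>\<^bsub>A\<^esub> slice (g w) (q n)) \<le>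
        anorm A (z w \<ominus>\<^bsub>A\<^esub> slice (g w) (?v n)) + (1 / \<omega> w) * anorm AT (?v n \<ominus>\<^bsub>AT\<^esub> q n)" for n
      proof -
        have "anorm A (slice (g w) (?v n) \<ominus>\<^bsub>A\<^esub> slice (g w) (q n)) \<le> (1 / \<omega> w) * anorm AT (?v n \<ominus>\<^bsub>AT\<^esub> q n)"
          using bound[OF AT.minus_closed[OF v qc]] unfolding slice_diff[OF g v qc] .
        then show ?thesis
          using A.anorm_diff_triangle[OF zc slice_closed[OF g v] D, of w w n w n] by linarith
      qed
      then show "\<forall>\<^sub>F n in sequentially. anorm A (z w \<ominus>\<^bsub>A\<^esub> slice (g w) (q n)) \<le>
        anorm A (z w \<ominus>\<^bsub>A\<^esub> slice (g w) (?v n)) + (1 / \<omega> w) * anorm AT (?v n \<ominus>\<^bsub>AT\<^esub> q n)"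
        by (intro always_eventually allI)
      show "\<forall>\<^sub>F n in sequentially. 0 \<le> anorm A (z w \<ominus>\<^bsub>A\<^esub> slice (g w) (q n))"
        by (intro always_eventually allI A.anorm_nonneg A.minus_closed zc D)
    qed
    have sv: "slice (g w) (?t \<oplus>\<^bsub>AT\<^esub> q n \<otimes>\<^bsub>AT\<^esub> ?t) =
      (if \<exists>j\<in>set is. w = [j] then c \<odot>\<^bsub>A\<^esub> x (hd w) else \<zero>\<^bsub>A\<^esub>) \<oplus>\<^bsub>A\<^esub>
      (if w \<noteq> [] \<and> last w \<in> set is then c \<odot>\<^bsub>A\<^esub> (slice (g (butlast w)) (q n) \<otimes>\<^bsub>A\<^esub> x (last w)) else \<zero>\<^bsub>A\<^esub>)" for w n
      using slice_add[OF g t AT.mult_closed[OF qc t]] slice_letters[OF dist] slice_mult_letters[OF dist qc] by simp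
    {
      case Nil
      show ?case by (rule step) (simp add: sv z_def)
    next
      case (snoc j v)
      then have j: "j \<in> set is" and v: "set v \<subseteq> set is" by auto
      let ?f = "if v = [] then c \<odot>\<^bsub>A\<^esub> x j else \<zero>\<^bsub>A\<^esub>"
      have f: "?f \<in> carrier A" using x by simp
      have z': "z (v @ [j]) = ?f \<oplus>\<^bsub>A\<^esub> c \<odot>\<^bsub>A\<^esub> (z v \<otimes>\<^bsub>A\<^esub> x j)"
      proof (cases "v = []")
        case False
        have "word_product A (map x v @ [x j]) = word_product A (map x v) \<otimes>\<^bsub>A\<^esub> x j"
          using A.word_product_append[of "map x v" "[x j]"] x False by auto
        then show ?thesis using False wp x by (simp add: z_def A.mult_smult_left A.smult_smult)
      qed (use x in \<open>simp add: z_def\<close>)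
      have "z (v @ [j]) \<ominus>\<^bsub>A\<^esub> slice (g (v @ [j])) (?t \<oplus>\<^bsub>AT\<^esub> q n \<otimes>\<^bsub>AT\<^esub> ?t) =
        c \<odot>\<^bsub>A\<^esub> ((z v \<ominus>\<^bsub>A\<^esub> slice (g v) (q n)) \<otimes>\<^bsub>A\<^esub> x j)" for n
      proof -
        have s: "slice (g (v @ [j])) (?t \<oplus>\<^bsub>AT\<^esub> q n \<otimes>\<^bsub>AT\<^esub> ?t) =
          ?f \<oplus>\<^bsub>A\<^esub> c \<odot>\<^bsub>A\<^esub> (slice (g v) (q n) \<otimes>\<^bsub>A\<^esub> x j)"
          unfolding sv using j by auto
        show ?thesis unfolding z' s using f zc D x
          by (simp add: A.add_diff_add A.mult_diff_left A.smult_diff)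
      qed
      moreover have "(\<lambda>n. anorm A (c \<odot>\<^bsub>A\<^esub> ((z v \<ominus>\<^bsub>A\<^esub> slice (g v) (q n)) \<otimes>\<^bsub>A\<^esub> x j))) \<longlonglongrightarrow> 0"
      proof (rule tendsto_sandwich[OF _ _ tendsto_const])
        have "(\<lambda>n. cmod c * (anorm A (z v \<ominus>\<^bsub>A\<^esub> slice (g v) (q n)) * anorm A (x j))) \<longlonglongrightarrow> cmod c * (0 * anorm A (x j))"
          by (intro tendsto_intros snoc.IH v)
        then show "(\<lambda>n. cmod c * (anorm A (z v \<ominus>\<^bsub>A\<^esub> slice (g v) (q n)) * anorm A (x j))) \<longlonglongrightarrow> 0" by simp
        have m: "(z v \<ominus>\<^bsub>A\<^esub> slice (g v) (q n)) \<otimes>\<^bsub>A\<^esub> x j \<in> carrier A" for n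
          by (intro A.mult_closed A.minus_closed zc D x)
        show "\<forall>\<^sub>F n in sequentially. anorm A (c \<odot>\<^bsub>A\<^esub> ((z v \<ominus>\<^bsub>A\<^esub> slice (g v) (q n)) \<otimes>\<^bsub>A\<^esub> x j)) \<le>
          cmod c * (anorm A (z v \<ominus>\<^bsub>A\<^esub> slice (g v) (q n)) * anorm A (x j))"
          unfolding A.anorm_smult[OF m]
          by (intro always_eventually allI mult_left_mono A.anorm_mult A.minus_closed zc D x norm_ge_zero)
        show "\<forall>\<^sub>F n in sequentially. 0 \<le> anorm A (c \<odot>\<^bsub>A\<^esub> ((z v \<ominus>\<^bsub>A\<^esub> slice (g v) (q n)) \<otimes>\<^bsub>A\<^esub> x j))"
          by (intro always_eventually allI A.anorm_nonneg A.smult_in m)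
      qed
      ultimately show ?case by (intro step) simp
    }
  qed
  have "cmod c ^ length w * anorm A (word_product A (map x w)) * \<omega> w \<le> C"
    if w: "w \<noteq> []" "set w \<subseteq> set is" for w
  proof -
    have "anorm A (z w) \<le> 0 + C / \<omega> w"
    proof (rule LIMSEQ_le_const)
      show "(\<lambda>n. anorm A (z w \<ominus>\<^bsub>A\<^esub> slice (g w) (q n)) + C / \<omega> w) \<longlonglongrightarrow> 0 + C / \<omega> w"
        by (intro tendsto_intros lim w)
      have "anorm A (z w) \<le> anorm A (z w \<ominus>\<^bsub>A\<^esub> slice (g w) (q n)) + C / \<omega> w" for n
      proof -
        have "anorm A (slice (g w) (q n)) \<le> (1 / \<omega> w) * C"
          using bound[OF qc, of w n] C(2)[of n] \<omega>[of w]
          by (intro order_trans[OF bound[OF qc]] mult_left_mono) auto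
        then show ?thesis using A.anorm_diff_ge[OF zc D, of w w n] by simp
      qed
      then show "\<exists>N. \<forall>n\<ge>N. anorm A (z w) \<le> anorm A (z w \<ominus>\<^bsub>A\<^esub> slice (g w) (q n)) + C / \<omega> w"
        by (intro exI allI impI)
    qed
    then have "anorm A (z w) * \<omega> w \<le> C" using \<omega>[of w] by (simp add: pos_le_divide_eq)
    then show ?thesis using w(1) wp[of w] by (simp add: z_def A.anorm_smult norm_power)
  qed
  then show ?thesis using C(1) by (intro exI[of _ C]) auto
qed

end

end

lemma (in seminormed_algebra) diff_sum_add:
  assumes "x \<in> carrier A" "y \<in> carrier A" "z \<in> carrier A"
  shows "(x \<ominus> (y \<oplus> z)) \<oplus> y = x \<ominus> z"
proof -
  have "\<ominus> (y \<oplus> z) = \<ominus> z \<oplus> \<ominus> y" using assms by (simp add: minus_add a_comm)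
  then show ?thesis using assms by (simp add: minus_eq a_assoc l_neg)
qed

context normed_algebra
begin

lemma joint_spectral_radius_mono:
  assumes M: "M \<noteq> {}" "M \<subseteq> N" and N: "N \<subseteq> carrier A" and K: "\<And>x. x \<in> N \<Longrightarrow> anorm A x \<le> K"
  shows "joint_spectral_radius A M \<le> joint_spectral_radius A N"
proof (rule dense_ge)
  fix r assume r: "joint_spectral_radius A N < r"
  have N0: "N \<noteq> {}" using M by blast
  have Mc: "M \<subseteq> carrier A" using M N by blast
  have KM: "\<And>x. x \<in> M \<Longrightarrow> anorm A x \<le> K" using K M(2) by blast
  obtain n where n: "n \<ge> 1" "\<And>ws. length ws = n \<Longrightarrow> set ws \<subseteq> N \<Longrightarrow> anorm A (word_product A ws) \<le> r ^ n"
    using joint_spectral_radius_lessD[OF N N0 K r] by blast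
  have "r \<ge> 0" using joint_spectral_radius_nonneg[OF N N0 K] r by simp
  then show "joint_spectral_radius A M \<le> r"
    using n(2) M(2) by (intro joint_spectral_radius_leI[OF Mc M(1) KM n(1)]) auto
qed

lemma joint_spectral_radius_power_le:
  assumes M: "M \<subseteq> carrier A" "M \<noteq> {}" and K: "\<And>x. x \<in> M \<Longrightarrow> anorm A x \<le> K" and n: "n \<ge> 1"
    and le: "\<And>ws. length ws = n \<Longrightarrow> set ws \<subseteq> M \<Longrightarrow> anorm A (word_product A ws) \<le> c"
  shows "joint_spectral_radius A M ^ n \<le> c"
proof -
  have "joint_spectral_radius A M ^ n \<le> root n (set_norm A (set_power A M n)) ^ n"
    by (intro power_mono joint_spectral_radius_le_root[OF M K n] joint_spectral_radius_nonneg[OF M K])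
  also have "\<dots> = set_norm A (set_power A M n)"
    using n set_norm_nonneg[OF M K n] by simp
  also have "\<dots> \<le> c" by (rule set_norm_le[OF M K n le])
  finally show ?thesis .
qed

end

lemma le_one_if_powers_bounded:
  fixes y :: real
  assumes "\<And>n. n \<ge> 1 \<Longrightarrow> y ^ n \<le> C" shows "y \<le> 1"
proof (rule ccontr)
  assume "\<not> y \<le> 1"
  then obtain n where n: "C < y ^ n" using real_arch_pow[of y C] by auto
  have "y ^ n \<le> y ^ Suc n" using \<open>\<not> y \<le> 1\<close> by (intro power_increasing) auto
  then show False using n assms[of "Suc n"] by simp
qed

text \<open>
  Replacing \<open>\<parallel>x\<^sub>w\<parallel>\<close> by \<open>max (\<parallel>x\<^sub>w\<parallel>, s^|w|)\<close> keeps the weight positive even when products vanish; it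
  stays submultiplicative, and on words of length \<open>m\<close> in the letters \<open>1, \<dots>, k\<close> it is \<open>s^(p m)\<close>.
  Left quasi-regularity of \<open>T\<close> appears as the left ideal of all \<open>y - y T\<close> being everything. A maximal
  modular left ideal above it would contain the radical part \<open>Z\<close> of \<open>T\<close>, and so have \<open>T1\<close>
  as a modular unit as well, against the smallness of the powers of \<open>T1\<close>.
\<close>

lemma (in banach_algebra) tensor_radical_power_bound:
  fixes x :: "nat \<Rightarrow> 'a" and r :: "real \<Rightarrow> 'u"
  assumes x: "\<And>i. x i \<in> carrier A" and rad: "x 0 \<in> tensor_radical TYPE('u) A" and r: "inj r"
    and s: "s > 0" and m: "m \<ge> 1" and small: "\<And>ws. length ws = m \<Longrightarrow> set ws \<subseteq> x ` {1..k} \<Longrightarrow>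
      anorm A (word_product A ws) \<le> s ^ m"
    and lam: "real k * s ^ Suc p < lam"
  shows "\<exists>C. \<forall>w. w \<noteq> [] \<longrightarrow> set w \<subseteq> {..k} \<longrightarrow>
    anorm A (word_product A (map x w)) ^ Suc p \<le> C * lam ^ length w"
proof -
  have lam0: "lam > 0" using s lam by (simp add: order_le_less_trans[of 0 "real k * s ^ Suc p"])
  define nrm where "nrm w = anorm A (word_product A (map x w))" for w
  have wp: "word_product A (map x w) \<in> carrier A" for w
    by (rule word_product_closed) (use x in auto)
  have nrm0: "nrm w \<ge> 0" for w using wp by (simp add: nrm_def)
  define \<omega> where "\<omega> w = (if w = [] then 1 else max (nrm w) (s ^ length w) ^ p)" for w
  interpret word_weight \<omega>
  proof
    show "\<omega> w > 0" for w using s by (simp add: \<omega>_def less_max_iff_disj)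
    show "\<omega> (u @ v) \<le> \<omega> u * \<omega> v" for u v
    proof (cases "u = [] \<or> v = []")
      case False
      have "nrm (u @ v) \<le> nrm u * nrm v"
        using word_product_append[of "map x u" "map x v"] anorm_mult[OF wp wp, of u v] x False
        by (simp add: nrm_def image_subset_iff)
      also have "\<dots> \<le> max (nrm u) (s ^ length u) * max (nrm v) (s ^ length v)"
        by (intro mult_mono) (auto simp: nrm0 le_max_iff_disj)
      finally have 1: "nrm (u @ v) \<le> max (nrm u) (s ^ length u) * max (nrm v) (s ^ length v)" .
      have 2: "s ^ length (u @ v) \<le> max (nrm u) (s ^ length u) * max (nrm v) (s ^ length v)"
        unfolding length_append power_add using s by (intro mult_mono) (auto simp: le_max_iff_disj nrm0)
      have "max (nrm (u @ v)) (s ^ length (u @ v)) ^ p \<le>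
        (max (nrm u) (s ^ length u) * max (nrm v) (s ^ length v)) ^ p"
        using 1 2 nrm0 by (intro power_mono) (auto simp: le_max_iff_disj)
      then show ?thesis using False by (simp add: \<omega>_def power_mult_distrib)
    qed (auto simp: \<omega>_def)
  qed
  obtain h :: "(nat list \<Rightarrow> complex) \<Rightarrow> 'u" where h: "inj h"
    using inj_complex_functions[OF r] by blast
  define B where "B = transport h l1"
  define e where "e i = h (point_mass [i])" for i
  define g where "g w y = inv_into UNIV h y w" for w y
  note B = transported_l1[OF h, folded B_def e_def g_def]
  interpret B: banach_algebra B by (rule B(1))
  interpret tensor_pair A B ..
  interpret P: banach_algebra AB by (rule banach_projective_tensor)
  define c where "c = complex_of_real (1 / lam)"
  have c: "cmod c = 1 / lam" using lam0 by (simp add: c_def norm_divide)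
  let ?b = "\<lambda>i. c \<odot>\<^bsub>B\<^esub> e i"
  let ?l = "\<lambda>is. map (\<lambda>i. (x i, ?b i)) is"
  have b: "?b i \<in> carrier B" for i using B(2)[of i] by simp
  have rep: "rep (?l is)" for "is" using x b by auto
  define T where "T = AT.cl (\<lambda>_. ts (?l [0..<Suc k]))"
  define T1 where "T1 = AT.cl (\<lambda>_. ts (?l [1..<Suc k]))"
  define Z where "Z = elementary_tensor A B (x 0) (?b 0)"
  note CS = AT.CS_const[OF ts_in[OF rep]]
  have Z_eq: "Z = AT.cl (\<lambda>_. ts (?l [0]))"
    by (simp add: Z_def elementary_tensor_def simple_tensor_eq)
  have PT: "T \<in> carrier AB" "T1 \<in> carrier AB"
    "Z \<in> carrier AB"
    unfolding T_def T1_def Z_eq projective_tensor_def by (intro AT.cl_in_carrier CS)+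
  have "T = Z \<oplus>\<^bsub>AB\<^esub> T1"
    unfolding T_def T1_def Z_eq projective_tensor_def AT.completion_add[OF CS CS] ts_add
    by (simp add: upt_conv_Cons del: upt_Suc)
  have Zrad: "Z \<in> jacobson_radical AB"
    using rad B(1) b[of 0] unfolding Z_def tensor_radical_def by blast
  \<comment> \<open>Letters of the given finite set alone have small powers.\<close>
  have T1_small: "anorm AB (word_product AB (replicate m T1)) < 1"
  proof -
    let ?c = "s ^ m * ((1 / lam) ^ m * (s ^ m) ^ p)"
    have "anorm A (word_product A (map fst ws)) * anorm B (word_product B (map snd ws)) \<le> ?c"
      if ws: "length ws = m" "set ws \<subseteq> set (?l [1..<Suc k])" for ws
    proof -
      have "ws \<in> lists ((\<lambda>i. (x i, ?b i)) ` {1..k})"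
        using ws(2) by (auto simp: lists_eq_set atLeastLessThanSuc_atLeastAtMost simp del: upt_Suc)
      then obtain v where v: "ws = ?l v" "set v \<subseteq> {1..k}"
        unfolding lists_image by (auto simp: lists_eq_set)
      have len: "length v = m" "v \<noteq> []" using ws(1) v(1) m by auto
      have n1: "nrm v \<le> s ^ m"
        unfolding nrm_def using v(2) len(1) by (intro small) auto
      have "anorm B (word_product B (map snd ws)) = anorm B (c ^ m \<odot>\<^bsub>B\<^esub> word_product B (map e v))"
        using B.word_product_smult[OF B(2) len(2), of c] len(1) by (simp add: v(1) o_def)
      also have "\<dots> = (1 / lam) ^ m * anorm B (word_product B (map e v))"
        using B.word_product_closed[of "map e v"] B(2) by (simp add: B.anorm_smult norm_power c image_subset_iff)
      also have "\<dots> \<le> (1 / lam) ^ m * (s ^ m) ^ p"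
      proof (intro mult_left_mono order_trans[OF B(8)[OF len(2)]])
        show "\<omega> v \<le> (s ^ m) ^ p" using n1 len by (simp add: \<omega>_def max_absorb2)
      qed (use lam0 in simp)
      finally have "anorm B (word_product B (map snd ws)) \<le> (1 / lam) ^ m * (s ^ m) ^ p" .
      moreover have "anorm A (word_product A (map fst ws)) \<le> s ^ m"
        using n1 by (simp add: v(1) nrm_def o_def)
      moreover have "0 \<le> anorm B (word_product B (map snd ws))"
        using b by (intro B.anorm_nonneg B.word_product_closed) (auto simp: v(1))
      ultimately show ?thesis using s by (intro mult_mono) auto
    qed
    then have "anorm AT (word_product AT (replicate m (ts (?l [1..<Suc k])))) \<le> real (length (?l [1..<Suc k])) ^ m * ?c"
      by (rule anorm_power_le_card[OF rep m])
    also have "\<dots> = (real k * s ^ Suc p / lam) ^ m"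
    proof -
      have "(s ^ m) ^ p = (s ^ p) ^ m" by (simp add: mult.commute flip: power_mult)
      then show ?thesis by (simp add: power_mult_distrib power_divide field_simps del: upt_Suc)
    qed
    finally have "anorm AB (word_product AB (replicate m T1))
      \<le> (real k * s ^ Suc p / lam) ^ m"
      unfolding T1_def projective_tensor_def by (rule AT.completion_power_le[OF CS m])
    also have "\<dots> < 1"
    proof -
      have "real k * s ^ Suc p / lam < 1" "0 \<le> real k * s ^ Suc p / lam" using lam lam0 s by auto
      then show ?thesis using m by (simp add: power_less_one_iff)
    qed
    finally show ?thesis .
  qed
  let ?J = "(\<lambda>y. y \<ominus>\<^bsub>AB\<^esub> y \<otimes>\<^bsub>AB\<^esub> T) ` carrier AB"
  have J: "left_ideal AB ?J" by (rule P.left_ideal_diffs[OF PT(1)])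
  have "?J = carrier AB"
  proof (rule ccontr)
    assume ne: "?J \<noteq> carrier AB"
    have "modular_left_ideal AB ?J"
      unfolding modular_left_ideal_def using J PT(1) by blast
    then obtain L where L: "maximal_modular_left_ideal AB L" "?J \<subseteq> L"
      using P.modular_left_ideal_below_maximal ne by blast
    have Li: "left_ideal AB L" "L \<noteq> carrier AB"
      using L(1) by (auto simp: maximal_modular_left_ideal_def modular_left_ideal_def)
    have ZL: "Z \<in> L" using Zrad L(1) by (simp add: jacobson_radical_def)
    have "L = carrier AB"
    proof (rule P.left_ideal_eq_carrier[OF Li(1) PT(2) _ m T1_small])
      fix y assume y: "y \<in> carrier AB"
      have "y \<otimes>\<^bsub>AB\<^esub> T =
        y \<otimes>\<^bsub>AB\<^esub> Z \<oplus>\<^bsub>AB\<^esub> y \<otimes>\<^bsub>AB\<^esub> T1"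
        unfolding \<open>T = Z \<oplus>\<^bsub>AB\<^esub> T1\<close> using y PT by (intro P.mult_add_right)
      then have e: "(y \<ominus>\<^bsub>AB\<^esub> y \<otimes>\<^bsub>AB\<^esub> T)
        \<oplus>\<^bsub>AB\<^esub> y \<otimes>\<^bsub>AB\<^esub> Z
        = y \<ominus>\<^bsub>AB\<^esub> y \<otimes>\<^bsub>AB\<^esub> T1"
        using y PT by (simp add: P.diff_sum_add)
      have "y \<ominus>\<^bsub>AB\<^esub> y \<otimes>\<^bsub>AB\<^esub> T \<in> L" using L(2) y by blast
      from P.left_ideal_add[OF Li(1) this P.left_ideal_mult[OF Li(1) y ZL]]
      show "y \<ominus>\<^bsub>AB\<^esub> y \<otimes>\<^bsub>AB\<^esub> T1 \<in> L" unfolding e .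
    qed
    then show False using Li(2) by simp
  qed
  then have "T \<in> ?J" using PT(1) by simp
  then obtain Y where Y: "T = Y \<ominus>\<^bsub>AB\<^esub> Y \<otimes>\<^bsub>AB\<^esub> T"
    "Y \<in> carrier AB" by (rule imageE)
  have "T \<oplus>\<^bsub>AB\<^esub> Y \<otimes>\<^bsub>AB\<^esub> T = Y"
    by (subst (1) Y(1)) (use Y(2) PT(1) in simp)
  then obtain C where C: "C \<ge> 0" "\<And>w. w \<noteq> [] \<Longrightarrow> set w \<subseteq> set [0..<Suc k] \<Longrightarrow>
    cmod c ^ length w * anorm A (word_product A (map x w)) * \<omega> w \<le> C"
    using coefficient_bound[of x e g \<omega> "[0..<Suc k]" Y c, OF x B(2) B(3) weight_pos B(4) B(5) B(6) B(7)
      distinct_upt Y(2)] unfolding T_def by blast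
  have "anorm A (word_product A (map x w)) ^ Suc p \<le> C * lam ^ length w"
    if w: "w \<noteq> []" "set w \<subseteq> {..k}" for w
  proof -
    have "(1 / lam) ^ length w * nrm w * \<omega> w \<le> C"
      using C(2)[OF w(1)] w(2) by (simp add: c nrm_def atLeast0LessThan lessThan_Suc_atMost del: upt_Suc)
    then have "nrm w * \<omega> w \<le> C * lam ^ length w"
      using lam0 by (simp add: power_divide field_simps)
    moreover have "nrm w * nrm w ^ p \<le> nrm w * \<omega> w"
      using w(1) nrm0[of w] by (intro mult_left_mono) (auto simp: \<omega>_def intro: power_mono)
    ultimately show ?thesis by (simp add: nrm_def)
  qed
  then show ?thesis by blast
qed

text \<open>
  The bound on words gives \<open>\<rho>^(p+1) \<le> (k+1) s^(p+1)\<close> for every \<open>p\<close>, with \<open>\<rho>\<close> the joint spectral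
  radius of the larger set. A number whose powers are all bounded by \<open>k+1\<close> is at most \<open>1\<close>; apply
  this to \<open>\<rho> / s\<close>.
\<close>

theorem tensor_radical_subset_R_f:
  assumes A: "banach_algebra A" and universe: "\<exists>r :: real \<Rightarrow> 'u. inj r"
  shows "tensor_radical TYPE('u) A \<subseteq> R_f A"
proof
  fix a assume a: "a \<in> tensor_radical TYPE('u) A"
  interpret A: banach_algebra A by fact
  have ac: "a \<in> carrier A" using a by (simp add: tensor_radical_def)
  obtain r :: "real \<Rightarrow> 'u" where r: "inj r" using universe by blast
  have "joint_spectral_radius A ({a} \<union> M) = joint_spectral_radius A M" if M: "M \<in> finite_sets A" for M
  proof (rule antisym)
    have Mc: "M \<subseteq> carrier A" "M \<noteq> {}" "finite M" using M by (auto simp: finite_sets_def)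
    let ?N = "{a} \<union> M"
    have N: "?N \<subseteq> carrier A" "?N \<noteq> {}" "finite ?N" using Mc ac by auto
    define K where "K = Max (anorm A ` ?N)"
    have K: "anorm A y \<le> K" if "y \<in> ?N" for y
      unfolding K_def using that N(3) by (intro Max_ge) auto
    then have KM: "anorm A y \<le> K" if "y \<in> M" for y using that by blast
    show "joint_spectral_radius A M \<le> joint_spectral_radius A ?N"
      by (rule A.joint_spectral_radius_mono[OF Mc(2) _ N(1) K]) auto
    show "joint_spectral_radius A ?N \<le> joint_spectral_radius A M"
    proof (rule dense_ge)
      fix s assume s: "joint_spectral_radius A M < s"
      then have s0: "s > 0" using A.joint_spectral_radius_nonneg[OF Mc(1,2) KM] by linarith
      obtain m where m: "m \<ge> 1" "\<And>ws. length ws = m \<Longrightarrow> set ws \<subseteq> M \<Longrightarrow> anorm A (word_product A ws) \<le> s ^ m"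
        using A.joint_spectral_radius_lessD[OF Mc(1,2) KM s] by blast
      let ?k = "card M"
      obtain f where f: "bij_betw f {1..?k} M" using ex_bij_betw_nat_finite_1[OF Mc(3)] by blast
      define x where "x i = (if i \<in> {1..?k} then f i else a)" for i
      have x0: "x 0 = a" by (simp add: x_def)
      have xM: "x ` {1..?k} = M" using f unfolding x_def bij_betw_def by (simp cong: image_cong_simp)
      have xN: "x ` {..?k} = ?N"
      proof -
        have "{..?k} = insert 0 {1..?k}" by auto
        then show ?thesis using xM x0 by simp
      qed
      have xc: "x i \<in> carrier A" for i using f Mc(1) ac by (auto simp: x_def bij_betw_def)
      let ?\<rho> = "joint_spectral_radius A ?N"
      have \<rho>0: "0 \<le> ?\<rho>" by (rule A.joint_spectral_radius_nonneg[OF N(1,2) K])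
      have key: "?\<rho> ^ Suc p \<le> (real ?k + 1) * s ^ Suc p" for p
      proof -
        define lam where "lam = (real ?k + 1) * s ^ Suc p"
        have lam: "real ?k * s ^ Suc p < lam" "lam > 0" using s0 by (simp_all add: lam_def)
        obtain C where C: "\<And>w. w \<noteq> [] \<Longrightarrow> set w \<subseteq> {..?k} \<Longrightarrow>
          anorm A (word_product A (map x w)) ^ Suc p \<le> C * lam ^ length w"
          using A.tensor_radical_power_bound[of x, OF xc _ r s0 m(1) _ lam(1)] a m(2) x0 xM by metis
        have "(?\<rho> ^ Suc p / lam) ^ n \<le> C" if n: "n \<ge> 1" for n
        proof -
          have "?\<rho> ^ n \<le> root (Suc p) (C * lam ^ n)"
          proof (rule A.joint_spectral_radius_power_le[OF N(1,2) K n])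
            fix ws assume ws: "length ws = n" "set ws \<subseteq> ?N"
            then have "ws \<in> lists (x ` {..?k})" by (simp add: lists_eq_set xN)
            then obtain w where w: "ws = map x w" "set w \<subseteq> {..?k}" unfolding lists_image by (auto simp: lists_eq_set)
            have "w \<noteq> []" "length w = n" using ws w n by auto
            then have "anorm A (word_product A ws) ^ Suc p \<le> C * lam ^ n" using C[of w] w by simp
            then have "root (Suc p) (anorm A (word_product A ws) ^ Suc p) \<le> root (Suc p) (C * lam ^ n)"
              by (intro real_root_le_mono) auto
            moreover have "0 \<le> anorm A (word_product A ws)"
              using ws N(1) by (intro A.anorm_nonneg A.word_product_closed) auto
            ultimately show "anorm A (word_product A ws) \<le> root (Suc p) (C * lam ^ n)"
              by (simp add: real_root_power_cancel del: power_Suc)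
          qed
          then have le: "(?\<rho> ^ n) ^ Suc p \<le> root (Suc p) (C * lam ^ n) ^ Suc p"
            using \<rho>0 by (intro power_mono) auto
          have "0 \<le> C * lam ^ n"
          proof -
            have "0 \<le> anorm A (word_product A (map x (replicate n 0))) ^ Suc p"
              using xc by (intro zero_le_power A.anorm_nonneg A.word_product_closed) auto
            also have "\<dots> \<le> C * lam ^ n" using C[of "replicate n 0"] n by auto
            finally show ?thesis .
          qed
          then have "(?\<rho> ^ n) ^ Suc p \<le> C * lam ^ n" using le by (simp add: real_root_pow_pos2 del: power_Suc)
          moreover have "(?\<rho> ^ n) ^ Suc p = (?\<rho> ^ Suc p) ^ n"
            by (simp add: mult.commute flip: power_mult del: power_Suc)
          ultimately have "(?\<rho> ^ Suc p) ^ n / lam ^ n \<le> C"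
            using lam(2) by (simp add: pos_divide_le_eq del: power_Suc)
          then show ?thesis by (simp add: power_divide del: power_Suc)
        qed
        then have "?\<rho> ^ Suc p / lam \<le> 1" by (rule le_one_if_powers_bounded)
        then show ?thesis using lam(2) by (simp add: lam_def pos_divide_le_eq del: power_Suc)
      qed
      have "(?\<rho> / s) ^ n \<le> real ?k + 1" if n: "n \<ge> 1" for n
        using key[of "n - 1"] n s0 by (simp add: power_divide pos_divide_le_eq del: power_Suc)
      then have "?\<rho> / s \<le> 1" by (rule le_one_if_powers_bounded)
      then show "?\<rho> \<le> s" using s0 by (simp add: pos_divide_le_eq)
    qed
  qed
  then show "a \<in> R_f A" using ac by (simp add: R_f_def)
qed

theorem corollary4p30:
  fixes A :: "'a nalg"
  assumes "banach_algebra A"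
    and universe: "\<exists>f :: real \<Rightarrow> 'u. inj f"
  shows "R_c A \<subseteq> tensor_radical TYPE('u) A \<and> tensor_radical TYPE('u) A \<subseteq> R_f A"
  using R_c_subset_tensor_radical[OF assms(1)] tensor_radical_subset_R_f[OF assms] by blast

end
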